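(* $(A,\ell)$-Path Packing is fixed-parameter tractable when parameterized by $\mathsf{cvd}+\ell$. That is, there is an algorithm solving it in time $f(\mathsf{cvd}(G)+\ell)\cdot |V(G)|^{O(1)}$ for some computable function $f$.
   Context: For an undirected graph $G$ and $A\subseteq V(G)$, an $A$-path is a path in $G$ that starts and ends at two distinct vertices of $A$ and whose internal vertices all lie in $V(G)\setminus A$. The problem $(A,\ell)$-Path Packing takes as input an undirected graph $G$, a set $A\subseteq V(G)$ and integers $k,\ell$. It asks whether $G$ contains $k$ pairwise vertex-disjoint $A$-paths, each of length exactly $\ell$. The cluster vertex deletion number $\mathsf{cvd}(G)$ is the minimum number of vertices whose deletion from $G$ leaves a disjoint union of cliques. *)

theory Defs
  imports Main "HOL-Library.Disjoint_Sets"
begin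

section \<open>Graphs and paths\<close>

definition simple_graph :: "'a set \<Rightarrow> 'a set set \<Rightarrow> bool" where
  "simple_graph V E \<longleftrightarrow> finite V \<and> E \<subseteq> {e. e \<subseteq> V \<and> card e = 2}"

text \<open>A path is given by the list of its vertices in order; its length is its number of edges.\<close>

definition is_path :: "'a set \<Rightarrow> 'a set set \<Rightarrow> 'a list \<Rightarrow> bool" where
  "is_path V E p \<longleftrightarrow> p \<noteq> [] \<and> set p \<subseteq> V \<and> distinct p \<and>
     (\<forall>i. Suc i < length p \<longrightarrow> {p ! i, p ! Suc i} \<in> E)"

definition path_length :: "'a list \<Rightarrow> nat" where
  "path_length p = length p - 1"

definition is_A_path :: "'a set \<Rightarrow> 'a set set \<Rightarrow> 'a set \<Rightarrow> 'a list \<Rightarrow> bool" where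
  "is_A_path V E A p \<longleftrightarrow> is_path V E p \<and> hd p \<in> A \<and> last p \<in> A \<and> hd p \<noteq> last p \<and>
     (\<forall>i. 0 < i \<and> i < length p - 1 \<longrightarrow> p ! i \<in> V - A)"

definition A_path_packing :: "'a set \<Rightarrow> 'a set set \<Rightarrow> 'a set \<Rightarrow> nat \<Rightarrow> nat \<Rightarrow> bool" where
  "A_path_packing V E A k l \<longleftrightarrow>
     (\<exists>P. length P = k \<and> (\<forall>p\<in>set P. is_A_path V E A p \<and> path_length p = l) \<and>
          (\<forall>i<k. \<forall>j<k. i \<noteq> j \<longrightarrow> set (P ! i) \<inter> set (P ! j) = {}))"

section \<open>Cluster vertex deletion number\<close>

definition cluster_graph :: "'a set \<Rightarrow> 'a set set \<Rightarrow> bool" where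
  "cluster_graph V E \<longleftrightarrow>
     (\<exists>\<C>. partition_on V \<C> \<and> E = {{u, v} | u v. u \<noteq> v \<and> (\<exists>C\<in>\<C>. u \<in> C \<and> v \<in> C)})"

definition cvd :: "'a set \<Rightarrow> 'a set set \<Rightarrow> nat" where
  "cvd V E = (LEAST d. \<exists>S\<subseteq>V. card S = d \<and> cluster_graph (V - S) {e \<in> E. e \<subseteq> V - S})"

section \<open>Machine model\<close>

text \<open>
  Algorithms are structured programs of a random access machine over the natural numbers. The
  state consists of scalar registers and of arrays (first index: the array, second index: the
  cell). The operands of an instruction are register and array names, so a program uses only
  finitely many registers and arrays; array cells are addressed indirectly, through a register.
  Every instruction and every test takes one time unit. As the only arithmetic is addition and
  truncated subtraction, unit cost agrees with Turing machine time up to a polynomial; a unit-cost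
  multiplication would destroy this.
\<close>

datatype program =
    Skip
  | SetConst nat nat
  | Plus nat nat nat
  | Minus nat nat nat
  | Load nat nat nat
  | Store nat nat nat
  | Seq program program
  | Cond nat program program
  | While nat program

type_synonym state = "(nat \<Rightarrow> nat) \<times> (nat \<Rightarrow> nat \<Rightarrow> nat)"

text \<open>\<open>exec c s t s'\<close>: started in \<open>s\<close>, the program \<open>c\<close> halts in \<open>s'\<close> after exactly \<open>t\<close> steps.\<close>

inductive exec :: "program \<Rightarrow> state \<Rightarrow> nat \<Rightarrow> state \<Rightarrow> bool" where
  Skip: "exec Skip s 1 s"
| SetConst: "exec (SetConst x n) (r, m) 1 (r(x := n), m)"
| Plus: "exec (Plus x y z) (r, m) 1 (r(x := r y + r z), m)"
| Minus: "exec (Minus x y z) (r, m) 1 (r(x := r y - r z), m)"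
| Load: "exec (Load x a y) (r, m) 1 (r(x := m a (r y)), m)"
| Store: "exec (Store a y z) (r, m) 1 (r, m(a := (m a)(r y := r z)))"
| Seq: "exec c1 s1 t1 s2 \<Longrightarrow> exec c2 s2 t2 s3 \<Longrightarrow> exec (Seq c1 c2) s1 (t1 + t2) s3"
| CondTrue: "fst s x \<noteq> 0 \<Longrightarrow> exec c1 s t s' \<Longrightarrow> exec (Cond x c1 c2) s (Suc t) s'"
| CondFalse: "fst s x = 0 \<Longrightarrow> exec c2 s t s' \<Longrightarrow> exec (Cond x c1 c2) s (Suc t) s'"
| WhileFalse: "fst s x = 0 \<Longrightarrow> exec (While x c) s 1 s"
| WhileTrue: "fst s1 x \<noteq> 0 \<Longrightarrow> exec c s1 t1 s2 \<Longrightarrow> exec (While x c) s2 t2 s3 \<Longrightarrow>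
    exec (While x c) s1 (Suc (t1 + t2)) s3"

inductive_cases SkipE: "exec Skip s t s'"
inductive_cases SetConstE: "exec (SetConst x n) s t s'"
inductive_cases PlusE: "exec (Plus x y z) s t s'"
inductive_cases MinusE: "exec (Minus x y z) s t s'"
inductive_cases LoadE: "exec (Load x a y) s t s'"
inductive_cases StoreE: "exec (Store a y z) s t s'"
inductive_cases SeqE: "exec (Seq c1 c2) s t s'"
inductive_cases CondE: "exec (Cond x c1 c2) s t s'"
inductive_cases WhileE: "exec (While x c) s t s'"

lemma exec_deterministic:
  "exec c s t s' \<Longrightarrow> exec c s u s'' \<Longrightarrow> u = t \<and> s'' = s'"
proof (induction arbitrary: u s'' rule: exec.induct)
  case Skip
  then show ?case by (auto elim: SkipE)
next
  case SetConst
  then show ?case by (auto elim: SetConstE)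
next
  case Plus
  then show ?case by (auto elim: PlusE)
next
  case Minus
  then show ?case by (auto elim: MinusE)
next
  case Load
  then show ?case by (auto elim: LoadE)
next
  case Store
  then show ?case by (auto elim: StoreE)
next
  case (Seq c1 s1 t1 s2 c2 t2 s3)
  from Seq.prems obtain u1 r u2 where "exec c1 s1 u1 r" "exec c2 r u2 s''" "u = u1 + u2"
    by (rule SeqE)
  with Seq.IH show ?case by metis
next
  case (CondTrue s x c1 t s' c2)
  from CondTrue.prems CondTrue.hyps obtain u' where "exec c1 s u' s''" "u = Suc u'"
    by (auto elim: CondE)
  with CondTrue.IH show ?case by metis
next
  case (CondFalse s x c2 t s' c1)
  from CondFalse.prems CondFalse.hyps obtain u' where "exec c2 s u' s''" "u = Suc u'"
    by (auto elim: CondE)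
  with CondFalse.IH show ?case by metis
next
  case (WhileFalse s x c)
  from WhileFalse.prems WhileFalse.hyps show ?case by (cases rule: WhileE) auto
next
  case (WhileTrue s1 x c t1 s2 t2 s3)
  from WhileTrue.prems WhileTrue.hyps obtain u1 r u2
    where "exec c s1 u1 r" "exec (While x c) r u2 s''" "u = Suc (u1 + u2)"
    by (cases rule: WhileE) auto
  with WhileTrue.IH show ?case by metis
qed

text \<open>By convention, numerical output is read off register 0.\<close>

definition computable :: "(nat \<Rightarrow> nat) \<Rightarrow> bool" where
  "computable f \<longleftrightarrow>
     (\<exists>c. \<forall>x. \<exists>t s. exec c ((\<lambda>_. 0)(0 := x), \<lambda>_ _. 0) t s \<and> fst s 0 = f x)"

text \<open>
  Initial state for an instance with vertex set \<open>{..<n}\<close>: registers 0, 1, 2 contain \<open>n\<close>, \<open>k\<close>,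
  \<open>l\<close>; array 0 is the characteristic vector of \<open>A\<close> and array 1 the row-major adjacency matrix.
\<close>

definition input :: "nat \<Rightarrow> nat set set \<Rightarrow> nat set \<Rightarrow> nat \<Rightarrow> nat \<Rightarrow> state" where
  "input n E A k l =
     ((\<lambda>_. 0)(0 := n, 1 := k, 2 := l),
      (\<lambda>_ _. 0)
        (0 := (\<lambda>v. if v \<in> A then 1 else 0),
         1 := (\<lambda>i. if i < n * n \<and> {i div n, i mod n} \<in> E then 1 else 0)))"

end

theory Submission
  imports Defs
begin

text \<open>
  A greedy scan selects vertex-disjoint induced paths on three vertices. Their vertex set \<open>S\<close>
  satisfies \<open>|S| \<le> 3 cvd\<close>, since a solution hits each of them, and \<open>G - S\<close> is a disjoint union of
  cliques. At most \<open>|S|\<close> of the paths in a packing meet \<open>S\<close>; they have \<open>D = |S|(l + 1)\<close> slots in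
  total, and all other paths lie inside a single clique. A dynamic program adds the vertices one by
  one, first \<open>S\<close>, then clique by clique, and puts each of them into a compatible slot or leaves it
  free. Its states record, for each slot, whether it is empty, or which vertex of \<open>S\<close> it holds,
  or whether it holds a vertex of the current clique or of an earlier one, so that there are
  \<open>(|S| + 3)^D\<close> states. When a clique is complete, adjacency of its vertices in consecutive slots is
  automatic, and the number of paths formed by its free vertices is determined by how many of them
  lie in \<open>A\<close>.

  All loops of the algorithm are counting loops, so its running time is bounded by a polynomial of
  fixed degree in the loop bounds: \<open>n\<close> and quantities that depend only on \<open>|S|\<close> and \<open>l\<close>.
\<close>

section \<open>A language with counting loops\<close>

text \<open>The number \<open>k\<close> is not part of the parameter, so a packing cannot be
  enumerated. The table keeps, for each state, the largest number of paths gained, and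
  \<open>k\<close> enters only in the last comparison. A state forgets which clique vertex a slot
  holds. All that still matters about it is whether it belongs to the current clique, because two
  consecutive slots holding vertices outside \<open>S\<close> must come from one clique. Hence three
  digits besides the names of the vertices of \<open>S\<close> suffice, and such adjacencies are
  settled at once when a clique is complete: beside a slot of this clique there may then be only
  slots of the same clique or of \<open>S\<close>. Adjacency with a vertex of \<open>S\<close> needs
  the name of that end, and since \<open>S\<close> is processed before the cliques, the name is
  stored when a clique vertex arrives. A path counts as gained as soon as its starting slot is
  filled, before it is known to be completed; this is repaired by accepting only states without
  half-filled paths.\<close>

datatype expr = Num nat | Reg nat | Cell nat expr | Add expr expr | Sub expr expr

datatype cmd = SkipC | Assign nat expr | Update nat expr expr
  | SeqC cmd cmd (infixr \<open>;;\<close> 60)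
  | If expr cmd cmd
  | For nat nat cmd

definition setr :: "nat \<Rightarrow> nat \<Rightarrow> state \<Rightarrow> state" where
  "setr x i s = ((fst s)(x := i), snd s)"

definition seta :: "nat \<Rightarrow> nat \<Rightarrow> nat \<Rightarrow> state \<Rightarrow> state" where
  "seta a i w s = (fst s, (snd s)(a := (snd s a)(i := w)))"

lemma fst_setr [simp]: "fst (setr x i s) = (fst s)(x := i)"
  and snd_setr [simp]: "snd (setr x i s) = snd s"
  and fst_seta [simp]: "fst (seta a i w s) = fst s"
  and snd_seta [simp]: "snd (seta a i w s) = (snd s)(a := (snd s a)(i := w))"
  by (simp_all add: setr_def seta_def)

primrec eval :: "expr \<Rightarrow> state \<Rightarrow> nat" where
  "eval (Num i) s = i"
| "eval (Reg x) s = fst s x"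
| "eval (Cell a e) s = snd s a (eval e s)"
| "eval (Add e1 e2) s = eval e1 s + eval e2 s"
| "eval (Sub e1 e2) s = eval e1 s - eval e2 s"

definition holds :: "expr \<Rightarrow> state \<Rightarrow> bool" where
  "holds e s \<longleftrightarrow> eval e s \<noteq> 0"

text \<open>Truth is being nonzero, so truncated subtraction gives both negation and the order
  tests. True values need not be 1, hence \<open>Iff_expr\<close> compares the negations, which are
  0 or 1.\<close>

definition Not_expr where "Not_expr e = Sub (Num 1) e"
definition Less_expr where "Less_expr e1 e2 = Sub e2 e1"
definition Le_expr where "Le_expr e1 e2 = Sub (Add e2 (Num 1)) e1"
definition Eq_expr where "Eq_expr e1 e2 = Not_expr (Add (Sub e1 e2) (Sub e2 e1))"
definition Or_expr where "Or_expr e1 e2 = Add e1 e2"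
definition And_expr where "And_expr e1 e2 = Not_expr (Or_expr (Not_expr e1) (Not_expr e2))"
definition Imp_expr where "Imp_expr e1 e2 = Or_expr (Not_expr e1) e2"
definition Iff_expr where "Iff_expr e1 e2 = Eq_expr (Not_expr e1) (Not_expr e2)"

lemmas bool_expr_defs = Not_expr_def Less_expr_def Le_expr_def Eq_expr_def Or_expr_def
  And_expr_def Imp_expr_def Iff_expr_def

lemma holds_simps [simp]:
  "holds (Not_expr e) s \<longleftrightarrow> \<not> holds e s"
  "holds (Less_expr e1 e2) s \<longleftrightarrow> eval e1 s < eval e2 s"
  "holds (Le_expr e1 e2) s \<longleftrightarrow> eval e1 s \<le> eval e2 s"
  "holds (Eq_expr e1 e2) s \<longleftrightarrow> eval e1 s = eval e2 s"
  "holds (Or_expr e1 e2) s \<longleftrightarrow> holds e1 s \<or> holds e2 s"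
  "holds (And_expr e1 e2) s \<longleftrightarrow> holds e1 s \<and> holds e2 s"
  "holds (Imp_expr e1 e2) s \<longleftrightarrow> (holds e1 s \<longrightarrow> holds e2 s)"
  "holds (Iff_expr e1 e2) s \<longleftrightarrow> (holds e1 s \<longleftrightarrow> holds e2 s)"
  "holds (Reg x) s \<longleftrightarrow> fst s x \<noteq> 0"
  "holds (Cell a e) s \<longleftrightarrow> snd s a (eval e s) \<noteq> 0"
  by (auto simp: holds_def bool_expr_defs)

primrec iter :: "(state \<Rightarrow> state) \<Rightarrow> nat \<Rightarrow> nat \<Rightarrow> state \<Rightarrow> state" where
  "iter F x 0 s = s"
| "iter F x (Suc i) s = F (setr x i (iter F x i s))"

text \<open>The loop bound \<open>fst s y\<close> is read once, at entry, and the counter register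
  is reset from the round number before each round. Every command therefore terminates, and
  \<open>sem\<close> is a total function.\<close>

primrec sem :: "cmd \<Rightarrow> state \<Rightarrow> state" where
  "sem SkipC = (\<lambda>s. s)"
| "sem (Assign x e) = (\<lambda>s. setr x (eval e s) s)"
| "sem (Update a e1 e2) = (\<lambda>s. seta a (eval e1 s) (eval e2 s) s)"
| "sem (c1 ;; c2) = (\<lambda>s. sem c2 (sem c1 s))"
| "sem (If e c1 c2) = (\<lambda>s. if holds e s then sem c1 s else sem c2 s)"
| "sem (For x y c) = (\<lambda>s. iter (sem c) x (fst s y) s)"

primrec expr_regs :: "expr \<Rightarrow> nat set" where
  "expr_regs (Num i) = {}"
| "expr_regs (Reg x) = {x}"
| "expr_regs (Cell a e) = expr_regs e"
| "expr_regs (Add e1 e2) = expr_regs e1 \<union> expr_regs e2"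
| "expr_regs (Sub e1 e2) = expr_regs e1 \<union> expr_regs e2"

primrec cmd_regs :: "cmd \<Rightarrow> nat set" where
  "cmd_regs SkipC = {}"
| "cmd_regs (Assign x e) = insert x (expr_regs e)"
| "cmd_regs (Update a e1 e2) = expr_regs e1 \<union> expr_regs e2"
| "cmd_regs (c1 ;; c2) = cmd_regs c1 \<union> cmd_regs c2"
| "cmd_regs (If e c1 c2) = expr_regs e \<union> cmd_regs c1 \<union> cmd_regs c2"
| "cmd_regs (For x y c) = {x, y} \<union> cmd_regs c"

primrec rmods :: "cmd \<Rightarrow> nat set" where
  "rmods SkipC = {}"
| "rmods (Assign x e) = {x}"
| "rmods (Update a e1 e2) = {}"
| "rmods (c1 ;; c2) = rmods c1 \<union> rmods c2"
| "rmods (If e c1 c2) = rmods c1 \<union> rmods c2"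
| "rmods (For x y c) = insert x (rmods c)"

primrec amods :: "cmd \<Rightarrow> nat set" where
  "amods SkipC = {}"
| "amods (Assign x e) = {}"
| "amods (Update a e1 e2) = {a}"
| "amods (c1 ;; c2) = amods c1 \<union> amods c2"
| "amods (If e c1 c2) = amods c1 \<union> amods c2"
| "amods (For x y c) = amods c"

section \<open>Frame properties and the loop rule\<close>

lemma frame_iter_reg:
  assumes "\<And>s. fst (F s) z = fst s z" "z \<noteq> x"
  shows "fst (iter F x i s) z = fst s z"
  using assms by (induction i) auto

lemma frame_iter_arr:
  assumes "\<And>s. snd (F s) a = snd s a"
  shows "snd (iter F x i s) a = snd s a"
  using assms by (induction i) auto

lemma frame_reg: "z \<notin> rmods c \<Longrightarrow> fst (sem c s) z = fst s z"
  by (induction c arbitrary: s) (auto simp: frame_iter_reg)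

lemma frame_arr: "a \<notin> amods c \<Longrightarrow> snd (sem c s) a = snd s a"
  by (induction c arbitrary: s) (auto simp: frame_iter_arr)

text \<open>Induction over the rounds. The frame facts for \<open>s'\<close> are handed to the step,
  so an invariant \<open>I\<close> only has to describe what the body changes.\<close>

lemma For_rule:
  assumes "I 0 s"
    and "\<And>i s'. i < fst s y \<Longrightarrow> I i s' \<Longrightarrow>
      (\<And>z. z \<notin> insert x (rmods c) \<Longrightarrow> fst s' z = fst s z) \<Longrightarrow>
      (\<And>a. a \<notin> amods c \<Longrightarrow> snd s' a = snd s a) \<Longrightarrow>
      I (Suc i) (sem c (setr x i s'))"
  shows "I (fst s y) (sem (For x y c) s)"
proof -
  have "i \<le> fst s y \<Longrightarrow> I i (iter (sem c) x i s)" for i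
  proof (induction i)
    case (Suc i)
    then show ?case
      using assms(2)[of i "iter (sem c) x i s"]
      by (simp add: frame_iter_reg frame_iter_arr frame_reg frame_arr)
  qed (simp add: assms)
  then show ?thesis by simp
qed

section \<open>Compilation\<close>

text \<open>The value ends up in register \<open>t\<close>; the registers from \<open>t\<close> on
  serve as an evaluation stack. The machine has no move instruction, so copying is addition to a
  zero register.\<close>

primrec compile_expr :: "nat \<Rightarrow> expr \<Rightarrow> program" where
  "compile_expr t (Num i) = SetConst t i"
| "compile_expr t (Reg x) = Seq (SetConst t 0) (Plus t t x)"
| "compile_expr t (Cell a e) = Seq (compile_expr t e) (Load t a t)"
| "compile_expr t (Add e1 e2) =
     Seq (compile_expr t e1) (Seq (compile_expr (Suc t) e2) (Plus t t (Suc t)))"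
| "compile_expr t (Sub e1 e2) =
     Seq (compile_expr t e1) (Seq (compile_expr (Suc t) e2) (Minus t t (Suc t)))"

primrec expr_time :: "expr \<Rightarrow> nat" where
  "expr_time (Num i) = 1"
| "expr_time (Reg x) = 2"
| "expr_time (Cell a e) = expr_time e + 1"
| "expr_time (Add e1 e2) = expr_time e1 + (expr_time e2 + 1)"
| "expr_time (Sub e1 e2) = expr_time e1 + (expr_time e2 + 1)"

text \<open>Register \<open>t\<close> counts the remaining rounds of a loop and \<open>t + 1\<close> the finished ones;
  the body works with registers from \<open>t + 2\<close> on.\<close>

primrec compile :: "nat \<Rightarrow> cmd \<Rightarrow> program" where
  "compile t SkipC = Skip"
| "compile t (Assign x e) = Seq (compile_expr t e) (Seq (SetConst (Suc t) 0) (Plus x t (Suc t)))"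
| "compile t (Update a e1 e2) =
     Seq (compile_expr t e1) (Seq (compile_expr (Suc t) e2) (Store a t (Suc t)))"
| "compile t (c1 ;; c2) = Seq (compile t c1) (compile t c2)"
| "compile t (If e c1 c2) = Seq (compile_expr t e) (Cond t (compile t c1) (compile t c2))"
| "compile t (For x y c) = Seq (SetConst (t + 1) 0) (Seq (Plus t y (t + 1))
     (While t (Seq (SetConst (t + 2) 0) (Seq (Plus x (t + 1) (t + 2)) (Seq (compile (t + 2) c)
       (Seq (SetConst (t + 2) 1) (Seq (Plus (t + 1) (t + 1) (t + 2)) (Minus t t (t + 2)))))))))"

text \<open>For a loop, 3 is the cost of initialising the two counters and of the last, failing
  test; 6 is a successful test plus five bookkeeping instructions per round.\<close>

primrec time :: "cmd \<Rightarrow> state \<Rightarrow> nat" where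
  "time SkipC = (\<lambda>s. 1)"
| "time (Assign x e) = (\<lambda>s. expr_time e + 2)"
| "time (Update a e1 e2) = (\<lambda>s. expr_time e1 + (expr_time e2 + 1))"
| "time (c1 ;; c2) = (\<lambda>s. time c1 s + time c2 (sem c1 s))"
| "time (If e c1 c2) = (\<lambda>s. expr_time e + Suc (if holds e s then time c1 s else time c2 s))"
| "time (For x y c) = (\<lambda>s. 3 + (\<Sum>i<fst s y. 6 + time c (setr x i (iter (sem c) x i s))))"

text \<open>Equality up to scratch registers: code compiled for \<open>t\<close> may write any
  register from \<open>t\<close> on, while the source command mentions only registers below
  \<open>t\<close>.\<close>

definition agree :: "nat \<Rightarrow> state \<Rightarrow> state \<Rightarrow> bool" where
  "agree t s s' \<longleftrightarrow> snd s = snd s' \<and> (\<forall>x<t. fst s x = fst s' x)"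

lemma agree_refl [simp]: "agree t s s"
  by (simp add: agree_def)

lemma agree_trans: "agree t s s' \<Longrightarrow> agree t s' s'' \<Longrightarrow> agree t s s''"
  by (simp add: agree_def)

lemma agree_mono: "agree t s s' \<Longrightarrow> t' \<le> t \<Longrightarrow> agree t' s s'"
  by (simp add: agree_def)

lemma agree_setr: "agree t s s' \<Longrightarrow> agree t (setr x i s) (setr x i s')"
  by (auto simp: agree_def)

lemma agree_eval: "agree t s s' \<Longrightarrow> expr_regs e \<subseteq> {..<t} \<Longrightarrow> eval e s = eval e s'"
  by (induction e) (auto simp: agree_def)

lemma agree_iter:
  assumes "\<And>s s'. agree t s s' \<Longrightarrow> agree t (F s) (F s')" "agree t s s'"
  shows "agree t (iter F x i s) (iter F x i s')"
  by (induction i) (simp_all add: assms agree_setr)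

lemma agree_sem:
  "agree t s s' \<Longrightarrow> cmd_regs c \<subseteq> {..<t} \<Longrightarrow> agree t (sem c s) (sem c s')"
proof (induction c arbitrary: s s')
  case (Assign x e)
  then show ?case using agree_eval[of t s s' e] by (auto simp: agree_setr)
next
  case (Update a e1 e2)
  then show ?case using agree_eval[of t s s' e1] agree_eval[of t s s' e2]
    by (auto simp: agree_def)
next
  case (If e c1 c2)
  then show ?case using agree_eval[of t s s' e] by (auto simp: holds_def)
next
  case (For x y c)
  then have "fst s y = fst s' y" by (auto simp: agree_def)
  with For show ?case by (auto intro!: agree_iter)
qed auto

text \<open>Branches and loop bounds are read from arrays and from registers below \<open>t\<close>.
  Thus the time of a later command can be computed from the abstract state, although the machine
  enters it with other scratch contents.\<close>

lemma agree_time: "agree t s s' \<Longrightarrow> cmd_regs c \<subseteq> {..<t} \<Longrightarrow> time c s = time c s'"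
proof (induction c arbitrary: s s')
  case (SeqC c1 c2)
  then show ?case using agree_sem[of t s s' c1] by simp
next
  case (If e c1 c2)
  then show ?case using agree_eval[of t s s' e] by (auto simp: holds_def)
next
  case (For x y c)
  then have y: "fst s y = fst s' y" by (auto simp: agree_def)
  have "time c (setr x i (iter (sem c) x i s)) = time c (setr x i (iter (sem c) x i s'))" for i
    using For by (intro For.IH agree_setr agree_iter agree_sem) auto
  with y show ?case by simp
qed auto

lemma exec_setr:
  "exec (SetConst x i) s 1 (setr x i s)"
  "exec (Plus x y z) s 1 (setr x (fst s y + fst s z) s)"
  "exec (Minus x y z) s 1 (setr x (fst s y - fst s z) s)"
  "exec (Load x a y) s 1 (setr x (snd s a (fst s y)) s)"
  "exec (Store a y z) s 1 (seta a (fst s y) (fst s z) s)"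
  using exec.SetConst[of x i "fst s" "snd s"] exec.Plus[of x y z "fst s" "snd s"]
    exec.Minus[of x y z "fst s" "snd s"] exec.Load[of x a y "fst s" "snd s"]
    exec.Store[of a y z "fst s" "snd s"]
  by (simp_all add: setr_def seta_def)

text \<open>The second operand is evaluated one register higher, so the first value survives in
  register \<open>t\<close>; this is why \<open>t\<close> varies in the induction.\<close>

lemma exec_compile_expr:
  "expr_regs e \<subseteq> {..<t} \<Longrightarrow>
    \<exists>s'. exec (compile_expr t e) s (expr_time e) s' \<and> agree t s' s \<and> fst s' t = eval e s"
proof (induction e arbitrary: t s)
  case (Num i)
  show ?case using exec_setr(1)[of t i s] by (intro exI[of _ "setr t i s"]) (simp add: agree_def)
next
  case (Reg x)
  then have x: "x < t" by simp
  have "exec (Seq (SetConst t 0) (Plus t t x)) s (1 + 1) (setr t (fst s x) s)"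
    using exec.Seq[OF exec_setr(1)[of t 0 s] exec_setr(2)[of t t x]] x by (simp add: setr_def)
  then show ?case
    by (intro exI[of _ "setr t (fst s x) s"]) (simp add: agree_def numeral_2_eq_2)
next
  case (Cell a e)
  from Cell.prems have "expr_regs e \<subseteq> {..<t}" by simp
  from Cell.IH[OF this] obtain s' where s': "exec (compile_expr t e) s (expr_time e) s'"
    "agree t s' s" "fst s' t = eval e s" by blast
  from exec.Seq[OF s'(1) exec_setr(4)[of t a t]] s'(2,3) show ?case
    by (intro exI[of _ "setr t (snd s' a (fst s' t)) s'"]) (simp add: agree_def)
next
  case (Add e1 e2)
  from Add.prems have "expr_regs e1 \<subseteq> {..<t}" by simp
  from Add.IH(1)[OF this] obtain s1 where s1: "exec (compile_expr t e1) s (expr_time e1) s1"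
    "agree t s1 s" "fst s1 t = eval e1 s" by blast
  from Add.prems have "expr_regs e2 \<subseteq> {..<Suc t}" by auto
  from Add.IH(2)[OF this] obtain s2 where s2: "exec (compile_expr (Suc t) e2) s1 (expr_time e2) s2"
    "agree (Suc t) s2 s1" "fst s2 (Suc t) = eval e2 s1" by blast
  have "eval e2 s1 = eval e2 s" using s1(2) Add.prems by (intro agree_eval) auto
  then show ?case using exec.Seq[OF s1(1) exec.Seq[OF s2(1) exec_setr(2)[of t t "Suc t"]]] s1(2,3) s2(2,3)
    by (intro exI[of _ "setr t (fst s2 t + fst s2 (Suc t)) s2"]) (simp add: agree_def)
next
  case (Sub e1 e2)
  from Sub.prems have "expr_regs e1 \<subseteq> {..<t}" by simp
  from Sub.IH(1)[OF this] obtain s1 where s1: "exec (compile_expr t e1) s (expr_time e1) s1"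
    "agree t s1 s" "fst s1 t = eval e1 s" by blast
  from Sub.prems have "expr_regs e2 \<subseteq> {..<Suc t}" by auto
  from Sub.IH(2)[OF this] obtain s2 where s2: "exec (compile_expr (Suc t) e2) s1 (expr_time e2) s2"
    "agree (Suc t) s2 s1" "fst s2 (Suc t) = eval e2 s1" by blast
  have "eval e2 s1 = eval e2 s" using s1(2) Sub.prems by (intro agree_eval) auto
  then show ?case using exec.Seq[OF s1(1) exec.Seq[OF s2(1) exec_setr(3)[of t t "Suc t"]]] s1(2,3) s2(2,3)
    by (intro exI[of _ "setr t (fst s2 t - fst s2 (Suc t)) s2"]) (simp add: agree_def)
qed

lemma exec_compile:
  "cmd_regs c \<subseteq> {..<t} \<Longrightarrow> \<exists>s'. exec (compile t c) s (time c s) s' \<and> agree t s' (sem c s)"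
proof (induction c arbitrary: t s)
  case SkipC
  then show ?case using exec.Skip[of s] by (intro exI[of _ s]) simp
next
  case (Assign x e)
  then have "expr_regs e \<subseteq> {..<t}" by simp
  from exec_compile_expr[OF this] obtain s1
    where s1: "exec (compile_expr t e) s (expr_time e) s1" "agree t s1 s" "fst s1 t = eval e s"
    by blast
  let ?s2 = "setr (Suc t) 0 s1"
  have "exec (Plus x t (Suc t)) ?s2 1 (setr x (fst s1 t) ?s2)"
    using exec_setr(2)[of x t "Suc t" ?s2] by simp
  then have "exec (compile t (Assign x e)) s (expr_time e + (1 + 1)) (setr x (fst s1 t) ?s2)"
    unfolding compile.simps by (intro exec.Seq[OF s1(1)] exec.Seq[OF exec_setr(1)])
  then show ?case using s1(2,3)
    by (intro exI[of _ "setr x (fst s1 t) ?s2"]) (simp add: agree_def numeral_2_eq_2)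
next
  case (Update a e1 e2)
  then have "expr_regs e1 \<subseteq> {..<t}" by simp
  from exec_compile_expr[OF this] obtain s1
    where s1: "exec (compile_expr t e1) s (expr_time e1) s1" "agree t s1 s" "fst s1 t = eval e1 s"
    by blast
  from Update.prems have "expr_regs e2 \<subseteq> {..<Suc t}" by auto
  from exec_compile_expr[OF this] obtain s2
    where s2: "exec (compile_expr (Suc t) e2) s1 (expr_time e2) s2"
    "agree (Suc t) s2 s1" "fst s2 (Suc t) = eval e2 s1" by blast
  have "eval e2 s1 = eval e2 s" using s1(2) Update.prems by (intro agree_eval) auto
  then show ?case using exec.Seq[OF s1(1) exec.Seq[OF s2(1) exec_setr(5)[of a t "Suc t"]]] s1(2,3) s2(2,3)
    by (intro exI[of _ "seta a (fst s2 t) (fst s2 (Suc t)) s2"]) (simp add: agree_def)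
next
  case (SeqC c1 c2)
  then have regs: "cmd_regs c1 \<subseteq> {..<t}" "cmd_regs c2 \<subseteq> {..<t}" by simp_all
  from SeqC.IH(1)[OF regs(1)] obtain s1 where s1: "exec (compile t c1) s (time c1 s) s1" "agree t s1 (sem c1 s)"
    by blast
  from SeqC.IH(2)[OF regs(2)] obtain s2 where s2: "exec (compile t c2) s1 (time c2 s1) s2" "agree t s2 (sem c2 s1)"
    by blast
  have "agree t (sem c2 s1) (sem c2 (sem c1 s))" using SeqC.prems s1(2) by (auto intro: agree_sem)
  moreover have "time c2 s1 = time c2 (sem c1 s)" using SeqC.prems s1(2) by (auto intro: agree_time)
  ultimately show ?case using exec.Seq[OF s1(1) s2(1)] s2(2)
    by (intro exI[of _ s2]) (auto intro: agree_trans)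
next
  case (If e c1 c2)
  then have regs: "cmd_regs c1 \<subseteq> {..<t}" "cmd_regs c2 \<subseteq> {..<t}" "expr_regs e \<subseteq> {..<t}"
    by simp_all
  from exec_compile_expr[OF regs(3)] obtain s1 where s1: "exec (compile_expr t e) s (expr_time e) s1" "agree t s1 s"
    "fst s1 t = eval e s" by blast
  show ?case
  proof (cases "eval e s = 0")
    case True
    from If.IH(2)[OF regs(2)] obtain s2 where s2: "exec (compile t c2) s1 (time c2 s1) s2" "agree t s2 (sem c2 s1)"
      by blast
    have "agree t (sem c2 s1) (sem c2 s)" using If.prems s1(2) by (auto intro: agree_sem)
    moreover have "time c2 s1 = time c2 s" using If.prems s1(2) by (auto intro: agree_time)
    ultimately show ?thesis using exec.Seq[OF s1(1) exec.CondFalse[OF _ s2(1)]] s1(3) s2(2) True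
      by (intro exI[of _ s2]) (auto simp: holds_def intro: agree_trans)
  next
    case False
    from If.IH(1)[OF regs(1)] obtain s2 where s2: "exec (compile t c1) s1 (time c1 s1) s2" "agree t s2 (sem c1 s1)"
      by blast
    have "agree t (sem c1 s1) (sem c1 s)" using If.prems s1(2) by (auto intro: agree_sem)
    moreover have "time c1 s1 = time c1 s" using If.prems s1(2) by (auto intro: agree_time)
    ultimately show ?thesis using exec.Seq[OF s1(1) exec.CondTrue[OF _ s2(1)]] s1(3) s2(2) False
      by (intro exI[of _ s2]) (auto simp: holds_def intro: agree_trans)
  qed
next
  case (For x y c)
  let ?body = "Seq (SetConst (t + 2) 0) (Seq (Plus x (t + 1) (t + 2)) (Seq (compile (t + 2) c)
       (Seq (SetConst (t + 2) 1) (Seq (Plus (t + 1) (t + 1) (t + 2)) (Minus t t (t + 2))))))"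
  let ?it = "\<lambda>i. iter (sem c) x i s" and ?tm = "\<lambda>i. time c (setr x i (iter (sem c) x i s))"
  have xt: "x < t" "y < t" using For.prems by auto
  \<comment> \<open>Generalised to a loop with \<open>b\<close> rounds left and \<open>j\<close>
    rounds done, which is the situation after each round; the instance needed has
    \<open>j = 0\<close>.\<close>
  have loop: "\<exists>s'. exec (While t ?body) s1 (1 + (\<Sum>i<b. 6 + ?tm (j + i))) s' \<and>
      agree t s' (?it (j + b))"
    if "agree t s1 (?it j)" "fst s1 t = b" "fst s1 (Suc t) = j" for b j s1
    using that
  proof (induction b arbitrary: j s1)
    case 0
    then show ?case using exec.WhileFalse[of s1 t ?body] by (intro exI[of _ s1]) simp
  next
    case (Suc b)
    let ?a = "setr x j (setr (t + 2) 0 s1)"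
    have e2: "exec (Plus x (t + 1) (t + 2)) (setr (t + 2) 0 s1) 1 ?a"
      using exec_setr(2)[of x "t + 1" "t + 2" "setr (t + 2) 0 s1"] Suc.prems by simp
    have "cmd_regs c \<subseteq> {..<t + 2}" using For.prems by auto
    from For.IH[OF this] obtain s2
      where s2: "exec (compile (t + 2) c) ?a (time c ?a) s2" "agree (t + 2) s2 (sem c ?a)"
      by blast
    have ag: "agree t ?a (setr x j (?it j))"
      using Suc.prems(1) by (auto simp: agree_def)
    have t2: "time c ?a = ?tm j" using agree_time[OF ag] For.prems by simp
    \<comment> \<open>The semantics of the body leaves registers from \<open>t\<close> on alone, and
      its compiled form uses scratch registers from \<open>t + 2\<close> on only; so both counters
      survive.\<close>
    have fr: "fst (sem c ?a) z = fst ?a z" if "z \<ge> t" for z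
    proof (rule frame_reg)
      have "rmods c \<subseteq> cmd_regs c" by (induction c) auto
      then show "z \<notin> rmods c" using For.prems that by auto
    qed
    have v: "fst s2 t = Suc b" "fst s2 (Suc t) = j"
      using s2(2) fr[of t] fr[of "Suc t"] Suc.prems xt by (auto simp: agree_def)
    have ag2: "agree t s2 (?it (Suc j))"
      using agree_trans[OF agree_mono[OF s2(2), of t] agree_sem[OF ag]] For.prems by simp
    let ?s3 = "setr t b (setr (t + 1) (Suc j) (setr (t + 2) 1 s2))"
    have e4: "exec (Plus (t + 1) (t + 1) (t + 2)) (setr (t + 2) 1 s2) 1
        (setr (t + 1) (Suc j) (setr (t + 2) 1 s2))"
      using exec_setr(2)[of "t + 1" "t + 1" "t + 2" "setr (t + 2) 1 s2"] v by simp
    have e5: "exec (Minus t t (t + 2)) (setr (t + 1) (Suc j) (setr (t + 2) 1 s2)) 1 ?s3"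
      using exec_setr(3)[of t t "t + 2" "setr (t + 1) (Suc j) (setr (t + 2) 1 s2)"] v by simp
    have bd: "exec ?body s1 (1 + (1 + (?tm j + (1 + (1 + 1))))) ?s3"
      using exec.Seq[OF exec_setr(1) exec.Seq[OF e2 exec.Seq[OF s2(1)[unfolded t2]
          exec.Seq[OF exec_setr(1) exec.Seq[OF e4 e5]]]]] .
    have "agree t ?s3 (?it (Suc j))" using ag2 by (auto simp: agree_def)
    from Suc.IH[OF this] obtain s' where s':
      "exec (While t ?body) ?s3 (1 + (\<Sum>i<b. 6 + ?tm (Suc j + i))) s'"
      "agree t s' (?it (Suc j + b))" by auto
    have "fst s1 t \<noteq> 0" using Suc.prems(2) by simp
    from exec.WhileTrue[OF this bd s'(1)]
    have ex: "exec (While t ?body) s1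
        (Suc (1 + (1 + (?tm j + (1 + (1 + 1)))) + (1 + (\<Sum>i<b. 6 + ?tm (Suc j + i))))) s'" .
    have "(\<Sum>i<Suc b. 6 + ?tm (j + i)) = 6 + ?tm j + (\<Sum>i<b. 6 + ?tm (Suc j + i))"
      unfolding sum.lessThan_Suc_shift by simp
    then have "Suc (1 + (1 + (?tm j + (1 + (1 + 1)))) + (1 + (\<Sum>i<b. 6 + ?tm (Suc j + i)))) =
        1 + (\<Sum>i<Suc b. 6 + ?tm (j + i))"
      by linarith
    with ex have "exec (While t ?body) s1 (1 + (\<Sum>i<Suc b. 6 + ?tm (j + i))) s'" by metis
    moreover have "agree t s' (?it (j + Suc b))" using s'(2) by (metis add_Suc_shift)
    ultimately show ?case by blast
  qed
  let ?s1 = "setr t (fst s y) (setr (t + 1) 0 s)"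
  have e2: "exec (Plus t y (t + 1)) (setr (t + 1) 0 s) 1 ?s1"
    using exec_setr(2)[of t y "t + 1" "setr (t + 1) 0 s"] xt by simp
  have "agree t ?s1 (?it 0)" by (auto simp: agree_def)
  from loop[OF this, where b = "fst s y"] obtain s' where s':
    "exec (While t ?body) ?s1 (1 + (\<Sum>i<fst s y. 6 + ?tm i)) s'" "agree t s' (?it (fst s y))"
    by auto
  show ?case
    using exec.Seq[OF exec_setr(1) exec.Seq[OF e2 s'(1)]] s'(2)
    by (intro exI[of _ s']) (simp add: numeral_3_eq_3)
qed

section \<open>Running time\<close>

primrec loop_regs :: "cmd \<Rightarrow> nat set" where
  "loop_regs SkipC = {}"
| "loop_regs (Assign x e) = {}"
| "loop_regs (Update a e1 e2) = {}"
| "loop_regs (c1 ;; c2) = loop_regs c1 \<union> loop_regs c2"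
| "loop_regs (If e c1 c2) = loop_regs c1 \<union> loop_regs c2"
| "loop_regs (For x y c) = insert y (loop_regs c)"

primrec depth :: "cmd \<Rightarrow> nat" where
  "depth SkipC = 0"
| "depth (Assign x e) = 0"
| "depth (Update a e1 e2) = 0"
| "depth (c1 ;; c2) = max (depth c1) (depth c2)"
| "depth (If e c1 c2) = max (depth c1) (depth c2)"
| "depth (For x y c) = Suc (depth c)"

primrec weight :: "cmd \<Rightarrow> nat" where
  "weight SkipC = 1"
| "weight (Assign x e) = expr_time e + 2"
| "weight (Update a e1 e2) = expr_time e1 + (expr_time e2 + 1)"
| "weight (c1 ;; c2) = weight c1 + weight c2"
| "weight (If e c1 c2) = Suc (expr_time e) + weight c1 + weight c2"
| "weight (For x y c) = 9 + weight c"

text \<open>As the command modifies none of its loop bounds, \<open>M\<close> bounds every round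
  count throughout the run, and each level of nesting costs a factor \<open>M + 1\<close>, where the
  extra 1 pays for the overhead of the loop. The 9 in \<open>weight\<close> is the sum of the loop
  costs 3 and 6.\<close>

lemma time_le:
  assumes "loop_regs c \<inter> rmods c = {}" "\<And>y. y \<in> loop_regs c \<Longrightarrow> fst s y \<le> M"
  shows "time c s \<le> weight c * (M + 1) ^ depth c"
  using assms
proof (induction c arbitrary: s)
  case (SeqC c1 c2)
  have "time c1 s \<le> weight c1 * (M + 1) ^ depth c1" using SeqC by (intro SeqC.IH) auto
  also have "\<dots> \<le> weight c1 * (M + 1) ^ max (depth c1) (depth c2)"
    by (intro mult_left_mono power_increasing) auto
  finally have 1: "time c1 s \<le> weight c1 * (M + 1) ^ max (depth c1) (depth c2)" .
  have "fst (sem c1 s) y \<le> M" if "y \<in> loop_regs c2" for y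
  proof -
    have "y \<notin> rmods c1" using SeqC.prems(1) that by auto
    then show ?thesis using SeqC.prems(2) that by (auto simp: frame_reg)
  qed
  then have "time c2 (sem c1 s) \<le> weight c2 * (M + 1) ^ depth c2"
    using SeqC.prems by (intro SeqC.IH) auto
  also have "\<dots> \<le> weight c2 * (M + 1) ^ max (depth c1) (depth c2)"
    by (intro mult_left_mono power_increasing) auto
  finally show ?case using 1 by (simp add: algebra_simps)
next
  case (If e c1 c2)
  let ?P = "(M + 1) ^ max (depth c1) (depth c2)"
  have "time c1 s \<le> weight c1 * (M + 1) ^ depth c1" using If by (intro If.IH) auto
  also have "\<dots> \<le> weight c1 * ?P"
    by (intro mult_left_mono power_increasing) auto
  finally have 1: "time c1 s \<le> weight c1 * ?P" .
  have "time c2 s \<le> weight c2 * (M + 1) ^ depth c2" using If by (intro If.IH) auto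
  also have "\<dots> \<le> weight c2 * ?P"
    by (intro mult_left_mono power_increasing) auto
  finally have 2: "time c2 s \<le> weight c2 * ?P" .
  have "1 \<le> ?P" by simp
  then have 3: "Suc (expr_time e) \<le> Suc (expr_time e) * ?P"
    by (metis mult.right_neutral mult_le_mono2)
  have "time (If e c1 c2) s \<le> Suc (expr_time e) + weight c1 * ?P + weight c2 * ?P"
    using 1 2 by auto
  also have "\<dots> \<le> Suc (expr_time e) * ?P + weight c1 * ?P + weight c2 * ?P"
    using 3 by linarith
  finally show ?case by (simp add: algebra_simps)
next
  case (For x y c)
  let ?P = "(M + 1) ^ depth c"
  have P: "1 \<le> ?P" by simp
  have "time c (setr x i (iter (sem c) x i s)) \<le> weight c * ?P" for i
  proof (rule For.IH)
    show "loop_regs c \<inter> rmods c = {}" using For.prems by auto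
    fix z assume z: "z \<in> loop_regs c"
    then have "z \<notin> insert x (rmods c)" using For.prems by auto
    then show "fst (setr x i (iter (sem c) x i s)) z \<le> M"
      using For.prems(2) z by (auto simp: frame_iter_reg frame_reg)
  qed
  then have "(\<Sum>i<fst s y. 6 + time c (setr x i (iter (sem c) x i s)))
      \<le> (\<Sum>i<fst s y. 6 + weight c * ?P)"
    by (intro sum_mono) simp
  also have "\<dots> \<le> M * (6 + weight c * ?P)" using For.prems(2)[of y] by auto
  also have "\<dots> \<le> M * (6 * ?P + weight c * ?P)" using P by (intro mult_left_mono) auto
  finally have "time (For x y c) s \<le> 3 + M * (6 * ?P + weight c * ?P)" by simp
  also have "\<dots> \<le> 3 * ?P + M * (6 * ?P + weight c * ?P)" using P by linarith
  also have "\<dots> \<le> (9 + weight c) * (M + 1) ^ depth (For x y c)"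
    by (simp add: algebra_simps)
  finally show ?case by simp
qed auto

section \<open>Radix representation\<close>

definition radix_sum :: "nat \<Rightarrow> nat \<Rightarrow> (nat \<Rightarrow> nat) \<Rightarrow> nat" where
  "radix_sum b d X = (\<Sum>j<d. X j * b ^ j)"

lemma radix_sum_0 [simp]: "radix_sum b 0 X = 0"
  by (simp add: radix_sum_def)

lemma radix_sum_Suc: "radix_sum b (Suc d) X = X 0 + b * radix_sum b d (\<lambda>j. X (Suc j))"
  unfolding radix_sum_def sum.lessThan_Suc_shift by (simp add: sum_distrib_left algebra_simps)

lemma radix_sum_less: "(\<And>j. X j < b) \<Longrightarrow> radix_sum b d X < b ^ d"
proof (induction d arbitrary: X)
  case (Suc d)
  have "radix_sum b d (\<lambda>j. X (Suc j)) < b ^ d" by (rule Suc.IH) (rule Suc.prems)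
  then have "Suc (radix_sum b d (\<lambda>j. X (Suc j))) \<le> b ^ d" by simp
  then have "b * Suc (radix_sum b d (\<lambda>j. X (Suc j))) \<le> b * b ^ d" by (rule mult_le_mono2)
  then show ?case using Suc.prems[of 0] by (simp add: radix_sum_Suc)
qed simp

lemma radix_sum_digit: "(\<And>j. X j < b) \<Longrightarrow> j < d \<Longrightarrow> radix_sum b d X div b ^ j mod b = X j"
proof (induction d arbitrary: X j)
  case (Suc d)
  show ?case
  proof (cases j)
    case 0
    then show ?thesis using Suc.prems(1)[of 0] by (simp add: radix_sum_Suc)
  next
    case (Suc i)
    have "b \<noteq> 0" using Suc.prems(1)[of 0] by auto
    then have "radix_sum b (Suc d) X div b = radix_sum b d (\<lambda>j. X (Suc j))"
      using Suc.prems(1)[of 0] by (simp add: radix_sum_Suc)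
    then show ?thesis using Suc.IH[of "\<lambda>j. X (Suc j)" i] Suc.prems Suc
      by (simp add: div_mult2_eq)
  qed
qed simp

section \<open>Paths of fixed length\<close>

locale instance_graph =
  fixes n l :: nat and E :: "nat set set" and A S :: "nat set"
  assumes graph: "simple_graph {..<n} E" and l_pos: "0 < l" and S: "S \<subseteq> {..<n}"
begin

abbreviation adj :: "nat \<Rightarrow> nat \<Rightarrow> bool" where "adj u v \<equiv> {u, v} \<in> E"

lemma adj_sym: "adj u v \<Longrightarrow> adj v u" by (simp add: insert_commute)

lemma finite_S [simp]: "finite S"
  using S finite_subset by blast

text \<open>Positional form: whether a vertex of the path lies in \<open>A\<close> depends on its
  index alone, which is what a slot knows. For \<open>l = 0\<close> a single vertex would qualify
  although an \<open>A\<close>-path needs distinct ends; that length is treated separately.\<close>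

definition lpath :: "nat list \<Rightarrow> bool" where
  "lpath q \<longleftrightarrow> length q = Suc l \<and> set q \<subseteq> {..<n} \<and> distinct q \<and>
     (\<forall>i<l. adj (q ! i) (q ! Suc i)) \<and> (\<forall>i\<le>l. q ! i \<in> A \<longleftrightarrow> i = 0 \<or> i = l)"

lemma lpath_iff: "lpath q \<longleftrightarrow> is_A_path {..<n} E A q \<and> path_length q = l"
proof
  assume q: "lpath q"
  then have len: "length q = Suc l" and ne: "q \<noteq> []" and d: "distinct q" and sub: "set q \<subseteq> {..<n}"
    and e: "\<And>i. i < l \<Longrightarrow> adj (q ! i) (q ! Suc i)" and A: "\<And>i. i \<le> l \<Longrightarrow> q ! i \<in> A \<longleftrightarrow> i = 0 \<or> i = l"
    by (auto simp: lpath_def)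
  have hl: "hd q = q ! 0" "last q = q ! l" using ne len by (simp_all add: hd_conv_nth last_conv_nth)
  moreover have "q ! 0 \<noteq> q ! l"
    using nth_eq_iff_index_eq[OF d, of 0 l] len l_pos by simp
  moreover have "q ! i \<in> {..<n}" if "i \<le> l" for i
    using sub len nth_mem[of i q] that by (metis less_Suc_eq_le subsetD)
  ultimately have "is_A_path {..<n} E A q"
    unfolding is_A_path_def is_path_def using ne sub d e A[of 0] A[of l] A len by simp
  then show "is_A_path {..<n} E A q \<and> path_length q = l" using len by (simp add: path_length_def)
next
  assume q: "is_A_path {..<n} E A q \<and> path_length q = l"
  then have ne: "q \<noteq> []" by (simp add: is_A_path_def is_path_def)
  have "length q \<noteq> 0" "length q - 1 = l" using q ne by (simp_all add: path_length_def)
  then have len: "length q = Suc l" by linarith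
  have hl: "hd q = q ! 0" "last q = q ! l" using ne len by (simp_all add: hd_conv_nth last_conv_nth)
  from q have q: "hd q \<in> A" "last q \<in> A" "\<And>i. 0 < i \<Longrightarrow> i < l \<Longrightarrow> q ! i \<notin> A"
    "set q \<subseteq> {..<n}" "distinct q" "\<And>i. i < l \<Longrightarrow> adj (q ! i) (q ! Suc i)"
    unfolding is_A_path_def is_path_def len by auto
  have "q ! i \<in> A \<longleftrightarrow> i = 0 \<or> i = l" if "i \<le> l" for i
    using q(1-3) hl that by (metis le_neq_implies_less not_gr_zero)
  then show "lpath q" unfolding lpath_def using len q(4-6) by blast
qed

abbreviation disjoint_lists :: "nat list list \<Rightarrow> bool" where
  "disjoint_lists \<equiv> sorted_wrt (\<lambda>p q. set p \<inter> set q = {})"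

text \<open>Disjointness is symmetric, so pairs \<open>i < j\<close> suffice. The form with
  \<open>sorted_wrt\<close> decomposes along Cons and append, the way packings are
  assembled.\<close>

lemma A_path_packing_iff:
  "A_path_packing {..<n} E A k l \<longleftrightarrow>
    (\<exists>P. length P = k \<and> (\<forall>q\<in>set P. lpath q) \<and> disjoint_lists P)"
proof -
  have "disjoint_lists P \<longleftrightarrow> (\<forall>i<k. \<forall>j<k. i \<noteq> j \<longrightarrow> set (P ! i) \<inter> set (P ! j) = {})"
    if "length P = k" for P
    unfolding sorted_wrt_iff_nth_less that
  proof (intro iffI allI impI)
    fix i j assume *: "\<forall>i j. i < j \<longrightarrow> j < k \<longrightarrow> set (P ! i) \<inter> set (P ! j) = {}"
      and ij: "i < k" "j < k" "i \<noteq> j"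
    show "set (P ! i) \<inter> set (P ! j) = {}"
    proof (cases "i < j")
      case True
      then show ?thesis using * ij(2) by simp
    next
      case False
      then have "set (P ! j) \<inter> set (P ! i) = {}" using * ij by simp
      then show ?thesis by (simp add: Int_commute)
    qed
  qed simp
  then have "(length P = k \<and> (\<forall>q\<in>set P. is_A_path {..<n} E A q \<and> path_length q = l) \<and>
      (\<forall>i<k. \<forall>j<k. i \<noteq> j \<longrightarrow> set (P ! i) \<inter> set (P ! j) = {})) \<longleftrightarrow>
      length P = k \<and> (\<forall>q\<in>set P. lpath q) \<and> disjoint_lists P" for P
    by (simp add: lpath_iff cong: conj_cong)
  then show ?thesis unfolding A_path_packing_def by simp
qed

lemma A_path_packing_mono:
  assumes "A_path_packing {..<n} E A p l" "k \<le> p"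
  shows "A_path_packing {..<n} E A k l"
proof -
  from assms obtain P where P: "length P = p" "\<forall>q\<in>set P. lpath q" "disjoint_lists P"
    unfolding A_path_packing_iff by auto
  then have "length (take k P) = k" "\<forall>q\<in>set (take k P). lpath q" "disjoint_lists (take k P)"
    using assms(2) by (auto simp: sorted_wrt_take dest: in_set_takeD)
  then show ?thesis unfolding A_path_packing_iff by blast
qed

lemma lpath_card:
  assumes "lpath q"
  shows "card (set q \<inter> A) = 2" "card (set q - A) = l - 1"
proof -
  have len: "length q = Suc l" and d: "distinct q" using assms by (auto simp: lpath_def)
  have sq: "set q = (!) q ` {..l}" using nth_image[of "Suc l" q] len
    by (simp add: atMost_atLeast0 atLeastLessThanSuc_atLeastAtMost)
  have "set q \<inter> A = (!) q ` {0, l}"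
    using assms unfolding sq by (auto simp: lpath_def)
  moreover have "card ((!) q ` {0, l}) = card {0, l}"
    using d len by (intro card_image inj_on_nth) auto
  ultimately show "card (set q \<inter> A) = 2" using l_pos by simp
  then have "card (set q - A) = card (set q) - 2"
    by (simp add: card_Diff_subset_Int)
  then show "card (set q - A) = l - 1" using distinct_card[OF d] len by simp
qed

text \<open>Counts the paths formed greedily in a clique with \<open>a\<close> vertices in \<open>A\<close> and \<open>b\<close> others; \<open>m\<close> is
  fuel. The closed form \<open>min (a div 2) (b div (l - 1))\<close> would be 0 for \<open>l = 1\<close>.\<close>

primrec clique_yield :: "nat \<Rightarrow> nat \<Rightarrow> nat \<Rightarrow> nat" where
  "clique_yield 0 a b = 0"
| "clique_yield (Suc m) a b =
     (if 2 \<le> a \<and> l - 1 \<le> b then Suc (clique_yield m (a - 2) (b - (l - 1))) else 0)"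

text \<open>Optimality of the greedy count: \<open>t\<close> paths inside a clique consume
  \<open>2 * t\<close> vertices of \<open>A\<close> and \<open>(l - 1) * t\<close> others, and
  removing one greedy path lowers all three numbers in step.\<close>

lemma clique_yield_ge: "2 * t \<le> a \<Longrightarrow> (l - 1) * t \<le> b \<Longrightarrow> t \<le> m \<Longrightarrow> t \<le> clique_yield m a b"
proof (induction m arbitrary: a b t)
  case (Suc m)
  show ?case
  proof (cases t)
    case (Suc r)
    then have "(l - 1) + (l - 1) * r \<le> b" using Suc.prems(2) by simp
    moreover from this have "r \<le> clique_yield m (a - 2) (b - (l - 1))"
      using Suc.prems Suc by (intro Suc.IH) auto
    ultimately show ?thesis using Suc Suc.prems(1) by simp
  qed simp
qed simp

text \<open>In a clique any two vertices of \<open>A\<close> can serve as ends and any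
  \<open>l - 1\<close> others, in any order, as interior, so the greedy count is attained by actual
  disjoint paths.\<close>

lemma clique_paths:
  assumes "finite F" "finite G" "F \<subseteq> A" "G \<inter> A = {}" "F \<union> G \<subseteq> {..<n}"
    and "\<And>u v. u \<in> F \<union> G \<Longrightarrow> v \<in> F \<union> G \<Longrightarrow> u \<noteq> v \<Longrightarrow> adj u v"
  shows "\<exists>P. length P = clique_yield m (card F) (card G) \<and>
    (\<forall>q\<in>set P. lpath q \<and> set q \<subseteq> F \<union> G) \<and> disjoint_lists P"
  using assms
proof (induction m arbitrary: F G)
  case (Suc m)
  show ?case
  proof (cases "2 \<le> card F \<and> l - 1 \<le> card G")
    case True
    then obtain F' where F': "F' \<subseteq> F" "card F' = 2" by (meson obtain_subset_with_card_n)
    then obtain a b where ab: "F' = {a, b}" "a \<noteq> b" by (meson card_2_iff)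
    from True obtain G' where G': "G' \<subseteq> G" "card G' = l - 1" by (meson obtain_subset_with_card_n)
    then obtain ys where ys: "set ys = G'" "distinct ys"
      using Suc.prems(2) finite_distinct_list finite_subset by metis
    have ly: "length ys = l - 1" using distinct_card[OF ys(2)] ys(1) G'(2) by simp
    have "\<exists>P. length P = clique_yield m (card (F - F')) (card (G - G')) \<and>
      (\<forall>q\<in>set P. lpath q \<and> set q \<subseteq> (F - F') \<union> (G - G')) \<and> disjoint_lists P"
      using Suc.prems by (intro Suc.IH) auto
    then obtain P where P: "length P = clique_yield m (card (F - F')) (card (G - G'))"
      "\<And>q. q \<in> set P \<Longrightarrow> lpath q \<and> set q \<subseteq> (F - F') \<union> (G - G')" "disjoint_lists P"
      by auto
    let ?q = "a # ys @ [b]"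
    have sq: "set ?q = F' \<union> G'" using ab ys by auto
    have dq: "distinct ?q" using ab ys F' G' Suc.prems(3,4) by auto
    have lq: "length ?q = Suc l" using ly l_pos by simp
    have inA: "?q ! i \<in> A \<longleftrightarrow> i = 0 \<or> i = l" if i: "i \<le> l" for i
    proof -
      consider "i = 0" | "i = l" | "0 < i" "i < l"
        using i by (metis gr0I le_neq_implies_less)
      then show ?thesis
      proof cases
        case 1
        then show ?thesis using ab F' Suc.prems(3) by auto
      next
        case 2
        then have "?q ! i = b" using ly l_pos by (simp add: nth_append nth_Cons')
        then show ?thesis using 2 ab F' Suc.prems(3) by auto
      next
        case 3
        then have "i - 1 < length ys" using ly by linarith
        then have "?q ! i = ys ! (i - 1)" "ys ! (i - 1) \<in> G'"
          using 3 ys(1) by (auto simp: nth_append nth_Cons')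
        then show ?thesis using 3 G' Suc.prems(4) by auto
      qed
    qed
    have "adj (?q ! i) (?q ! Suc i)" if "i < l" for i
    proof -
      have "?q ! i \<in> set ?q" "?q ! Suc i \<in> set ?q"
        by (rule nth_mem, unfold lq, use that in simp)+
      moreover have "?q ! i \<noteq> ?q ! Suc i"
        using nth_eq_iff_index_eq[OF dq, unfolded lq, of i "Suc i"] that by (simp del: nth_Cons_Suc)
      ultimately show ?thesis using Suc.prems(6) sq F' G' by blast
    qed
    with lq dq inA have "lpath ?q"
      unfolding lpath_def using sq F' G' Suc.prems(5) by blast
    moreover have "length (?q # P) = clique_yield (Suc m) (card F) (card G)"
      using P(1) True F' G' Suc.prems(1,2) by (simp add: card_Diff_subset finite_subset)
    moreover have "set ?q \<inter> set p = {}" if "p \<in> set P" for p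
      using P(2)[OF that] sq Suc.prems(3,4) F' G' by blast
    moreover have "set ?q \<subseteq> F \<union> G" using sq F' G' by blast
    ultimately show ?thesis using P(2,3)
      by (intro exI[of _ "?q # P"]) (auto simp del: set_append)
  qed auto
qed auto

end

section \<open>The dynamic program\<close>

text \<open>
  A slot \<open>j\<close> stands for position \<open>j mod (l + 1)\<close> of path number \<open>j div (l + 1)\<close>. A state maps
  slots to digits: 0 for an empty slot, \<open>code v \<ge> 3\<close> for a slot holding \<open>v \<in> S\<close>, 1 for a slot
  holding a vertex of an already completed clique, 2 for one holding a vertex of the current clique.
\<close>

locale path_dp = instance_graph +
  fixes code sv :: "nat \<Rightarrow> nat"
  assumes cluster: "\<lbrakk>u \<notin> S; v \<notin> S; w \<notin> S; u \<noteq> w; {u, v} \<in> E; {v, w} \<in> E\<rbrakk> \<Longrightarrow> {u, w} \<in> E"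
    and code_S: "v \<in> S \<Longrightarrow> 3 \<le> code v \<and> code v < card S + 3 \<and> sv (code v) = v"
    and code_notin: "v < n \<Longrightarrow> v \<notin> S \<Longrightarrow> code v = 2"
    and sv_less: "3 \<le> i \<Longrightarrow> i < card S + 3 \<Longrightarrow> sv i < n"
begin

section \<open>States, slots and their codes\<close>

definition B :: nat where "B = card S + 3"
definition D :: nat where "D = card S * Suc l"
definition N :: nat where "N = B ^ D"
definition pos :: "nat \<Rightarrow> nat" where "pos j = j mod Suc l"
definition endp :: "nat \<Rightarrow> bool" where "endp j \<longleftrightarrow> pos j = 0 \<or> pos j = l"

text \<open>Digits vanish from \<open>D\<close> on, so a state is determined by its code as a
  function on all naturals, and decoding an encoded state gives back the same function.\<close>

definition digits :: "(nat \<Rightarrow> nat) \<Rightarrow> bool" where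
  "digits X \<longleftrightarrow> (\<forall>j. X j < B) \<and> (\<forall>j\<ge>D. X j = 0)"

definition enc :: "(nat \<Rightarrow> nat) \<Rightarrow> nat" where "enc X = radix_sum B D X"
definition dec :: "nat \<Rightarrow> nat \<Rightarrow> nat" where "dec c j = (if j < D then c div B ^ j mod B else 0)"

lemma B_pos: "0 < B" and B_ge: "3 \<le> B" by (simp_all add: B_def)

lemma enc_less: "digits X \<Longrightarrow> enc X < N"
  unfolding digits_def enc_def N_def by (rule radix_sum_less) blast

lemma dec_enc:
  assumes "digits X"
  shows "dec (enc X) = X"
proof
  fix j
  have X: "X i < B" for i using assms by (simp add: digits_def)
  show "dec (enc X) j = X j"
  proof (cases "j < D")
    case True
    then show ?thesis using radix_sum_digit[of X B j D] X by (simp add: dec_def enc_def)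
  next
    case False
    then show ?thesis using assms by (simp add: dec_def digits_def)
  qed
qed

lemma digits_dec: "digits (dec c)"
  unfolding digits_def dec_def using B_pos by simp

lemma less_D_iff: "j < D \<longleftrightarrow> j div Suc l < card S"
  unfolding D_def by (simp add: div_less_iff_less_mult)

lemma pos_less: "pos j < Suc l" by (simp add: pos_def)

lemma pos_Suc: "pos j < l \<Longrightarrow> pos (Suc j) = Suc (pos j) \<and> Suc j div Suc l = j div Suc l"
  by (simp add: pos_def mod_Suc div_Suc)

lemma Suc_less_D: "j < D \<Longrightarrow> pos j < l \<Longrightarrow> Suc j < D"
  by (simp add: less_D_iff pos_Suc)

lemma pos_gr0:
  assumes "0 < pos j"
  obtains i where "j = Suc i" "pos i < l"
proof -
  from assms obtain i where i: "j = Suc i" by (cases j) (auto simp: pos_def)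
  moreover have "pos i \<noteq> l" using assms i by (auto simp: pos_def mod_Suc)
  moreover have "pos i < Suc l" by (rule pos_less)
  ultimately show ?thesis using that by simp
qed

definition slot :: "nat \<Rightarrow> nat \<Rightarrow> nat" where "slot i h = i * Suc l + h"

lemma pos_slot: "h \<le> l \<Longrightarrow> pos (slot i h) = h"
  using mod_mult_self3[of i "Suc l" h] by (simp add: pos_def slot_def)

lemma slot_div: "h \<le> l \<Longrightarrow> slot i h div Suc l = i"
  using div_mult_self3[of "Suc l" i h] by (simp add: slot_def)

lemma slot_Suc: "slot i (Suc h) = Suc (slot i h)"
  by (simp add: slot_def)

lemma slot_less: "i < card S \<Longrightarrow> h \<le> l \<Longrightarrow> slot i h < D"
  by (simp add: less_D_iff slot_div)

lemma slot_div_pos: "slot (j div Suc l) (pos j) = j"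
  using div_mult_mod_eq[of j "Suc l"] by (simp add: slot_def pos_def)

text \<open>The position guards keep the neighbouring slot inside the same path. Only neighbours in
  \<open>S\<close> are tested, since only their names are stored; adjacency inside a clique is left
  to \<open>closed\<close>.\<close>

definition compat :: "nat \<Rightarrow> nat \<Rightarrow> (nat \<Rightarrow> nat) \<Rightarrow> bool" where
  "compat v j X \<longleftrightarrow> (v \<in> A \<longleftrightarrow> endp j) \<and>
     (0 < pos j \<and> 3 \<le> X (j - 1) \<longrightarrow> adj v (sv (X (j - 1)))) \<and>
     (pos j < l \<and> 3 \<le> X (Suc j) \<longrightarrow> adj v (sv (X (Suc j))))"

text \<open>The pair \<open>(X, 0)\<close> leaves \<open>v\<close> free. The truncated difference
  \<open>1 - pos j\<close> is 1 exactly at a starting slot, so each path is counted once.\<close>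

definition vertex_moves :: "nat \<Rightarrow> (nat \<Rightarrow> nat) \<Rightarrow> ((nat \<Rightarrow> nat) \<times> nat) set" where
  "vertex_moves v X = insert (X, 0)
     ((\<lambda>j. (X(j := code v), 1 - pos j)) ` {j. j < D \<and> X j = 0 \<and> compat v j X})"

text \<open>Outside \<open>S\<close>, a vertex of a clique has neighbours in this clique only. Once
  the clique is complete, a 0 or a 1 next to a 2 can therefore no longer become part of a
  path.\<close>

definition closed :: "(nat \<Rightarrow> nat) \<Rightarrow> bool" where
  "closed X \<longleftrightarrow> (\<forall>j<D. X j = 2 \<longrightarrow> (0 < pos j \<longrightarrow> 2 \<le> X (j - 1)) \<and> (pos j < l \<longrightarrow> 2 \<le> X (Suc j)))"

definition recolor :: "(nat \<Rightarrow> nat) \<Rightarrow> nat \<Rightarrow> nat" where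
  "recolor X j = (if X j = 2 then 1 else X j)"

text \<open>Here \<open>a\<close> and \<open>b\<close> count the vertices of the clique inside and
  outside \<open>A\<close>; subtracting the occupied slots of either kind leaves the free ones. Fuel
  \<open>n\<close> is enough for any number of disjoint paths.\<close>

definition clique_moves :: "nat \<Rightarrow> nat \<Rightarrow> (nat \<Rightarrow> nat) \<Rightarrow> ((nat \<Rightarrow> nat) \<times> nat) set" where
  "clique_moves a b X = (if closed X then
     {(recolor X, clique_yield n (a - card {j. j < D \<and> X j = 2 \<and> endp j})
       (b - card {j. j < D \<and> X j = 2 \<and> \<not> endp j}))} else {})"

text \<open>Propagated along the slots of a path, this makes each path entirely empty or entirely
  filled.\<close>

definition final :: "(nat \<Rightarrow> nat) \<Rightarrow> bool" where
  "final X \<longleftrightarrow> (\<forall>j<D. pos j < l \<longrightarrow> (X j = 0 \<longleftrightarrow> X (Suc j) = 0))"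

text \<open>A table entry is 0 for an unreachable state, and otherwise one more than the number of
  paths gained so far.\<close>

definition table_step :: "((nat \<Rightarrow> nat) \<Rightarrow> ((nat \<Rightarrow> nat) \<times> nat) set) \<Rightarrow>
    (nat \<Rightarrow> nat) \<Rightarrow> (nat \<Rightarrow> nat) \<Rightarrow> bool" where
  "table_step \<Gamma> T T' \<longleftrightarrow>
     (\<forall>c'<N. T' c' \<noteq> 0 \<longrightarrow>
        (\<exists>c<N. T c \<noteq> 0 \<and> (\<exists>(X, g)\<in>\<Gamma> (dec c). c' = enc X \<and> T' c' = T c + g))) \<and>
     (\<forall>c<N. T c \<noteq> 0 \<longrightarrow> (\<forall>(X, g)\<in>\<Gamma> (dec c). T c + g \<le> T' (enc X)))"

lemma digits_vertex_moves:
  assumes "digits X" "(X', g) \<in> vertex_moves v X" "v < n"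
  shows "digits X'"
proof -
  have "code v < B" using code_S[of v] code_notin[of v] assms(3) by (cases "v \<in> S") (auto simp: B_def)
  then show ?thesis using assms by (auto simp: vertex_moves_def digits_def)
qed

lemma digits_recolor: "digits X \<Longrightarrow> digits (recolor X)"
  using B_ge by (auto simp: digits_def recolor_def)

subsection \<open>Soundness\<close>

text \<open>Digit pairs whose slots are already known to hold adjacent vertices: one end in
  \<open>S\<close>, as tested by \<open>compat\<close>, or both in completed cliques, as ensured by
  \<open>closed\<close>. A 2 without a vertex of \<open>S\<close> beside it is still
  pending.\<close>

definition linked :: "nat \<Rightarrow> nat \<Rightarrow> bool" where
  "linked a b \<longleftrightarrow> a \<noteq> 0 \<and> b \<noteq> 0 \<and> (3 \<le> a \<or> 3 \<le> b \<or> a = 1 \<and> b = 1)"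

definition starts :: "(nat \<Rightarrow> nat) \<Rightarrow> nat set" where
  "starts X = {j. j < D \<and> pos j = 0 \<and> X j \<noteq> 0}"

text \<open>The partial packing behind a table entry: \<open>\<phi>\<close> fills the slots,
  \<open>P\<close> collects the paths formed inside completed cliques. \<open>U\<close> contains the
  processed vertices of \<open>S\<close> and of completed cliques, \<open>C\<close> those of the
  current clique. Slot paths are counted by their starts, even while incomplete.\<close>

definition witness ::
  "nat set \<Rightarrow> nat set \<Rightarrow> (nat \<Rightarrow> nat) \<Rightarrow> nat \<Rightarrow> (nat \<Rightarrow> nat) \<Rightarrow> nat list list \<Rightarrow> bool" where
  "witness U C X p \<phi> P \<longleftrightarrow>
     (\<forall>j<D. X j \<noteq> 0 \<longrightarrow> \<phi> j \<in> U \<union> C \<and> (\<phi> j \<in> A \<longleftrightarrow> endp j)) \<and>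
     (\<forall>j<D. 3 \<le> X j \<longrightarrow> \<phi> j \<in> S \<and> X j = code (\<phi> j)) \<and>
     (\<forall>j<D. X j = 2 \<longrightarrow> \<phi> j \<in> C - S) \<and>
     (\<forall>j<D. X j = 1 \<longrightarrow> \<phi> j \<in> U - S) \<and>
     inj_on \<phi> {j. j < D \<and> X j \<noteq> 0} \<and>
     (\<forall>j<D. pos j < l \<and> linked (X j) (X (Suc j)) \<longrightarrow> adj (\<phi> j) (\<phi> (Suc j))) \<and>
     p = length P + card (starts X) \<and>
     (\<forall>q\<in>set P. lpath q \<and> set q \<subseteq> U \<and> set q \<inter> \<phi> ` {j. j < D \<and> X j \<noteq> 0} = {}) \<and>
     disjoint_lists P"

definition good :: "nat set \<Rightarrow> nat set \<Rightarrow> (nat \<Rightarrow> nat) \<Rightarrow> nat \<Rightarrow> bool" where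
  "good U C X p \<longleftrightarrow> U \<union> C \<subseteq> {..<n} \<and> (\<exists>\<phi> P. witness U C X p \<phi> P)"

definition sound :: "nat set \<Rightarrow> nat set \<Rightarrow> (nat \<Rightarrow> nat) \<Rightarrow> bool" where
  "sound U C T \<longleftrightarrow> (\<forall>c<N. T c \<noteq> 0 \<longrightarrow> good U C (dec c) (T c - 1))"

lemma witnessD:
  assumes "witness U C X p \<phi> P"
  shows "\<And>i. i < D \<Longrightarrow> X i \<noteq> 0 \<Longrightarrow> \<phi> i \<in> U \<union> C \<and> (\<phi> i \<in> A \<longleftrightarrow> endp i)"
    and "\<And>i. i < D \<Longrightarrow> 3 \<le> X i \<Longrightarrow> \<phi> i \<in> S \<and> X i = code (\<phi> i)"
    and "\<And>i. i < D \<Longrightarrow> X i = 2 \<Longrightarrow> \<phi> i \<in> C - S"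
    and "\<And>i. i < D \<Longrightarrow> X i = 1 \<Longrightarrow> \<phi> i \<in> U - S"
    and "inj_on \<phi> {i. i < D \<and> X i \<noteq> 0}"
    and "\<And>i. i < D \<Longrightarrow> pos i < l \<Longrightarrow> linked (X i) (X (Suc i)) \<Longrightarrow> adj (\<phi> i) (\<phi> (Suc i))"
    and "p = length P + card (starts X)"
    and "\<And>q. q \<in> set P \<Longrightarrow> lpath q \<and> set q \<subseteq> U \<and> set q \<inter> \<phi> ` {j. j < D \<and> X j \<noteq> 0} = {}"
    and "disjoint_lists P"
  using assms unfolding witness_def by - (elim conjE, simp)+

lemma finite_starts [simp]: "finite (starts X)"
  by (simp add: starts_def)

text \<open>Each nonzero new entry is traced back to one old entry and one move, which reduces a
  round over the whole table to single moves.\<close>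

lemma sound_step:
  assumes "sound U C T" "table_step \<Gamma> T T'"
    and "\<And>X p X' g. digits X \<Longrightarrow> good U C X p \<Longrightarrow> (X', g) \<in> \<Gamma> X \<Longrightarrow>
      digits X' \<and> good U' C' X' (p + g)"
  shows "sound U' C' T'"
  unfolding sound_def
proof (intro allI impI)
  fix c' assume "c' < N" "T' c' \<noteq> 0"
  with assms(2) obtain c X g where c: "c < N" "T c \<noteq> 0" "(X, g) \<in> \<Gamma> (dec c)" "c' = enc X"
    "T' c' = T c + g"
    unfolding table_step_def by blast
  have "good U C (dec c) (T c - 1)" using assms(1) c by (auto simp: sound_def)
  from assms(3)[OF digits_dec this c(3)] have "digits X" "good U' C' X (T c - 1 + g)" by auto
  then show "good U' C' (dec c') (T' c' - 1)" using c by (simp add: dec_enc)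
qed

text \<open>Covers a processed vertex that is left free.\<close>

lemma good_mono:
  assumes "good U C X p" "U \<subseteq> U'" "C \<subseteq> C'" "U' \<union> C' \<subseteq> {..<n}"
  shows "good U' C' X p"
proof -
  from assms(1) obtain \<phi> P where w: "witness U C X p \<phi> P" by (auto simp: good_def)
  have "witness U' C' X p \<phi> P"
    unfolding witness_def
  proof (intro conjI allI impI ballI)
    fix i assume i: "i < D"
    { assume "X i \<noteq> 0"
      then have *: "\<phi> i \<in> U \<union> C \<and> (\<phi> i \<in> A \<longleftrightarrow> endp i)" by (rule witnessD(1)[OF w i])
      show "\<phi> i \<in> U' \<union> C'" using * assms(2,3) by blast
      show "(\<phi> i \<in> A) = endp i" using * by simp }
    { assume "3 \<le> X i"
      then have *: "\<phi> i \<in> S \<and> X i = code (\<phi> i)" by (rule witnessD(2)[OF w i])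
      show "\<phi> i \<in> S" using * by simp
      show "X i = code (\<phi> i)" using * by simp }
    show "\<phi> i \<in> C' - S" if "X i = 2" using witnessD(3)[OF w i that] assms(3) by blast
    show "\<phi> i \<in> U' - S" if "X i = 1" using witnessD(4)[OF w i that] assms(2) by blast
    show "adj (\<phi> i) (\<phi> (Suc i))" if "pos i < l \<and> linked (X i) (X (Suc i))"
      using witnessD(6)[OF w i] that by blast
  next
    fix q assume q: "q \<in> set P"
    show "lpath q" "set q \<inter> \<phi> ` {j. j < D \<and> X j \<noteq> 0} = {}" using witnessD(8)[OF w q] by simp_all
    show "set q \<subseteq> U'" using witnessD(8)[OF w q] assms(2) by blast
  qed (fact witnessD[OF w])+
  with assms(4) show ?thesis by (auto simp: good_def)
qed

text \<open>Placing \<open>v\<close> extends \<open>\<phi>\<close> at one empty slot. A vertex of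
  \<open>S\<close> must arrive while only vertices of \<open>S\<close> have been processed;
  otherwise it could land beside an anonymous clique vertex without a test of adjacency.\<close>

lemma good_vertex:
  assumes good: "good U C X p" and move: "(X', g) \<in> vertex_moves v X"
    and v: "v < n" "v \<notin> U \<union> C"
    and vS: "v \<in> S \<Longrightarrow> U \<union> C \<subseteq> S \<and> v \<in> U'" "v \<notin> S \<Longrightarrow> v \<in> C'"
    and sub: "U \<subseteq> U'" "C \<subseteq> C'" "U' \<union> C' \<subseteq> {..<n}"
  shows "good U' C' X' (p + g)"
proof (cases "(X', g) = (X, 0)")
  case True
  then show ?thesis using good_mono[OF good sub] by simp
next
  case False
  with move obtain j where j: "j < D" "X j = 0" "compat v j X" "X' = X(j := code v)" "g = 1 - pos j"
    by (auto simp: vertex_moves_def)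
  from good obtain \<phi> P where w: "witness U C X p \<phi> P" by (auto simp: good_def)
  note w1 = witnessD(1)[OF w] and w3 = witnessD(2)[OF w] and w2 = witnessD(3)[OF w]
    and w1' = witnessD(4)[OF w] and winj = witnessD(5)[OF w] and wadj = witnessD(6)[OF w]
    and wp = witnessD(7)[OF w] and wP = witnessD(8)[OF w] and wd = witnessD(9)[OF w]
  have cv: "2 \<le> code v" "3 \<le> code v \<longleftrightarrow> v \<in> S"
    using code_S[of v] code_notin[of v] v(1) by (cases "v \<in> S"; auto)+
  have nbr: "adj v (\<phi> i)"
    if i: "i < D" "linked (code v) (X i)" and c: "3 \<le> X i \<longrightarrow> adj v (sv (X i))" for i
  proof (cases "3 \<le> X i")
    case True
    then show ?thesis using c w3[OF i(1)] code_S[of "\<phi> i"] by auto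
  next
    case False
    \<comment> \<open>Contradictory: a digit 1 or 2 stands for a processed vertex outside
      \<open>S\<close>, yet \<open>U\<close> and \<open>C\<close> lie in \<open>S\<close> when a
      vertex of \<open>S\<close> arrives.\<close>
    then have "v \<in> S" "X i = 1 \<or> X i = 2" using i(2) cv by (auto simp: linked_def)
    then show ?thesis using vS(1) w1[OF i(1)] w2[OF i(1)] w1'[OF i(1)] by auto
  qed
  have filled: "{i. i < D \<and> X' i \<noteq> 0} = insert j {i. i < D \<and> X i \<noteq> 0}"
    using j cv by auto
  have img: "(\<phi>(j := v)) ` {i. i < D \<and> X' i \<noteq> 0} = insert v (\<phi> ` {i. i < D \<and> X i \<noteq> 0})"
    using j unfolding filled by auto
  have vnot: "v \<notin> \<phi> ` {i. i < D \<and> X i \<noteq> 0}" using w1 v(2) by auto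
  have "witness U' C' X' (p + g) (\<phi>(j := v)) P"
    unfolding witness_def
  proof (intro conjI allI impI ballI)
    fix i assume "i < D" "X' i \<noteq> 0"
    then show "(\<phi>(j := v)) i \<in> U' \<union> C'" using w1[of i] j vS sub by (cases "v \<in> S") auto
  next
    fix i assume "i < D" "X' i \<noteq> 0"
    then show "((\<phi>(j := v)) i \<in> A) = endp i" using w1[of i] j by (auto simp: compat_def)
  next
    fix i assume "i < D" "3 \<le> X' i"
    then show "(\<phi>(j := v)) i \<in> S" "X' i = code ((\<phi>(j := v)) i)" using w3[of i] j cv by auto
  next
    fix i assume "i < D" "X' i = 2"
    then show "(\<phi>(j := v)) i \<in> C' - S" using w2[of i] j cv vS sub by auto
  next
    fix i assume "i < D" "X' i = 1"
    then show "(\<phi>(j := v)) i \<in> U' - S" using w1'[of i] j cv vS sub by auto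
  next
    have "inj_on (\<phi>(j := v)) {i. i < D \<and> X i \<noteq> 0}"
      using winj j by (auto simp: inj_on_def)
    moreover have "(\<phi>(j := v)) j \<notin> (\<phi>(j := v)) ` ({i. i < D \<and> X i \<noteq> 0} - {j})"
      using vnot by auto
    ultimately show "inj_on (\<phi>(j := v)) {i. i < D \<and> X' i \<noteq> 0}"
      unfolding filled inj_on_insert by blast
  next
    fix i assume i: "i < D" "pos i < l \<and> linked (X' i) (X' (Suc i))"
    then have "Suc i < D" using Suc_less_D by auto
    show "adj ((\<phi>(j := v)) i) ((\<phi>(j := v)) (Suc i))"
    proof (cases "i = j")
      case True
      then show ?thesis using nbr[of "Suc i"] i \<open>Suc i < D\<close> j by (auto simp: compat_def)
    next
      case ij: False
      show ?thesis
      proof (cases "Suc i = j")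
        case True
        have "0 < pos j" "j - 1 = i" using pos_Suc[of i] i True by auto
        then have "adj v (\<phi> i)" using nbr[of i] i j True ij by (auto simp: compat_def linked_def)
        then show ?thesis using True ij adj_sym by auto
      next
        case False
        then show ?thesis using wadj[of i] i j ij by auto
      qed
    qed
  next
    have "starts X' = (if pos j = 0 then insert j (starts X) else starts X)"
      using j cv by (auto simp: starts_def)
    moreover have "j \<notin> starts X" using j by (simp add: starts_def)
    ultimately show "p + g = length P + card (starts X')" using wp j(5) by auto
  next
    fix q assume q: "q \<in> set P"
    show "lpath q" using wP[OF q] by blast
    show "set q \<subseteq> U'" using wP[OF q] sub(1) by blast
    show "set q \<inter> (\<phi>(j := v)) ` {j. j < D \<and> X' j \<noteq> 0} = {}"
      unfolding img using wP[OF q] v(2) by auto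
  qed (rule wd)
  with sub(3) show ?thesis by (auto simp: good_def)
qed

text \<open>The members of \<open>C\<close> that occupy no slot are turned into fresh paths by
  \<open>clique_paths\<close>. Recolouring is safe because two consecutive 2s hold distinct, hence
  adjacent, members of the clique.\<close>

lemma good_clique:
  assumes good: "good U C X p" and move: "(X', g) \<in> clique_moves (card (C \<inter> A)) (card (C - A)) X"
    and C: "C \<inter> U = {}" "C \<inter> S = {}"
    and clique: "\<And>u v. u \<in> C \<Longrightarrow> v \<in> C \<Longrightarrow> u \<noteq> v \<Longrightarrow> adj u v"
  shows "good (U \<union> C) {} X' (p + g)"
proof -
  define Je where "Je = {j. j < D \<and> X j = 2 \<and> endp j}"
  define Ji where "Ji = {j. j < D \<and> X j = 2 \<and> \<not> endp j}"
  have mv: "closed X" "X' = recolor X"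
      "g = clique_yield n (card (C \<inter> A) - card Je) (card (C - A) - card Ji)"
    using move unfolding clique_moves_def Je_def Ji_def by (cases "closed X"; simp)+
  from good obtain \<phi> P where UC: "U \<union> C \<subseteq> {..<n}" and w: "witness U C X p \<phi> P"
    by (auto simp: good_def)
  note w1 = witnessD(1)[OF w] and w3 = witnessD(2)[OF w] and w2 = witnessD(3)[OF w]
    and w1' = witnessD(4)[OF w] and winj = witnessD(5)[OF w] and wadj = witnessD(6)[OF w]
    and wp = witnessD(7)[OF w] and wP = witnessD(8)[OF w] and wd = witnessD(9)[OF w]
  have nz: "X' j \<noteq> 0 \<longleftrightarrow> X j \<noteq> 0" for j using mv by (auto simp: recolor_def)
  have finC: "finite C" using UC finite_subset by blast
  let ?F = "C \<inter> A - \<phi> ` Je" and ?G = "C - A - \<phi> ` Ji"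
  have injJ: "inj_on \<phi> Je" "inj_on \<phi> Ji"
    using winj by (auto simp: Je_def Ji_def elim!: inj_on_subset)
  have "\<phi> ` Je \<subseteq> C \<inter> A" "\<phi> ` Ji \<subseteq> C - A" using w1 w2 by (auto simp: Je_def Ji_def)
  then have cards: "card ?F = card (C \<inter> A) - card Je" "card ?G = card (C - A) - card Ji"
    using injJ finC by (simp_all add: card_Diff_subset finite_subset card_image Je_def Ji_def)
  have "\<exists>P'. length P' = clique_yield n (card ?F) (card ?G) \<and>
    (\<forall>q\<in>set P'. lpath q \<and> set q \<subseteq> ?F \<union> ?G) \<and> disjoint_lists P'"
    using finC clique UC by (intro clique_paths) auto
  then obtain P' where P': "length P' = g" "\<And>q. q \<in> set P' \<Longrightarrow> lpath q \<and> set q \<subseteq> ?F \<union> ?G"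
    "disjoint_lists P'"
    unfolding mv(3) cards by auto
  have free: "x \<notin> \<phi> ` {j. j < D \<and> X j \<noteq> 0}" if x: "x \<in> ?F \<union> ?G" for x
  proof
    assume "x \<in> \<phi> ` {j. j < D \<and> X j \<noteq> 0}"
    then obtain j where j: "j < D" "X j \<noteq> 0" "x = \<phi> j" by auto
    have "x \<in> C" using x by auto
    \<comment> \<open>Digit 1 would put \<open>x\<close> into \<open>U\<close> and a digit from 3 on
      into \<open>S\<close>; both are disjoint from \<open>C\<close>.\<close>
    have "X j = 2" using w3[OF j(1)] w1'[OF j(1)] \<open>x \<in> C\<close> C j by (cases "X j \<ge> 3") force+
    then have "j \<in> Je \<or> j \<in> Ji" using j by (auto simp: Je_def Ji_def)
    then show False using x j w1[of j] by (auto simp: Je_def Ji_def)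
  qed
  have "witness (U \<union> C) {} X' (p + g) \<phi> (P @ P')"
    unfolding witness_def nz
  proof (intro conjI allI impI ballI)
    fix i assume i: "i < D" "pos i < l \<and> linked (X' i) (X' (Suc i))"
    then have "Suc i < D" using Suc_less_D by auto
    have "0 < pos (Suc i)" using pos_Suc i by auto
    have cl1: "X i = 2 \<Longrightarrow> 2 \<le> X (Suc i)" using mv(1) i unfolding closed_def by blast
    have cl2: "X (Suc i) = 2 \<Longrightarrow> 2 \<le> X i"
      using mv(1) \<open>Suc i < D\<close> \<open>0 < pos (Suc i)\<close> unfolding closed_def
      by (metis diff_Suc_1)
    show "adj (\<phi> i) (\<phi> (Suc i))"
    proof (cases "X i = 2 \<and> X (Suc i) = 2")
      case True
      then have "\<phi> i \<in> C" "\<phi> (Suc i) \<in> C" using w2 i \<open>Suc i < D\<close> by auto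
      moreover have "\<phi> i \<noteq> \<phi> (Suc i)"
        using inj_onD[OF winj, of i "Suc i"] True i \<open>Suc i < D\<close> by auto
      ultimately show ?thesis using clique by blast
    next
      case False
      \<comment> \<open>Without a 2 nothing has changed; otherwise closedness puts a vertex of
        \<open>S\<close> beside the 2. Either way the pair was linked before recolouring.\<close>
      then have "linked (X i) (X (Suc i))"
        using i cl1 cl2 unfolding mv(2) recolor_def linked_def by (auto split: if_splits)
      then show ?thesis using wadj i by blast
    qed
  next
    have "starts X' = starts X" using nz by (simp add: starts_def)
    then show "p + g = length (P @ P') + card (starts X')" using wp P' by simp
  next
    fix q assume "q \<in> set (P @ P')"
    then consider "q \<in> set P" | "q \<in> set P'" by auto
    then have "lpath q \<and> set q \<subseteq> U \<union> C \<and> set q \<inter> \<phi> ` {j. j < D \<and> X j \<noteq> 0} = {}"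
    proof cases
      case 1
      show ?thesis using wP[OF 1] by blast
    next
      case 2
      have q: "x \<in> ?F \<union> ?G" if "x \<in> set q" for x using P'(2)[OF 2] that by (rule subsetD[OF conjunct2])
      then have "x \<in> C" "x \<notin> \<phi> ` {j. j < D \<and> X j \<noteq> 0}" if "x \<in> set q" for x
        using q[OF that] free[OF q[OF that]] by blast+
      moreover have "lpath q" using P'(2)[OF 2] by simp
      ultimately show ?thesis by blast
    qed
    then show "lpath q" "set q \<subseteq> U \<union> C" "set q \<inter> \<phi> ` {j. j < D \<and> X j \<noteq> 0} = {}"
      by simp_all
  next
    show "disjoint_lists (P @ P')"
      unfolding sorted_wrt_append
    proof (intro conjI ballI wd P'(3))
      fix q r assume "q \<in> set P" "r \<in> set P'"
      then have "set q \<subseteq> U" "set r \<subseteq> ?F \<union> ?G" using wP[of q] P'(2)[of r] by simp_all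
      moreover have "?F \<union> ?G \<subseteq> C" by auto
      ultimately show "set q \<inter> set r = {}" using C(1) by (metis (lifting) disjoint_iff subsetD)
    qed
  next
    fix i assume i: "i < D" "X' i = 1"
    then have "X i = 1 \<or> X i = 2" by (auto simp: mv(2) recolor_def split: if_splits)
    then show "\<phi> i \<in> U \<union> C - S" using w1' w2 i(1) by blast
  next
    fix i assume i: "i < D" "X' i = 2"
    then show "\<phi> i \<in> {} - S" by (simp add: mv(2) recolor_def split: if_splits)
  next
    fix i assume i: "i < D" "3 \<le> X' i"
    then have "X' i = X i" by (auto simp: mv(2) recolor_def split: if_splits)
    then show "\<phi> i \<in> S" "X' i = code (\<phi> i)" using i w3[of i] by auto
  qed (use w1 winj in auto)
  with UC show ?thesis by (auto simp: good_def)
qed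

text \<open>With no current clique there is no digit 2, so any two filled consecutive slots of a
  path are linked. By finality the rows whose starting slot is filled are complete paths, and their
  number is the one already included in \<open>p\<close>.\<close>

lemma good_final:
  assumes good: "good U {} X p" and final: "final X"
  shows "A_path_packing {..<n} E A p l"
proof -
  from good obtain \<phi> P where UC: "U \<subseteq> {..<n}" and w: "witness U {} X p \<phi> P"
    by (auto simp: good_def)
  note w1 = witnessD(1)[OF w] and w3 = witnessD(2)[OF w] and w2 = witnessD(3)[OF w]
    and w1' = witnessD(4)[OF w] and winj = witnessD(5)[OF w] and wadj = witnessD(6)[OF w]
    and wp = witnessD(7)[OF w] and wP = witnessD(8)[OF w] and wd = witnessD(9)[OF w]
  have w2: "X i \<noteq> 2" if "i < D" for i using w2[OF that] by blast
  define I where "I = filter (\<lambda>i. X (slot i 0) \<noteq> 0) [0..<card S]"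
  define path where "path i = map (\<lambda>h. \<phi> (slot i h)) [0..<Suc l]" for i
  have IS: "i < card S" if "i \<in> set I" for i using that by (simp add: I_def)
  have set_path: "set (path i) = (\<lambda>h. \<phi> (slot i h)) ` {..l}" for i
    by (simp add: path_def atMost_atLeast0 atLeastLessThanSuc_atLeastAtMost del: upt_Suc)
  have filled: "slot i h < D \<and> X (slot i h) \<noteq> 0" if i: "i \<in> set I" and "h \<le> l" for i h
    using that(2)
  proof (induction h)
    case 0
    then show ?case using i slot_less[of i 0] by (simp add: I_def)
  next
    case (Suc h)
    then have "X (slot i h) \<noteq> 0" by simp
    moreover have "slot i h < D" "pos (slot i h) < l" "slot i (Suc h) < D"
      using Suc slot_less[OF IS[OF i]] pos_slot[of h i] by auto
    ultimately have "X (Suc (slot i h)) \<noteq> 0" using final[unfolded final_def, rule_format, of "slot i h"] by simp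
    then show ?case using \<open>slot i (Suc h) < D\<close> by (simp add: slot_Suc)
  qed
  have inj: "i = i' \<and> h = h'" if "\<phi> (slot i h) = \<phi> (slot i' h')"
    and *: "i \<in> set I" "i' \<in> set I" "h \<le> l" "h' \<le> l" for i i' h h'
  proof -
    have "slot i h \<in> {j. j < D \<and> X j \<noteq> 0}" "slot i' h' \<in> {j. j < D \<and> X j \<noteq> 0}"
      using filled[OF *(1,3)] filled[OF *(2,4)] by simp_all
    with winj that(1) have "slot i h = slot i' h'" by (rule inj_onD)
    then have "slot i h div Suc l = slot i' h' div Suc l" "pos (slot i h) = pos (slot i' h')"
      by simp_all
    then show ?thesis using * by (simp only: slot_div pos_slot simp_thms)
  qed
  have "lpath (path i)" if i: "i \<in> set I" for i
  proof -
    have nth: "path i ! h = \<phi> (slot i h)" if "h \<le> l" for h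
      using that nth_map[of h "[0..<Suc l]"] nth_upt[of 0 h "Suc l"] by (simp add: path_def del: upt_Suc)
    have "length (path i) = Suc l" by (simp add: path_def)
    moreover have "\<phi> (slot i h) \<in> {..<n}" if "h \<le> l" for h
      using w1[of "slot i h"] filled[OF i that] UC by blast
    then have "set (path i) \<subseteq> {..<n}" unfolding set_path by blast
    moreover have "inj_on (\<lambda>h. \<phi> (slot i h)) {..l}"
      by (rule inj_onI) (use inj[OF _ i i] in simp)
    then have "distinct (path i)"
      by (simp add: path_def distinct_map atMost_atLeast0 atLeastLessThanSuc_atLeastAtMost del: upt_Suc)
    moreover have "adj (path i ! h) (path i ! Suc h)" if h: "h < l" for h
    proof -
      have *: "slot i h < D" "X (slot i h) \<noteq> 0" "Suc (slot i h) < D" "X (Suc (slot i h)) \<noteq> 0"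
        using h filled[OF i, of h] filled[OF i, of "Suc h"] by (auto simp: slot_Suc)
      moreover from this have "X (slot i h) \<noteq> 2" "X (Suc (slot i h)) \<noteq> 2" using w2 by blast+
      ultimately have "linked (X (slot i h)) (X (Suc (slot i h)))"
        unfolding linked_def by linarith
      then show ?thesis using wadj[of "slot i h"] * h pos_slot[of h i]
        by (simp add: nth slot_Suc)
    qed
    moreover have "path i ! h \<in> A \<longleftrightarrow> h = 0 \<or> h = l" if h: "h \<le> l" for h
      using w1[of "slot i h"] filled[OF i h] h by (simp add: nth endp_def pos_slot)
    ultimately show ?thesis unfolding lpath_def by blast
  qed
  then have "\<forall>q\<in>set (P @ map path I). lpath q" using wP by auto
  moreover have "disjoint_lists (P @ map path I)"
    unfolding sorted_wrt_append
  proof (intro conjI ballI)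
    show "disjoint_lists (map path I)"
    proof -
      have "set (path i) \<inter> set (path i') = {}" if i: "i \<in> set I" "i' \<in> set I" "i \<noteq> i'" for i i'
      proof -
        have "\<phi> (slot i h) \<noteq> \<phi> (slot i' h')" if "h \<le> l" "h' \<le> l" for h h'
          using inj[of i h i' h'] i that by blast
        then show ?thesis unfolding set_path by blast
      qed
      moreover have "distinct I" by (simp add: I_def)
      ultimately show ?thesis unfolding sorted_wrt_map
        by (induction I) auto
    qed
    fix q r assume q: "q \<in> set P" and "r \<in> set (map path I)"
    then obtain i where i: "i \<in> set I" "r = path i" by auto
    then have "set r \<subseteq> \<phi> ` {j. j < D \<and> X j \<noteq> 0}"
      using filled unfolding i(2) set_path by blast
    then show "set q \<inter> set r = {}" using wP[OF q] by blast
  qed (rule wd)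
  moreover have "length (P @ map path I) = p"
  proof -
    have "starts X = (\<lambda>i. slot i 0) ` set I"
    proof
      show "starts X \<subseteq> (\<lambda>i. slot i 0) ` set I"
      proof
        fix j assume j: "j \<in> starts X"
        then have *: "j = slot (j div Suc l) 0" using slot_div_pos[of j] by (simp add: starts_def)
        have "j div Suc l \<in> set I"
          using j * unfolding I_def starts_def less_D_iff by simp
        with * show "j \<in> (\<lambda>i. slot i 0) ` set I" by blast
      qed
      show "(\<lambda>i. slot i 0) ` set I \<subseteq> starts X"
        using filled[of _ 0] pos_slot[of 0] by (auto simp: starts_def)
    qed
    moreover have "inj_on (\<lambda>i. slot i 0) (set I)"
    proof (rule inj_onI)
      fix i i' assume "slot i 0 = slot i' 0"
      then have "slot i 0 div Suc l = slot i' 0 div Suc l" by simp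
      then show "i = i'" by (simp only: slot_div le0)
    qed
    ultimately have "card (starts X) = card (set I)" by (simp add: card_image)
    also have "\<dots> = length I" by (rule distinct_card) (simp add: I_def)
    finally show ?thesis using wp by simp
  qed
  ultimately show ?thesis unfolding A_path_packing_iff by blast
qed

lemma sound_initial: "sound {} {} ((\<lambda>_. 0)(0 := 1))"
proof -
  have "witness {} {} (dec 0) 0 \<phi> []" for \<phi>
    by (auto simp: witness_def dec_def starts_def linked_def)
  then show ?thesis by (auto simp: sound_def good_def)
qed

end

subsection \<open>Completeness\<close>

text \<open>An arbitrary packing \<open>P\<close> is fixed and its trace through the dynamic program
  followed: the paths \<open>Q\<close> meeting \<open>S\<close> are written into consecutive rows of
  slots, and the paths \<open>F\<close> avoiding \<open>S\<close> are gained at the cliques that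
  contain them.\<close>

locale packed_instance = path_dp +
  fixes P :: "nat list list"
  assumes P_path: "q \<in> set P \<Longrightarrow> lpath q" and P_disjoint: "disjoint_lists P"
begin

definition Q where "Q = filter (\<lambda>q. set q \<inter> S \<noteq> {}) P"
definition F where "F = filter (\<lambda>q. \<not> set q \<inter> S \<noteq> {}) P"
definition vx where "vx j = Q ! (j div Suc l) ! pos j"
definition used where "used j \<longleftrightarrow> j div Suc l < length Q"

definition config :: "nat set \<Rightarrow> nat set \<Rightarrow> nat \<Rightarrow> nat" where
  "config U C j = (if used j \<and> vx j \<in> U \<union> C then
     (if vx j \<in> S then code (vx j) else if vx j \<in> C then 2 else 1) else 0)"

text \<open>Credits are given in the order of the algorithm: for a path of \<open>Q\<close> with its
  starting vertex, for a path of \<open>F\<close> when its clique is complete.\<close>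

definition gained :: "nat set \<Rightarrow> nat set \<Rightarrow> nat" where
  "gained U C = card {j. used j \<and> pos j = 0 \<and> vx j \<in> U \<union> C} + card {q \<in> set F. set q \<subseteq> U}"

text \<open>Strict because table entries are shifted by one; in particular the entry is nonzero, so
  the state is reachable.\<close>

definition complete :: "nat set \<Rightarrow> nat set \<Rightarrow> (nat \<Rightarrow> nat) \<Rightarrow> bool" where
  "complete U C T \<longleftrightarrow> gained U C < T (enc (config U C))"

lemma P_disjointD:
  assumes "q \<in> set P" "r \<in> set P" "q \<noteq> r"
  shows "set q \<inter> set r = {}"
proof -
  obtain i j where ij: "i < length P" "j < length P" "q = P ! i" "r = P ! j"
    using assms by (metis in_set_conv_nth)
  then consider "i < j" | "j < i" using assms(3) by (metis linorder_neqE_nat)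
  then show ?thesis
  proof cases
    case 1
    then show ?thesis using P_disjoint ij unfolding sorted_wrt_iff_nth_less by blast
  next
    case 2
    then have "set r \<inter> set q = {}" using P_disjoint ij unfolding sorted_wrt_iff_nth_less by blast
    then show ?thesis by blast
  qed
qed

lemma P_distinct: "distinct P"
  unfolding distinct_conv_nth
proof (intro allI impI)
  fix i j assume ij: "i < length P" "j < length P" "i \<noteq> j"
  have "set (P ! i) \<noteq> {}" "set (P ! j) \<noteq> {}"
    using P_path[of "P ! i"] P_path[of "P ! j"] ij by (auto simp: lpath_def)
  moreover have "set (P ! i) \<inter> set (P ! j) = {} \<or> set (P ! j) \<inter> set (P ! i) = {}"
    using P_disjoint ij unfolding sorted_wrt_iff_nth_less by (cases "i < j") simp_all
  ultimately show "P ! i \<noteq> P ! j" by auto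
qed

lemma Q_in: "q \<in> set Q \<Longrightarrow> q \<in> set P" and F_in: "q \<in> set F \<Longrightarrow> q \<in> set P \<and> set q \<inter> S = {}"
  by (auto simp: Q_def F_def)

text \<open>Choosing a vertex of \<open>S\<close> from each path of \<open>Q\<close> is injective by
  disjointness. This is why \<open>card S\<close> rows of slots are enough.\<close>

lemma length_Q: "length Q \<le> card S"
proof -
  define f where "f q = (SOME v. v \<in> set q \<inter> S)" for q
  have f: "f q \<in> set q \<inter> S" if "q \<in> set Q" for q
  proof -
    have "\<exists>v. v \<in> set q \<inter> S" using that by (auto simp: Q_def)
    then show ?thesis unfolding f_def by (rule someI_ex)
  qed
  have "inj_on f (set Q)"
  proof (rule inj_onI)
    fix q r assume qr: "q \<in> set Q" "r \<in> set Q" "f q = f r"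
    show "q = r"
    proof (rule ccontr)
      assume "q \<noteq> r"
      then have "set q \<inter> set r = {}" by (rule P_disjointD[OF Q_in[OF qr(1)] Q_in[OF qr(2)]])
      moreover have "f q \<in> set q" "f q \<in> set r" using f[OF qr(1)] f[OF qr(2)] qr(3) by auto
      ultimately show False by blast
    qed
  qed
  then have "card (set Q) \<le> card S" using f by (intro card_inj_on_le[of f]) auto
  moreover have "distinct Q" using P_distinct by (simp add: Q_def)
  ultimately show ?thesis by (simp add: distinct_card)
qed

lemma used_less: "used j \<Longrightarrow> j < D"
  using length_Q by (simp add: used_def less_D_iff)

lemma finite_used [simp]: "finite {j. used j \<and> R j}"
  by (rule finite_subset[of _ "{..<D}"]) (auto dest: used_less)

lemma used_Suc: "pos j < l \<Longrightarrow> used (Suc j) \<longleftrightarrow> used j"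
  by (simp add: used_def pos_Suc)

lemma used_path:
  assumes "used j"
  shows "Q ! (j div Suc l) \<in> set Q" "lpath (Q ! (j div Suc l))" "vx j \<in> set (Q ! (j div Suc l))"
proof -
  show q: "Q ! (j div Suc l) \<in> set Q" using assms by (simp add: used_def)
  then show p: "lpath (Q ! (j div Suc l))" using P_path Q_in by blast
  show "vx j \<in> set (Q ! (j div Suc l))"
    unfolding vx_def using p pos_less[of j] by (intro nth_mem) (simp add: lpath_def)
qed

lemma vx_less: "used j \<Longrightarrow> vx j < n"
  using used_path[of j] by (auto simp: lpath_def)

lemma vx_A: "used j \<Longrightarrow> vx j \<in> A \<longleftrightarrow> endp j"
  using used_path(2)[of j] pos_less[of j] unfolding lpath_def vx_def endp_def by simp

lemma vx_adj:
  assumes "used j" "pos j < l"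
  shows "adj (vx j) (vx (Suc j))"
  using used_path(2)[OF assms(1)] assms(2) pos_Suc[OF assms(2)] unfolding lpath_def vx_def by simp

lemma vx_inj:
  assumes "used i" "used j" "vx i = vx j"
  shows "i = j"
proof -
  let ?q = "Q ! (i div Suc l)" and ?r = "Q ! (j div Suc l)"
  have "?q = ?r"
  proof (rule ccontr)
    assume "?q \<noteq> ?r"
    then have "set ?q \<inter> set ?r = {}" using used_path(1) assms Q_in P_disjointD by blast
    then show False using used_path(3)[OF assms(1)] used_path(3)[OF assms(2)] assms(3) by auto
  qed
  moreover have "distinct Q" using P_distinct by (simp add: Q_def)
  ultimately have d: "i div Suc l = j div Suc l"
    using assms by (simp add: used_def nth_eq_iff_index_eq)
  have "distinct ?q" "length ?q = Suc l" using used_path(2)[OF assms(1)] by (simp_all add: lpath_def)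
  then have "pos i = pos j"
    using assms(3) d pos_less[of i] pos_less[of j] unfolding vx_def by (simp add: nth_eq_iff_index_eq)
  with d show ?thesis by (metis slot_div_pos)
qed

lemma digits_config: "digits (config U C)"
  unfolding digits_def
proof (intro conjI allI impI)
  show "config U C j < B" for j
    using code_S[of "vx j"] by (auto simp: config_def B_def)
  show "config U C j = 0" if "D \<le> j" for j
    using used_less[of j] that by (auto simp: config_def)
qed

lemma config_S: "3 \<le> config U C j \<Longrightarrow> used j \<and> vx j \<in> U \<union> C \<and> vx j \<in> S \<and> sv (config U C j) = vx j"
  using code_S[of "vx j"] by (auto simp: config_def split: if_splits)

text \<open>Only the one move prescribed by the packing is followed; competing moves can merely
  raise the entry.\<close>

lemma complete_step:
  assumes "complete U C T" "table_step \<Gamma> T T'" "(config U' C', g) \<in> \<Gamma> (config U C)"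
    and "gained U' C' \<le> gained U C + g"
  shows "complete U' C' T'"
proof -
  let ?c = "enc (config U C)"
  have "?c < N" "dec ?c = config U C" using digits_config by (simp_all add: enc_less dec_enc)
  moreover have "T ?c \<noteq> 0" using assms(1) by (simp add: complete_def)
  ultimately have "T ?c + g \<le> T' (enc (config U' C'))"
    using assms(2,3) unfolding table_step_def by fastforce
  then show ?thesis using assms(1,4) by (simp add: complete_def)
qed

lemma complete_initial: "complete {} {} ((\<lambda>_. 0)(0 := 1))"
proof -
  have "set q \<noteq> {}" if "q \<in> set F" for q
    using P_path[of q] F_in[OF that] by (auto simp: lpath_def)
  then have "{q \<in> set F. set q \<subseteq> {}} = {}" by auto
  then have "gained {} {} = 0" by (simp add: gained_def)
  moreover have "enc (config {} {}) = 0" by (simp add: enc_def radix_sum_def config_def)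
  ultimately show ?thesis by (simp add: complete_def)
qed

lemma config_vertex_move:
  assumes v: "v < n" "v \<notin> U \<union> C"
    and UC': "v \<in> S \<and> U' = insert v U \<and> C' = C \<or> v \<notin> S \<and> U' = U \<and> C' = insert v C"
  shows "\<exists>g. (config U' C', g) \<in> vertex_moves v (config U C) \<and> gained U' C' \<le> gained U C + g"
proof -
  have un: "U' \<union> C' = insert v (U \<union> C)" using UC' by auto
  \<comment> \<open>Paths of \<open>F\<close> avoid \<open>S\<close>, so adding a vertex of
    \<open>S\<close> to \<open>U\<close> completes none of them; in the other case \<open>U\<close>
    stays the same.\<close>
  have F: "{q \<in> set F. set q \<subseteq> U'} = {q \<in> set F. set q \<subseteq> U}"
    using UC' F_in by auto
  show ?thesis
  proof (cases "\<exists>j. used j \<and> vx j = v")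
    case False
    then have "config U' C' j = config U C j" for j
      using UC' v(2) by (auto simp: config_def)
    then have "config U' C' = config U C" by auto
    moreover have "{j. used j \<and> pos j = 0 \<and> vx j \<in> U' \<union> C'} = {j. used j \<and> pos j = 0 \<and> vx j \<in> U \<union> C}"
      unfolding un using False by auto
    ultimately show ?thesis using F by (intro exI[of _ 0]) (simp add: vertex_moves_def gained_def)
  next
    case True
    then obtain j where j: "used j" "vx j = v" by auto
    have other: "vx i \<noteq> v" if "used i" "i \<noteq> j" for i using vx_inj[OF that(1) j(1)] that(2) j(2) by auto
    have "config U' C' i = ((config U C)(j := code v)) i" for i
    proof (cases "i = j")
      case True
      then show ?thesis using j UC' v code_notin[of v] by (auto simp: config_def)
    next
      case False
      then show ?thesis using other[of i] UC' by (auto simp: config_def)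
    qed
    then have conf: "config U' C' = (config U C)(j := code v)" by auto
    have "compat v j (config U C)"
      unfolding compat_def
    proof (intro conjI impI)
      show "(v \<in> A) = endp j" using vx_A j by blast
    next
      assume a: "0 < pos j \<and> 3 \<le> config U C (j - 1)"
      then obtain i where i: "j = Suc i" "pos i < l" using pos_gr0 by blast
      then have "used i" "sv (config U C i) = vx i" using config_S[of U C i] a by auto
      then show "adj v (sv (config U C (j - 1)))" using vx_adj[of i] i j(2) adj_sym by simp
    next
      assume a: "pos j < l \<and> 3 \<le> config U C (Suc j)"
      then show "adj v (sv (config U C (Suc j)))" using vx_adj[OF j(1)] config_S[of U C "Suc j"] j(2) by simp
    qed
    moreover have "config U C j = 0" using j v(2) by (simp add: config_def)
    ultimately have "(config U' C', 1 - pos j) \<in> vertex_moves v (config U C)"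
      unfolding conf vertex_moves_def using used_less[OF j(1)] by blast
    moreover have "{i. used i \<and> pos i = 0 \<and> vx i \<in> U' \<union> C'} =
        {i. used i \<and> pos i = 0 \<and> vx i \<in> U \<union> C} \<union> (if pos j = 0 then {j} else {})"
    proof -
      have "(used i \<and> pos i = 0 \<and> vx i \<in> insert v (U \<union> C)) \<longleftrightarrow>
          (used i \<and> pos i = 0 \<and> vx i \<in> U \<union> C) \<or> (i = j \<and> pos j = 0)" for i
        using j other[of i] v(2) by (cases "i = j") auto
      then show ?thesis unfolding un by auto
    qed
    then have "card {i. used i \<and> pos i = 0 \<and> vx i \<in> U' \<union> C'} \<le>
        card {i. used i \<and> pos i = 0 \<and> vx i \<in> U \<union> C} + (1 - pos j)"
      using card_Un_le[of "{i. used i \<and> pos i = 0 \<and> vx i \<in> U \<union> C}" "if pos j = 0 then {j} else {}"]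
      by (auto split: if_splits)
    ultimately show ?thesis using F by (auto simp: gained_def)
  qed
qed

text \<open>An edge of a path avoiding \<open>S\<close> neither enters nor leaves \<open>C\<close>,
  so membership in \<open>C\<close> is constant along the path.\<close>

lemma F_clique:
  assumes q: "q \<in> set F" and C: "\<And>u w. u \<in> C \<Longrightarrow> adj u w \<Longrightarrow> w \<notin> S \<Longrightarrow> w \<in> C"
    and x: "x \<in> set q" "x \<in> C"
  shows "set q \<subseteq> C"
proof -
  have p: "lpath q" and qS: "set q \<inter> S = {}" using q F_in P_path by auto
  then have len: "length q = Suc l" and e: "\<And>i. i < l \<Longrightarrow> adj (q ! i) (q ! Suc i)"
    by (auto simp: lpath_def)
  have notS: "q ! i \<notin> S" if "i \<le> l" for i 
  proof -
    have "q ! i \<in> set q" using len that by simp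
    then show ?thesis using qS by blast
  qed
  have step: "q ! Suc i \<in> C \<longleftrightarrow> q ! i \<in> C" if "i < l" for i
    using C[OF _ e[OF that]] C[OF _ adj_sym[OF e[OF that]]] notS[of i] notS[of "Suc i"] that by auto
  have all: "q ! i \<in> C \<longleftrightarrow> q ! 0 \<in> C" if "i \<le> l" for i
    using that by (induction i) (auto simp: step)
  obtain k where "k \<le> l" "x = q ! k" using x(1) len by (metis in_set_conv_nth less_Suc_eq_le)
  then have "q ! 0 \<in> C" using x(2) all by blast
  show ?thesis
  proof
    fix y assume "y \<in> set q"
    then obtain i where "i \<le> l" "y = q ! i" using len by (metis in_set_conv_nth less_Suc_eq_le)
    then show "y \<in> C" using all \<open>q ! 0 \<in> C\<close> by blast
  qed
qed

text \<open>Inside \<open>C\<close> the packing uses the slot vertices and the paths of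
  \<open>F\<close> contained in \<open>C\<close>. Counting both in \<open>C \<inter> A\<close> and
  in \<open>C - A\<close> shows that the greedy yield on the remaining vertices is at least the
  number of those paths.\<close>

lemma config_clique_move:
  assumes C: "C \<inter> U = {}" "C \<inter> S = {}" "C \<subseteq> {..<n}" and U: "S \<subseteq> U"
    and closed: "\<And>u w. u \<in> C \<Longrightarrow> adj u w \<Longrightarrow> w \<notin> S \<Longrightarrow> w \<in> C"
  shows "\<exists>g. (config (U \<union> C) {}, g) \<in> clique_moves (card (C \<inter> A)) (card (C - A)) (config U C) \<and>
    gained (U \<union> C) {} \<le> gained U C + g"
proof -
  let ?X = "config U C"
  define Je where "Je = {j. j < D \<and> ?X j = 2 \<and> endp j}"
  define Ji where "Ji = {j. j < D \<and> ?X j = 2 \<and> \<not> endp j}"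
  define FC where "FC = {q \<in> set F. set q \<subseteq> C}"
  have codeS: "v \<in> S \<Longrightarrow> code v \<noteq> 2" for v using code_S[of v] by auto
  have X2: "?X j = 2 \<longleftrightarrow> used j \<and> vx j \<in> C" for j
    using C codeS by (auto simp: config_def split: if_splits)
  have "config (U \<union> C) {} j = recolor ?X j" for j
    using C codeS by (auto simp: config_def recolor_def)
  then have conf: "config (U \<union> C) {} = recolor ?X" by auto
  have nbr: "2 \<le> ?X i" if "used i" "adj (vx j) (vx i)" "vx j \<in> C" for i j
  proof (cases "vx i \<in> S")
    case True
    then show ?thesis using that U code_S[of "vx i"] by (auto simp: config_def)
  next
    case False
    then have "vx i \<in> C" using closed that by blast
    then show ?thesis using X2[of i] that(1) by simp
  qed
  have cl: "closed ?X"
    unfolding closed_def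
  proof (intro allI impI conjI)
    fix j assume j: "?X j = 2" "0 < pos j"
    then obtain i where i: "j = Suc i" "pos i < l" using pos_gr0 by blast
    then have "used i" using j X2[of j] used_Suc by blast
    then show "2 \<le> ?X (j - 1)" using nbr[of i j] vx_adj[of i] adj_sym i j X2[of j] by simp
  next
    fix j assume j: "?X j = 2" "pos j < l"
    then show "2 \<le> ?X (Suc j)" using nbr[of "Suc j" j] vx_adj[of j] used_Suc X2[of j] by simp
  qed
  have finC: "finite C" using C(3) finite_subset by blast
  have FC: "lpath q \<and> set q \<subseteq> C \<and> q \<in> set P" if "q \<in> FC" for q
    using that F_in P_path by (auto simp: FC_def)
  have finFC: "finite FC" by (simp add: FC_def)
  \<comment> \<open>Disjointness of the packing turned into a count. It is used with
    \<open>R\<close> the part of \<open>C\<close> in \<open>A\<close> and \<open>m = 2\<close>, and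
    with the part outside \<open>A\<close> and \<open>m = l - 1\<close>.\<close>
  have bound: "card (vx ` J) + m * card FC \<le> card R"
    if J: "\<And>j. j \<in> J \<Longrightarrow> used j \<and> vx j \<in> R" "finite J" and R: "R \<subseteq> C"
      and m: "\<And>q. q \<in> FC \<Longrightarrow> card (set q \<inter> R) = m" for J R m
  proof -
    have finR: "finite R" using R finC finite_subset by blast
    have "card (\<Union>q\<in>FC. set q \<inter> R) = (\<Sum>q\<in>FC. card (set q \<inter> R))"
      using FC P_disjointD by (intro card_UN_disjoint finFC) (auto, blast)
    also have "\<dots> = m * card FC" using m by simp
    finally have 1: "card (\<Union>q\<in>FC. set q \<inter> R) = m * card FC" .
    have "vx ` J \<inter> (\<Union>q\<in>FC. set q \<inter> R) = {}"
    proof -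
      have "vx j \<notin> set q" if j: "j \<in> J" and q: "q \<in> FC" for j q
      proof
        assume a: "vx j \<in> set q"
        let ?r = "Q ! (j div Suc l)"
        have r: "?r \<in> set Q" "vx j \<in> set ?r" using used_path J(1)[OF j] by auto
        moreover have "set ?r \<inter> S \<noteq> {}" using r(1) by (simp add: Q_def)
        moreover have "set q \<inter> S = {}" using FC[OF q] C(2) by blast
        ultimately have "q \<noteq> ?r" by auto
        then have "set q \<inter> set ?r = {}" using P_disjointD[of q ?r] FC[OF q] Q_in[OF r(1)] by blast
        then show False using a r(2) by blast
      qed
      then show ?thesis by blast
    qed
    then have "card (vx ` J \<union> (\<Union>q\<in>FC. set q \<inter> R)) = card (vx ` J) + m * card FC"
      using J(2) finFC 1 by (subst card_Un_disjoint) auto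
    moreover have "vx ` J \<union> (\<Union>q\<in>FC. set q \<inter> R) \<subseteq> R" using J by auto
    ultimately show ?thesis using card_mono[OF finR] by metis
  qed
  have card_vx: "card (vx ` J) = card J" if "\<And>j. j \<in> J \<Longrightarrow> used j" for J
    using that vx_inj by (intro card_image inj_onI) blast
  have Je: "used j \<and> vx j \<in> C \<inter> A" if "j \<in> Je" for j using that X2 vx_A by (auto simp: Je_def)
  have Ji: "used j \<and> vx j \<in> C - A" if "j \<in> Ji" for j using that X2 vx_A by (auto simp: Ji_def)
  have "card (set q \<inter> (C \<inter> A)) = 2" "card (set q \<inter> (C - A)) = l - 1" if "q \<in> FC" for q
  proof -
    have "set q \<inter> (C \<inter> A) = set q \<inter> A" "set q \<inter> (C - A) = set q - A" using FC[OF that] by auto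
    then show "card (set q \<inter> (C \<inter> A)) = 2" "card (set q \<inter> (C - A)) = l - 1"
      using lpath_card FC[OF that] by auto
  qed
  then have "card (vx ` Je) + 2 * card FC \<le> card (C \<inter> A)"
      "card (vx ` Ji) + (l - 1) * card FC \<le> card (C - A)"
    using Je Ji by (intro bound; auto simp: Je_def Ji_def)+
  then have b: "card Je + 2 * card FC \<le> card (C \<inter> A)" "card Ji + (l - 1) * card FC \<le> card (C - A)"
    using card_vx Je Ji by auto
  have "card (C \<inter> A) \<le> n" using card_mono[of "{..<n}" "C \<inter> A"] C(3) by auto
  then have g: "card FC \<le> clique_yield n (card (C \<inter> A) - card Je) (card (C - A) - card Ji)" (is "_ \<le> ?g")
    using b by (intro clique_yield_ge) auto
  have in_C: "set q \<subseteq> C" if "q \<in> set F" "x \<in> set q" "x \<in> C" for q x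
    by (rule F_clique[OF that(1) _ that(2,3)]) (rule closed)
  have "{q \<in> set F. set q \<subseteq> U \<union> C} \<subseteq> {q \<in> set F. set q \<subseteq> U} \<union> FC"
  proof
    fix q assume "q \<in> {q \<in> set F. set q \<subseteq> U \<union> C}"
    then show "q \<in> {q \<in> set F. set q \<subseteq> U} \<union> FC"
      using in_C[of q] unfolding FC_def by (cases "\<exists>x\<in>set q. x \<in> C") (blast, auto)
  qed
  then have "card {q \<in> set F. set q \<subseteq> U \<union> C} \<le> card ({q \<in> set F. set q \<subseteq> U} \<union> FC)"
    by (intro card_mono) (auto simp: finFC)
  also have "\<dots> \<le> card {q \<in> set F. set q \<subseteq> U} + card FC" by (rule card_Un_le)
  finally have "gained (U \<union> C) {} \<le> gained U C + ?g"
    using g by (simp add: gained_def)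
  moreover have "(config (U \<union> C) {}, ?g) \<in> clique_moves (card (C \<inter> A)) (card (C - A)) ?X"
    unfolding clique_moves_def Je_def Ji_def conf using cl by simp
  ultimately show ?thesis by blast
qed

text \<open>Once all vertices are processed, every path of \<open>Q\<close> has its start counted
  and every path of \<open>F\<close> is covered, so the trace has gained all of
  \<open>P\<close>.\<close>

lemma complete_final:
  assumes "complete {..<n} {} T"
  shows "\<exists>c<N. final (dec c) \<and> length P < T c"
proof -
  let ?X = "config {..<n} {}"
  have X0: "?X j = 0 \<longleftrightarrow> \<not> used j" for j
    using vx_less[of j] code_S[of "vx j"] by (auto simp: config_def)
  have "final ?X" unfolding final_def X0 using used_Suc by blast
  moreover have "enc ?X < N" "dec (enc ?X) = ?X" using digits_config by (simp_all add: enc_less dec_enc)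
  moreover have "gained {..<n} {} = length P"
  proof -
    have "{j. used j \<and> pos j = 0 \<and> vx j \<in> {..<n} \<union> {}} = {j. used j \<and> pos j = 0}"
      using vx_less by auto
    also have "\<dots> = (\<lambda>i. slot i 0) ` {..<length Q}"
    proof
      show "{j. used j \<and> pos j = 0} \<subseteq> (\<lambda>i. slot i 0) ` {..<length Q}"
      proof
        fix j assume "j \<in> {j. used j \<and> pos j = 0}"
        then have "j = slot (j div Suc l) 0" "j div Suc l \<in> {..<length Q}"
          using slot_div_pos[of j] by (auto simp: used_def)
        then show "j \<in> (\<lambda>i. slot i 0) ` {..<length Q}" by (rule image_eqI)
      qed
      show "(\<lambda>i. slot i 0) ` {..<length Q} \<subseteq> {j. used j \<and> pos j = 0}"
        by (auto simp: used_def slot_div pos_slot)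
    qed
    also have "card \<dots> = card {..<length Q}"
    proof (rule card_image, rule inj_onI)
      fix i i' assume "slot i 0 = slot i' 0"
      then have "slot i 0 div Suc l = slot i' 0 div Suc l" by simp
      then show "i = i'" by (simp only: slot_div le0)
    qed
    finally have "card {j. used j \<and> pos j = 0 \<and> vx j \<in> {..<n} \<union> {}} = length Q" by simp
    moreover have "set q \<subseteq> {..<n}" if "q \<in> set F" for q
      using P_path[of q] F_in[OF that] by (simp add: lpath_def)
    then have "{q \<in> set F. set q \<subseteq> {..<n}} = set F" by blast
    moreover have "card (set F) = length F" using P_distinct by (intro distinct_card) (simp add: F_def)
    moreover have "length Q + length F = length P"
      unfolding Q_def F_def by (rule sum_length_filter_compl)
    ultimately show ?thesis by (simp add: gained_def)
  qed
  ultimately show ?thesis using assms unfolding complete_def by metis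
qed

end

section \<open>Preparing the tables\<close>

abbreviation (input) "rB \<equiv> 3 :: nat"
abbreviation (input) "rD \<equiv> 4 :: nat"
abbreviation (input) "rN \<equiv> 5 :: nat"
abbreviation (input) "rL \<equiv> 6 :: nat"
abbreviation (input) "rS \<equiv> 7 :: nat"
abbreviation (input) "rU \<equiv> 8 :: nat"
abbreviation (input) "rV \<equiv> 9 :: nat"
abbreviation (input) "rW \<equiv> 10 :: nat"
abbreviation (input) "rC \<equiv> 11 :: nat"
abbreviation (input) "rJ \<equiv> 12 :: nat"
abbreviation (input) "rI \<equiv> 13 :: nat"
abbreviation (input) "rQ \<equiv> 14 :: nat"
abbreviation (input) "rRem \<equiv> 15 :: nat"
abbreviation (input) "rEnc \<equiv> 16 :: nat"
abbreviation (input) "rVal \<equiv> 17 :: nat"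
abbreviation (input) "rOk \<equiv> 18 :: nat"
abbreviation (input) "rXa \<equiv> 19 :: nat"
abbreviation (input) "rXb \<equiv> 20 :: nat"
abbreviation (input) "rAlpha \<equiv> 21 :: nat"
abbreviation (input) "rBeta \<equiv> 22 :: nat"
abbreviation (input) "rAcc \<equiv> 23 :: nat"
abbreviation (input) "rR \<equiv> 24 :: nat"
abbreviation (input) "rFlag \<equiv> 25 :: nat"
abbreviation (input) "rJ2 \<equiv> 26 :: nat"
abbreviation (input) "rI2 \<equiv> 27 :: nat"

abbreviation (input) "aA \<equiv> 0 :: nat"
abbreviation (input) "aAdj \<equiv> 1 :: nat"
abbreviation (input) "aRow \<equiv> 2 :: nat"
abbreviation (input) "aDone \<equiv> 3 :: nat"
abbreviation (input) "aCode \<equiv> 4 :: nat"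
abbreviation (input) "aSv \<equiv> 5 :: nat"
abbreviation (input) "aPos \<equiv> 6 :: nat"
abbreviation (input) "aT \<equiv> 7 :: nat"
abbreviation (input) "aT' \<equiv> 8 :: nat"
abbreviation (input) "aX \<equiv> 9 :: nat"

lemma For_bound:
  assumes "fst s y = b" "I 0 s"
    and "\<And>i s'. i < b \<Longrightarrow> I i s' \<Longrightarrow>
      (\<And>z. z \<notin> insert x (rmods c) \<Longrightarrow> fst s' z = fst s z) \<Longrightarrow>
      (\<And>a. a \<notin> amods c \<Longrightarrow> snd s' a = snd s a) \<Longrightarrow>
      I (Suc i) (sem c (setr x i s'))"
  shows "I b (sem (For x y c) s)"
  using For_rule[of I s y x c] assms by blast

section \<open>Greedy selection of a set hitting all induced paths on three vertices\<close>

definition marked :: "nat \<Rightarrow> state \<Rightarrow> nat set" where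
  "marked n s = {v. v < n \<and> snd s aDone v \<noteq> 0}"

text \<open>Row offsets \<open>u * n\<close> of the adjacency matrix, tabulated by repeated addition
  because the machine has no multiplication.\<close>

definition c_row :: cmd where
  "c_row = Assign rAcc (Num 0) ;; For rU 0 (
     Update aRow (Reg rU) (Reg rAcc) ;;
     Assign rAcc (Add (Reg rAcc) (Reg 0)))"

lemma sem_c_row:
  assumes "u < fst s 0"
  shows "snd (sem c_row s) aRow u = u * fst s 0"
proof -
  define s1 where "s1 = setr rAcc 0 s"
  let ?I = "\<lambda>i s'. fst s' rAcc = i * fst s 0 \<and> (\<forall>u<i. snd s' aRow u = u * fst s 0)"
  have "?I (fst s1 0) (sem (For rU 0 (Update aRow (Reg rU) (Reg rAcc) ;;
     Assign rAcc (Add (Reg rAcc) (Reg 0)))) s1)"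
  proof (rule For_rule[where I = ?I], goal_cases)
    case 1
    then show ?case by (simp add: s1_def)
  next
    case (2 i s')
    have "fst s' 0 = fst s 0" using 2(3)[of 0] by (simp add: s1_def)
    with 2(2) show ?case by (auto simp: less_Suc_eq)
  qed
  then show ?thesis using assms by (simp add: c_row_def s1_def)
qed

definition adj_expr :: "expr \<Rightarrow> expr \<Rightarrow> expr" where
  "adj_expr e1 e2 = Cell aAdj (Add (Cell aRow e1) e2)"

lemma eval_adj_expr [simp]: "eval (adj_expr e1 e2) s = snd s aAdj (snd s aRow (eval e1 s) + eval e2 s)"
  and holds_adj_expr [simp]:
    "holds (adj_expr e1 e2) s \<longleftrightarrow> snd s aAdj (snd s aRow (eval e1 s) + eval e2 s) \<noteq> 0"
  by (simp_all add: adj_expr_def)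

definition adjacency :: "nat \<Rightarrow> nat set set \<Rightarrow> state \<Rightarrow> bool" where
  "adjacency n E s \<longleftrightarrow> (\<forall>u<n. \<forall>v<n. snd s aAdj (snd s aRow u + v) \<noteq> 0 \<longleftrightarrow> {u, v} \<in> E)"

definition cond_P3 :: expr where
  "cond_P3 = And_expr (And_expr (And_expr (adj_expr (Reg rU) (Reg rV)) (adj_expr (Reg rV) (Reg rW)))
     (And_expr (Not_expr (adj_expr (Reg rU) (Reg rW))) (Not_expr (Eq_expr (Reg rU) (Reg rW)))))
     (And_expr (And_expr (Not_expr (Cell aDone (Reg rU))) (Not_expr (Cell aDone (Reg rV))))
       (Not_expr (Cell aDone (Reg rW))))"

definition c_mark :: cmd where
  "c_mark = If cond_P3 (Update aDone (Reg rU) (Num 1) ;; Update aDone (Reg rV) (Num 1) ;;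
     Update aDone (Reg rW) (Num 1)) SkipC"

definition c_select :: cmd where
  "c_select = For rU 0 (For rV 0 (For rW 0 c_mark))"

text \<open>An induced path with middle vertex \<open>v\<close>, which differs from \<open>u\<close>
  and \<open>w\<close> as \<open>E\<close> has no loops. Its absence for all triples means that
  deleting the set leaves disjoint cliques.\<close>

definition P3 :: "nat set set \<Rightarrow> nat set \<Rightarrow> nat \<Rightarrow> nat \<Rightarrow> nat \<Rightarrow> bool" where
  "P3 E S u v w \<longleftrightarrow> {u, v} \<in> E \<and> {v, w} \<in> E \<and> {u, w} \<notin> E \<and> u \<noteq> w \<and> u \<notin> S \<and> v \<notin> S \<and> w \<notin> S"

text \<open>Each selected triple hits every solution, and the selected triples are disjoint.\<close>

definition packed :: "nat \<Rightarrow> nat set set \<Rightarrow> nat set \<Rightarrow> (nat \<times> nat \<times> nat) set \<Rightarrow> nat set \<Rightarrow> bool" where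
  "packed n E K Done S \<longleftrightarrow> S \<subseteq> {..<n} \<and> card S \<le> 3 * card (S \<inter> K) \<and>
     (\<forall>(u, v, w)\<in>Done. \<not> P3 E S u v w)"

lemma packed_antimono: "packed n E K Done S \<Longrightarrow> Done' \<subseteq> Done \<Longrightarrow> packed n E K Done' S"
  unfolding packed_def by auto

text \<open>A selected triple is disjoint from \<open>S\<close> and meets \<open>K\<close>, being
  otherwise an induced path avoiding \<open>K\<close>; so \<open>card S\<close> grows by 3 and
  \<open>card (S \<inter> K)\<close> by at least 1. Triples examined earlier stay harmless as
  \<open>S\<close> only grows.\<close>

lemma packed_step:
  assumes "packed n E K Done S" and K: "\<And>u v w. \<not> P3 E K u v w"
    and E: "\<And>v. {v} \<notin> E" and less: "u < n" "v < n" "w < n"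
  shows "packed n E K (insert (u, v, w) Done) (if P3 E S u v w then insert u (insert v (insert w S)) else S)"
proof (cases "P3 E S u v w")
  case True
  let ?S = "insert u (insert v (insert w S))"
  have fin: "finite S" using assms(1) finite_subset unfolding packed_def by blast
  have d: "u \<noteq> v" "v \<noteq> w" "u \<noteq> w" "u \<notin> S" "v \<notin> S" "w \<notin> S"
    using True E unfolding P3_def by auto
  have "u \<in> K \<or> v \<in> K \<or> w \<in> K" using K[of u v w] True unfolding P3_def by blast
  then obtain x where x: "x \<in> {u, v, w}" "x \<in> K" by blast
  have "insert x (S \<inter> K) \<subseteq> ?S \<inter> K" using x by auto
  moreover have "x \<notin> S" using x d by auto
  ultimately have "Suc (card (S \<inter> K)) \<le> card (?S \<inter> K)"
    using card_mono[of "?S \<inter> K" "insert x (S \<inter> K)"] fin by simp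
  moreover have "card ?S = card S + 3" using d fin by simp
  moreover have "\<not> P3 E ?S u' v' w'" if "(u', v', w') \<in> insert (u, v, w) Done" for u' v' w'
    using assms(1) that unfolding packed_def P3_def by auto
  moreover have "?S \<subseteq> {..<n}" using assms(1) less unfolding packed_def by auto
  moreover have "card S \<le> 3 * card (S \<inter> K)" using assms(1) unfolding packed_def by simp
  ultimately have "packed n E K (insert (u, v, w) Done) ?S" unfolding packed_def by auto
  then show ?thesis using True by simp
next
  case False
  then show ?thesis using assms(1) unfolding packed_def by auto
qed

lemma sem_c_mark:
  assumes "adjacency n E s" "fst s rU = u" "fst s rV = v" "fst s rW = w" "u < n" "v < n" "w < n"
  shows "marked n (sem c_mark s) =
    (if P3 E (marked n s) u v w then insert u (insert v (insert w (marked n s))) else marked n s)"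
proof -
  have "holds cond_P3 s \<longleftrightarrow> P3 E (marked n s) u v w"
    using assms unfolding adjacency_def P3_def cond_P3_def marked_def by auto
  then show ?thesis using assms by (auto simp: c_mark_def marked_def)
qed

lemma mods_c_mark [simp]: "rmods c_mark = {}" "amods c_mark = {aDone}"
  by (auto simp: c_mark_def)

text \<open>One pass over all triples suffices, because enlarging the selected set creates no new
  \<open>P3\<close>. The three nested invariants list the triples examined so far in lexicographic
  order.\<close>

lemma sem_c_select:
  assumes adj: "adjacency n E s" and n: "fst s 0 = n" and m: "marked n s = {}"
    and K: "\<And>u v w. \<not> P3 E K u v w" and E: "\<And>v. {v} \<notin> E"
  shows "packed n E K ({..<n} \<times> {..<n} \<times> {..<n}) (marked n (sem c_select s))"
proof -
  let ?D = "{..<n} \<times> {..<n}"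
  let ?Iu = "\<lambda>i s'. packed n E K ({..<i} \<times> ?D) (marked n s')"
  show ?thesis
    unfolding c_select_def
  proof (rule For_bound[where I = ?Iu, OF n], goal_cases)
    case 1
    then show ?case by (simp add: packed_def m)
  next
    case (2 i su)
    let ?Iv = "\<lambda>j s'. packed n E K ({..<i} \<times> ?D \<union> {i} \<times> {..<j} \<times> {..<n}) (marked n s')"
    let ?su = "setr rU i su"
    have su: "fst ?su 0 = n" "adjacency n E ?su" "marked n ?su = marked n su"
      using 2(3)[of 0] 2(4)[of aAdj] 2(4)[of aRow] n adj by (simp_all add: adjacency_def marked_def)
    have i: "i < n" by (rule 2(1))
    have "?Iv n (sem (For rV 0 (For rW 0 c_mark)) ?su)"
    proof (rule For_bound[where I = ?Iv, OF su(1)], goal_cases)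
      case 1
      then show ?case using 2(2) su(3) by simp
    next
      case (2 j sv)
      let ?Dj = "{..<i} \<times> ?D \<union> {i} \<times> {..<j} \<times> {..<n}"
      let ?Iw = "\<lambda>k s'. packed n E K (?Dj \<union> {i} \<times> {j} \<times> {..<k}) (marked n s')"
      let ?sv = "setr rV j sv"
      have sv: "fst ?sv 0 = n" "fst ?sv rU = i" "adjacency n E ?sv" "marked n ?sv = marked n sv"
        using 2(3)[of 0] 2(3)[of rU] 2(4)[of aAdj] 2(4)[of aRow] su by (simp_all add: adjacency_def marked_def)
      have j: "j < n" by (rule 2(1))
      have "?Iw n (sem (For rW 0 c_mark) ?sv)"
      proof (rule For_bound[where I = ?Iw, OF sv(1)], goal_cases)
        case 1
        then show ?case using 2(2) sv(4) by simp
      next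
        case (2 k sw)
        let ?sw = "setr rW k sw"
        have sw: "fst ?sw rU = i" "fst ?sw rV = j" "fst ?sw rW = k" "adjacency n E ?sw"
            "marked n ?sw = marked n sw"
          using 2(3)[of rU] 2(3)[of rV] 2(4)[of aAdj] 2(4)[of aRow] sv
          by (simp_all add: adjacency_def marked_def)
        have k: "k < n" by (rule 2(1))
        have Dk: "?Dj \<union> {i} \<times> {j} \<times> {..<Suc k} = insert (i, j, k) (?Dj \<union> {i} \<times> {j} \<times> {..<k})"
          by auto
        show ?case
          unfolding Dk sem_c_mark[OF sw(4,1,2,3) i j k, unfolded sw(5)]
          by (rule packed_step[OF 2(2) K E i j k])
      qed
      then show ?case by (rule packed_antimono) (auto simp: less_Suc_eq)
    qed
    then show ?case by (rule packed_antimono) (auto simp: less_Suc_eq)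
  qed
qed

section \<open>Numbering of digits, positions and states\<close>

definition c_code :: cmd where
  "c_code = Assign rB (Num 3) ;; For rV 0 (If (Cell aDone (Reg rV))
     (Update aSv (Reg rB) (Reg rV) ;; Update aCode (Reg rV) (Reg rB) ;; Assign rB (Add (Reg rB) (Num 1)))
     (Update aCode (Reg rV) (Num 2)))"

lemma sem_c_code:
  assumes n: "fst s 0 = n"
  defines "S \<equiv> marked n s" and "s' \<equiv> sem c_code s"
  shows "fst s' rB = card S + 3"
    and "v \<in> S \<Longrightarrow> 3 \<le> snd s' aCode v \<and> snd s' aCode v < card S + 3 \<and> snd s' aSv (snd s' aCode v) = v"
    and "v < n \<Longrightarrow> v \<notin> S \<Longrightarrow> snd s' aCode v = 2"
    and "3 \<le> i \<Longrightarrow> i < card S + 3 \<Longrightarrow> snd s' aSv i < n"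
proof -
  define s1 where "s1 = setr rB 3 s"
  let ?I = "\<lambda>i s'. fst s' rB = card (S \<inter> {..<i}) + 3 \<and>
    (\<forall>v<i. v \<in> S \<longrightarrow> 3 \<le> snd s' aCode v \<and> snd s' aCode v < fst s' rB \<and> snd s' aSv (snd s' aCode v) = v) \<and>
    (\<forall>v<i. v \<notin> S \<longrightarrow> snd s' aCode v = 2) \<and>
    (\<forall>c. 3 \<le> c \<longrightarrow> c < fst s' rB \<longrightarrow> snd s' aSv c < n)"
  let ?c = "If (Cell aDone (Reg rV)) (Update aSv (Reg rB) (Reg rV) ;; Update aCode (Reg rV) (Reg rB) ;;
    Assign rB (Add (Reg rB) (Num 1))) (Update aCode (Reg rV) (Num 2))"
  have s': "s' = sem (For rV 0 ?c) s1" by (simp add: s'_def c_code_def s1_def)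
  have "?I (fst s1 0) s'"
    unfolding s'
  proof (rule For_rule[where I = ?I], goal_cases)
    case 1
    then show ?case by (simp add: s1_def)
  next
    case (2 i s')
    have i: "i < n" using 2(1) n by (simp add: s1_def)
    have "snd s' aDone = snd s aDone" using 2(4)[of aDone] by (simp add: s1_def)
    then have iS: "snd s' aDone i \<noteq> 0 \<longleftrightarrow> i \<in> S" using i by (simp add: S_def marked_def)
    show ?case
    proof (cases "i \<in> S")
      case True
      then have "S \<inter> {..<Suc i} = insert i (S \<inter> {..<i})" by auto
      then have "card (S \<inter> {..<Suc i}) = Suc (card (S \<inter> {..<i}))" by simp
      then show ?thesis using 2(2) True iS i by (auto simp: less_Suc_eq)
    next
      case False
      then have "S \<inter> {..<Suc i} = S \<inter> {..<i}" by (auto simp: less_Suc_eq)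
      then show ?thesis using 2(2) False iS i by (auto simp: less_Suc_eq)
    qed
  qed
  moreover have "fst s1 0 = n" "S \<inter> {..<n} = S" using n by (auto simp: s1_def S_def marked_def)
  ultimately have I: "?I n s'" and c: "card (S \<inter> {..<n}) = card S" by metis+
  have "v < n" if "v \<in> S" for v using that by (simp add: S_def marked_def)
  moreover from I have B: "fst s' rB = card S + 3" unfolding c by (rule conjunct1)
  moreover note I[THEN conjunct2, unfolded B]
  ultimately show "fst s' rB = card S + 3"
    "v \<in> S \<Longrightarrow> 3 \<le> snd s' aCode v \<and> snd s' aCode v < card S + 3 \<and> snd s' aSv (snd s' aCode v) = v"
    "v < n \<Longrightarrow> v \<notin> S \<Longrightarrow> snd s' aCode v = 2"
    "3 \<le> i \<Longrightarrow> i < card S + 3 \<Longrightarrow> snd s' aSv i < n"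
    by simp_all
qed

definition c_slots :: cmd where
  "c_slots = Assign rS (Sub (Reg rB) (Num 3)) ;; Assign rL (Add (Reg 2) (Num 1)) ;; Assign rD (Num 0)"

definition c_pos :: cmd where
  "c_pos = For rI rS (For rJ rL (Update aPos (Reg rD) (Reg rJ) ;; Assign rD (Add (Reg rD) (Num 1))))"

text \<open>Running through paths and positions in two nested loops yields both the residues
  \<open>j mod Suc l\<close> and, as the final counter, the number of slots, without division or
  multiplication.\<close>

lemma sem_c_pos:
  assumes "fst s rL = Suc l" "fst s rD = 0"
  shows "fst (sem c_pos s) rD = fst s rS * Suc l"
    and "j < fst s rS * Suc l \<Longrightarrow> snd (sem c_pos s) aPos j = j mod Suc l"
proof -
  let ?I = "\<lambda>i h s'. fst s' rD = i * Suc l + h \<and> (\<forall>j<i * Suc l + h. snd s' aPos j = j mod Suc l)"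
  have "?I (fst s rS) 0 (sem c_pos s)"
    unfolding c_pos_def
  proof (rule For_rule[where I = "\<lambda>i. ?I i 0"], goal_cases)
    case 1
    then show ?case by (simp add: assms)
  next
    case (2 i s1)
    let ?s1 = "setr rI i s1"
    have l: "fst ?s1 rL = Suc l" using 2(3)[of rL] assms by simp
    have "?I i (fst ?s1 rL) (sem (For rJ rL (Update aPos (Reg rD) (Reg rJ) ;;
        Assign rD (Add (Reg rD) (Num 1)))) ?s1)"
    proof (rule For_rule[where I = "?I i"], goal_cases)
      case 1
      then show ?case using 2(2) by simp
    next
      case (2 h s2)
      have "h < Suc l" using 2(1) l by simp
      then have "(i * Suc l + h) mod Suc l = h" using mod_mult_self3[of i "Suc l" h] by simp
      then show ?case using 2(2) by (auto simp: less_Suc_eq simp del: mult_Suc_right)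
    qed
    moreover have "i * Suc l + Suc l = Suc i * Suc l + 0" by simp
    ultimately show ?case unfolding l by metis
  qed
  then show "fst (sem c_pos s) rD = fst s rS * Suc l"
    and "j < fst s rS * Suc l \<Longrightarrow> snd (sem c_pos s) aPos j = j mod Suc l" by simp_all
qed

definition c_power :: cmd where
  "c_power = For rJ rD (Assign rAcc (Num 0) ;; For rI rB (Assign rAcc (Add (Reg rAcc) (Reg rN))) ;;
     Assign rN (Reg rAcc))"

lemma sem_add_loop:
  "z \<noteq> x \<Longrightarrow> z \<noteq> i \<Longrightarrow> x \<noteq> i \<Longrightarrow>
    fst (sem (For i y (Assign x (Add (Reg x) (Reg z)))) s) x = fst s x + fst s y * fst s z"
proof -
  assume ne: "z \<noteq> x" "z \<noteq> i" "x \<noteq> i"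
  let ?I = "\<lambda>j s'. fst s' x = fst s x + j * fst s z"
  show ?thesis
  proof (rule For_rule[where I = ?I], goal_cases)
    case (2 j s')
    then show ?case using ne by simp
  qed simp
qed

text \<open>Each multiplication by the base is a loop of additions, so the loop bounds are the
  number of slots and the base, not the power itself.\<close>

lemma sem_c_power:
  assumes "fst s rN = 1"
  shows "fst (sem c_power s) rN = fst s rB ^ fst s rD"
proof -
  let ?I = "\<lambda>j s'. fst s' rN = fst s rB ^ j"
  show ?thesis
    unfolding c_power_def
  proof (rule For_rule[where I = ?I], goal_cases)
    case (2 j s')
    let ?s1 = "setr rAcc 0 (setr rJ j s')"
    have "fst (sem (For rI rB (Assign rAcc (Add (Reg rAcc) (Reg rN)))) ?s1) rAcc =
        fst ?s1 rAcc + fst ?s1 rB * fst ?s1 rN"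
      by (rule sem_add_loop) simp_all
    moreover have "fst s' rB = fst s rB" using 2(3)[of rB] by simp
    ultimately show ?case using 2(2) by (simp del: sem.simps(6))
  qed (simp add: assms)
qed

section \<open>Implementation of the dynamic program\<close>

text \<open>Division by repeated subtraction. The dividend is below \<open>N\<close>, so
  \<open>N\<close> rounds are enough for the quotient; surplus rounds do nothing.\<close>

definition c_div :: cmd where
  "c_div = For rI2 rN (If (Le_expr (Reg rB) (Reg rRem))
     (Assign rRem (Sub (Reg rRem) (Reg rB)) ;; Assign rQ (Add (Reg rQ) (Num 1))) SkipC)"

definition c_dec :: cmd where
  "c_dec = Assign rRem (Reg rC) ;; For rJ rD (Assign rQ (Num 0) ;; c_div ;;
     Update aX (Reg rJ) (Reg rRem) ;; Assign rRem (Reg rQ))"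

text \<open>Horner's rule from the most significant digit on. The counter \<open>rJ2\<close> is
  separate because encoding takes place inside a loop over \<open>rJ\<close> whose body still needs
  that value.\<close>

definition c_enc :: cmd where
  "c_enc = Assign rEnc (Num 0) ;; For rJ2 rD (Assign rAcc (Num 0) ;;
     For rI2 rB (Assign rAcc (Add (Reg rAcc) (Reg rEnc))) ;;
     Assign rEnc (Add (Reg rAcc) (Cell aX (Sub (Sub (Reg rD) (Num 1)) (Reg rJ2)))))"

definition c_relax :: cmd where
  "c_relax = c_enc ;; If (Less_expr (Cell aT' (Reg rEnc)) (Reg rVal))
     (Update aT' (Reg rEnc) (Reg rVal)) SkipC"

definition pos_expr where "pos_expr = Cell aPos (Reg rJ)"
definition digit_expr where "digit_expr = Cell aX (Reg rJ)"
definition prev_expr where "prev_expr = Cell aX (Sub (Reg rJ) (Num 1))"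
definition next_expr where "next_expr = Cell aX (Add (Reg rJ) (Num 1))"
definition endp_expr where
  "endp_expr = Or_expr (Eq_expr pos_expr (Num 0)) (Eq_expr pos_expr (Reg 2))"

definition compat_expr where
  "compat_expr = And_expr (And_expr (Eq_expr digit_expr (Num 0)) (Iff_expr (Cell aA (Reg rV)) endp_expr))
     (And_expr
       (Imp_expr (And_expr (Less_expr (Num 0) pos_expr) (Le_expr (Num 3) prev_expr))
         (adj_expr (Reg rV) (Cell aSv prev_expr)))
       (Imp_expr (And_expr (Less_expr pos_expr (Reg 2)) (Le_expr (Num 3) next_expr))
         (adj_expr (Reg rV) (Cell aSv next_expr))))"

text \<open>Each move is tried in place: the digit is written, the resulting state relaxed, and the
  slot, which was empty, reset to 0.\<close>

definition c_vertex :: cmd where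
  "c_vertex = Assign rVal (Cell aT (Reg rC)) ;; c_relax ;; For rJ rD (If compat_expr
     (Update aX (Reg rJ) (Cell aCode (Reg rV)) ;;
      Assign rVal (Add (Cell aT (Reg rC)) (Sub (Num 1) pos_expr)) ;; c_relax ;;
      Update aX (Reg rJ) (Num 0)) SkipC)"

definition open_expr where
  "open_expr = Or_expr (And_expr (Less_expr (Num 0) pos_expr) (Less_expr prev_expr (Num 2)))
     (And_expr (Less_expr pos_expr (Reg 2)) (Less_expr next_expr (Num 2)))"

definition c_check :: cmd where
  "c_check = For rJ rD (If (Eq_expr digit_expr (Num 2))
     (If endp_expr (Assign rXa (Sub (Reg rXa) (Num 1))) (Assign rXb (Sub (Reg rXb) (Num 1))) ;;
      If open_expr (Assign rOk (Num 0)) SkipC) SkipC)"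

definition c_recolor :: cmd where
  "c_recolor = For rJ rD (If (Eq_expr digit_expr (Num 2)) (Update aX (Reg rJ) (Num 1)) SkipC)"

definition c_yield :: cmd where
  "c_yield = For rI 0 (If (And_expr (Le_expr (Num 2) (Reg rXa)) (Le_expr (Sub (Reg 2) (Num 1)) (Reg rXb)))
     (Assign rXa (Sub (Reg rXa) (Num 2)) ;; Assign rXb (Sub (Reg rXb) (Sub (Reg 2) (Num 1))) ;;
      Assign rVal (Add (Reg rVal) (Num 1))) SkipC)"

definition c_clique :: cmd where
  "c_clique = Assign rOk (Num 1) ;; Assign rXa (Reg rAlpha) ;; Assign rXb (Reg rBeta) ;; c_check ;;
     c_recolor ;; Assign rVal (Cell aT (Reg rC)) ;; c_yield ;; If (Reg rOk) c_relax SkipC"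

text \<open>The new table is built separately, in a cleared array, so every state is expanded with
  its old value and states without a predecessor become unreachable.\<close>

definition c_step :: "cmd \<Rightarrow> cmd" where
  "c_step body = For rC rN (Update aT' (Reg rC) (Num 0)) ;;
     For rC rN (If (Cell aT (Reg rC)) (c_dec ;; body) SkipC) ;;
     For rC rN (Update aT (Reg rC) (Cell aT' (Reg rC)))"

text \<open>From here on \<open>aDone\<close> marks the processed vertices: initially \<open>S\<close>, then also those of the
  cliques visited so far.\<close>

definition c_phase1 :: cmd where
  "c_phase1 = Update aT (Num 0) (Num 1) ;; For rV 0 (If (Cell aDone (Reg rV)) (c_step c_vertex) SkipC)"

definition c_collect :: cmd where
  "c_collect = For rV 0 (If (And_expr (Not_expr (Cell aDone (Reg rV)))
       (Or_expr (Eq_expr (Reg rV) (Reg rR)) (adj_expr (Reg rR) (Reg rV))))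
     (Update aDone (Reg rV) (Num 1) ;;
      If (Cell aA (Reg rV)) (Assign rAlpha (Add (Reg rAlpha) (Num 1)))
        (Assign rBeta (Add (Reg rBeta) (Num 1))) ;;
      c_step c_vertex) SkipC)"

definition c_phase2 :: cmd where
  "c_phase2 = For rR 0 (If (Not_expr (Cell aDone (Reg rR)))
     (Assign rAlpha (Num 0) ;; Assign rBeta (Num 0) ;; c_collect ;; c_step c_clique) SkipC)"

definition c_final :: cmd where
  "c_final = For rJ rD (If (And_expr (Less_expr pos_expr (Reg 2))
     (Not_expr (Iff_expr digit_expr next_expr))) (Assign rOk (Num 0)) SkipC)"

text \<open>An entry exceeding \<open>k\<close> is nonzero and, entries being shifted by one, stands
  for at least \<open>k\<close> gained paths.\<close>

definition c_answer :: cmd where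
  "c_answer = Assign rFlag (Num 0) ;; For rC rN (If (Less_expr (Reg 1) (Cell aT (Reg rC)))
     (c_dec ;; Assign rOk (Num 1) ;; c_final ;;
      If (Reg rOk) (Assign rFlag (Num 1)) SkipC) SkipC)"

lemma mods_simps [simp]:
  "rmods c_div = {rI2, rRem, rQ}" "amods c_div = {}"
  "rmods c_dec = {rRem, rJ, rQ, rI2}" "amods c_dec = {aX}"
  "rmods c_enc = {rEnc, rJ2, rAcc, rI2}" "amods c_enc = {}"
  "rmods c_relax = {rEnc, rJ2, rAcc, rI2}" "amods c_relax = {aT'}"
  "rmods c_vertex = {rVal, rJ, rEnc, rJ2, rAcc, rI2}" "amods c_vertex = {aX, aT'}"
  "rmods c_check = {rJ, rXa, rXb, rOk}" "amods c_check = {}"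
  "rmods c_recolor = {rJ}" "amods c_recolor = {aX}"
  "rmods c_yield = {rI, rXa, rXb, rVal}" "amods c_yield = {}"
  "rmods c_clique = {rOk, rXa, rXb, rJ, rVal, rI, rEnc, rJ2, rAcc, rI2}" "amods c_clique = {aX, aT'}"
  "rmods (c_step body) = {rC, rRem, rJ, rQ, rI2} \<union> rmods body" "amods (c_step body) = {aX, aT', aT} \<union> amods body"
  "rmods c_final = {rJ, rOk}" "amods c_final = {}"
  by (auto simp: c_final_def c_div_def c_dec_def c_enc_def c_relax_def c_vertex_def c_check_def c_recolor_def
      c_yield_def c_clique_def c_step_def)

section \<open>Correctness of the commands for single moves\<close>

context path_dp begin

text \<open>The data that stay fixed during the dynamic program; \<open>ctx_sem\<close> preserves
  them by the syntactic frame alone.\<close>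

definition ctx :: "state \<Rightarrow> bool" where
  "ctx s \<longleftrightarrow> fst s 0 = n \<and> fst s 2 = l \<and> fst s rB = B \<and> fst s rD = D \<and> fst s rN = N \<and>
     (\<forall>v<n. snd s aA v \<noteq> 0 \<longleftrightarrow> v \<in> A) \<and> adjacency n E s \<and> (\<forall>v<n. snd s aCode v = code v) \<and>
     (\<forall>i. 3 \<le> i \<longrightarrow> i < B \<longrightarrow> snd s aSv i = sv i) \<and> (\<forall>j<D. snd s aPos j = pos j)"

lemma ctxD:
  assumes "ctx s"
  shows "fst s 0 = n" "fst s 2 = l" "fst s rB = B" "fst s rD = D" "fst s rN = N" "adjacency n E s"
    "v < n \<Longrightarrow> snd s aA v \<noteq> 0 \<longleftrightarrow> v \<in> A" "v < n \<Longrightarrow> snd s aCode v = code v"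
    "3 \<le> i \<Longrightarrow> i < B \<Longrightarrow> snd s aSv i = sv i" "j < D \<Longrightarrow> snd s aPos j = pos j"
  using assms unfolding ctx_def by simp_all

lemma ctx_cong:
  assumes "ctx s" "\<And>x. x \<in> {0, 2, rB, rD, rN} \<Longrightarrow> fst s' x = fst s x"
    "\<And>a. a \<in> {aA, aAdj, aRow, aCode, aSv, aPos} \<Longrightarrow> snd s' a = snd s a"
  shows "ctx s'"
  using assms(1) unfolding ctx_def adjacency_def by (simp add: assms(2,3))

lemma ctx_sem:
  assumes "ctx s" "{0, 2, rB, rD, rN} \<inter> rmods c = {}" "{aA, aAdj, aRow, aCode, aSv, aPos} \<inter> amods c = {}"
  shows "ctx (sem c s)"
proof (rule ctx_cong[OF assms(1)])
  show "fst (sem c s) x = fst s x" if "x \<in> {0, 2, rB, rD, rN}" for x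
    using assms(2) that by (intro frame_reg) blast
  show "snd (sem c s) a = snd s a" if "a \<in> {aA, aAdj, aRow, aCode, aSv, aPos}" for a
    using assms(3) that by (intro frame_arr) blast
qed

lemma ctx_setr: "ctx s \<Longrightarrow> x \<notin> {0, 2, rB, rD, rN} \<Longrightarrow> ctx (setr x i s)"
  by (erule ctx_cong) auto

lemma ctx_seta: "ctx s \<Longrightarrow> a \<notin> {aA, aAdj, aRow, aCode, aSv, aPos} \<Longrightarrow> ctx (seta a i w s)"
  by (erule ctx_cong) auto

text \<open>Keeping the cells from \<open>D\<close> on at 0 makes the whole array, as a function,
  equal to the decoded state.\<close>

definition clean :: "state \<Rightarrow> bool" where "clean s \<longleftrightarrow> (\<forall>j\<ge>D. snd s aX j = 0)"

lemma sem_c_div: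
  assumes s: "ctx s" and Q: "fst s rQ = 0" and R: "fst s rRem = r" "r < N"
  shows "fst (sem c_div s) rRem = r mod B" "fst (sem c_div s) rQ = r div B"
proof -
  \<comment> \<open>Either the remainder is already below \<open>B\<close>, or every round so far
    has subtracted. In the latter case \<open>N\<close> rounds would need a dividend of at least
    \<open>N * B\<close>.\<close>
  let ?I = "\<lambda>i s'. fst s' rRem + fst s' rQ * B = r \<and> (fst s' rRem < B \<or> fst s' rQ = i)"
  have I: "?I N (sem c_div s)"
    unfolding c_div_def
  proof (rule For_bound[where I = ?I, OF ctxD(5)[OF s]], goal_cases)
    case 1
    then show ?case using Q R by simp
  next
    case (2 i s')
    have "fst s' rB = B" using 2(3)[of rB] ctxD(3)[OF s] by simp
    then show ?case using 2(2) by (auto simp: algebra_simps)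
  qed
  let ?s = "sem c_div s"
  have less: "fst ?s rRem < B"
  proof (rule ccontr)
    assume "\<not> fst ?s rRem < B"
    then have "fst ?s rRem + N * B = r" using I by auto
    moreover have "N \<le> N * B" using B_pos by simp
    ultimately show False using R(2) by linarith
  qed
  have "r = fst ?s rRem + B * fst ?s rQ" using I by (simp add: mult.commute)
  then show "fst ?s rRem = r mod B" "fst ?s rQ = r div B" using less by simp_all
qed

lemma sem_c_dec:
  assumes s: "ctx s" and c: "fst s rC < N" and "clean s"
  shows "snd (sem c_dec s) aX = dec (fst s rC)"
proof -
  let ?c = "fst s rC"
  define s1 where "s1 = setr rRem ?c s"
  let ?I = "\<lambda>j s'. fst s' rRem = ?c div B ^ j \<and> (\<forall>i<j. snd s' aX i = dec ?c i) \<and> clean s'"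
  have s1: "ctx s1" unfolding s1_def using s by (rule ctx_setr) simp
  have "?I D (sem (For rJ rD (Assign rQ (Num 0) ;; c_div ;;
     Update aX (Reg rJ) (Reg rRem) ;; Assign rRem (Reg rQ))) s1)"
  proof (rule For_bound[where I = ?I, OF ctxD(4)[OF s1]], goal_cases)
    case 1
    then show ?case using assms(3) by (simp add: s1_def clean_def)
  next
    case (2 j s')
    have "ctx s'" by (rule ctx_cong[OF s1]) (auto intro!: 2(3,4))
    let ?s2 = "setr rQ 0 (setr rJ j s')"
    have s2: "ctx ?s2" by (intro ctx_setr \<open>ctx s'\<close>) simp_all
    have "?c div B ^ j < N" using c by (meson div_le_dividend le_less_trans)
    then have d: "fst (sem c_div ?s2) rRem = ?c div B ^ j mod B" "fst (sem c_div ?s2) rQ = ?c div B ^ j div B"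
      using sem_c_div[OF s2, of "?c div B ^ j"] 2(2) by simp_all
    have fr: "snd (sem c_div ?s2) = snd s'" "fst (sem c_div ?s2) rJ = j"
      by (auto simp: frame_arr frame_reg fun_eq_iff)
    have "?c div B ^ Suc j = ?c div B ^ j div B"
      by (metis div_mult2_eq power_Suc2)
    then show ?case using 2(1,2) d fr by (auto simp: less_Suc_eq clean_def dec_def)
  qed
  then show ?thesis by (auto simp: c_dec_def s1_def fun_eq_iff clean_def dec_def not_less)
qed

lemma sem_c_enc:
  assumes s: "ctx s"
  shows "fst (sem c_enc s) rEnc = enc (snd s aX)"
proof -
  define X where "X = snd s aX"
  define s1 where "s1 = setr rEnc 0 s"
  have s1: "ctx s1" unfolding s1_def using s by (rule ctx_setr) simp
  \<comment> \<open>After \<open>j\<close> rounds the \<open>j\<close> highest digits are encoded;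
    the next round shifts them and adds digit \<open>D - 1 - j\<close>.\<close>
  let ?I = "\<lambda>j s'. fst s' rEnc = radix_sum B j (\<lambda>t. X (D - j + t))"
  have "?I D (sem (For rJ2 rD (Assign rAcc (Num 0) ;;
     For rI2 rB (Assign rAcc (Add (Reg rAcc) (Reg rEnc))) ;;
     Assign rEnc (Add (Reg rAcc) (Cell aX (Sub (Sub (Reg rD) (Num 1)) (Reg rJ2)))))) s1)"
  proof (rule For_bound[where I = ?I, OF ctxD(4)[OF s1]], goal_cases)
    case 1
    then show ?case by (simp add: s1_def)
  next
    case (2 j s')
    let ?s2 = "setr rAcc 0 (setr rJ2 j s')"
    let ?s3 = "sem (For rI2 rB (Assign rAcc (Add (Reg rAcc) (Reg rEnc)))) ?s2"
    have "fst ?s3 rAcc = fst ?s2 rAcc + fst ?s2 rB * fst ?s2 rEnc"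
      by (rule sem_add_loop) simp_all
    moreover have "fst s' rB = B" using 2(3)[of rB] ctxD(3)[OF s1] by simp
    ultimately have acc: "fst ?s3 rAcc = B * radix_sum B j (\<lambda>t. X (D - j + t))" using 2(2) by simp
    have "snd ?s3 aX = snd ?s2 aX" by (rule frame_arr) simp
    moreover have "snd s' aX = X" using 2(4)[of aX] by (simp add: s1_def X_def)
    ultimately have X: "snd ?s3 aX = X" by simp
    have J: "fst ?s3 rJ2 = j" by (subst frame_reg) simp_all
    have "fst ?s3 rD = fst s' rD" by (subst frame_reg) simp_all
    then have D: "fst ?s3 rD = D" using 2(3)[of rD] ctxD(4)[OF s1] by simp
    have idx: "D - Suc j + Suc t = D - j + t" for t using 2(1) by simp
    have "radix_sum B (Suc j) (\<lambda>t. X (D - Suc j + t)) =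
        X (D - 1 - j) + B * radix_sum B j (\<lambda>t. X (D - j + t))"
      unfolding radix_sum_Suc idx by simp
    then show ?case using acc X J D by (simp del: sem.simps(6))
  qed
  then show ?thesis by (simp add: c_enc_def s1_def enc_def X_def)
qed

definition relax :: "nat \<Rightarrow> nat \<Rightarrow> (nat \<Rightarrow> nat) \<Rightarrow> nat \<Rightarrow> nat" where
  "relax c w T = T(c := max (T c) w)"

lemma sem_c_relax:
  assumes "ctx s"
  shows "snd (sem c_relax s) aT' = relax (enc (snd s aX)) (fst s rVal) (snd s aT')"
  using sem_c_enc[OF assms] by (auto simp: c_relax_def relax_def frame_arr frame_reg fun_eq_iff max_def)

text \<open>An account of relaxing with all moves from a state of value \<open>t\<close> that does
  not mention their order or the maximum: entries never drop, and they change only to values offered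
  by a move.\<close>

definition performs :: "nat \<Rightarrow> ((nat \<Rightarrow> nat) \<times> nat) set \<Rightarrow> (nat \<Rightarrow> nat) \<Rightarrow> (nat \<Rightarrow> nat) \<Rightarrow> bool" where
  "performs t M T T' \<longleftrightarrow>
     (\<forall>c. T' c = T c \<or> (\<exists>(X, g)\<in>M. c = enc X \<and> T' c = t + g)) \<and>
     (\<forall>c. T c \<le> T' c) \<and> (\<forall>(X, g)\<in>M. t + g \<le> T' (enc X))"

lemma performs_empty: "performs t {} T T"
  by (simp add: performs_def)

lemma performs_insert:
  assumes "performs t M T T'"
  shows "performs t (insert (X, g) M) T (relax (enc X) (t + g) T')"
  unfolding performs_def
proof (intro conjI allI)
  fix c
  show "relax (enc X) (t + g) T' c = T c \<or>
      (\<exists>(X', g')\<in>insert (X, g) M. c = enc X' \<and> relax (enc X) (t + g) T' c = t + g')"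
    using assms unfolding performs_def relax_def by (auto simp: max_def)
  show "T c \<le> relax (enc X) (t + g) T' c"
    using assms unfolding performs_def relax_def by (auto simp: max_def intro: order_trans le_trans)
  have "T' c \<le> relax (enc X) (t + g) T' c" for c by (simp add: relax_def)
  then show "\<forall>(X', g')\<in>insert (X, g) M. t + g' \<le> relax (enc X) (t + g) T' (enc X')"
    using assms unfolding performs_def by (fastforce simp: relax_def intro: order_trans)
qed

text \<open>The state is arbitrary, not just a reachable one; by \<open>sv_less\<close> every digit
  from 3 on names a vertex, so adjacency is looked up within its range. Neighbouring cells outside
  the path are masked by the position tests.\<close>

lemma holds_compat_expr:
  assumes s: "ctx s" and v: "fst s rV = v" "v < n" and j: "fst s rJ = j" "j < D"
    and X: "snd s aX = X" "digits X"
  shows "holds compat_expr s \<longleftrightarrow> X j = 0 \<and> compat v j X"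
proof -
  have adj: "snd s aAdj (snd s aRow v + snd s aSv (X i)) \<noteq> 0 \<longleftrightarrow> adj v (sv (X i))" if "3 \<le> X i" for i
  proof -
    have XB: "X i < B" using X(2) by (simp add: digits_def)
    then have "sv (X i) < n" using sv_less[of "X i"] that by (simp add: B_def)
    then show ?thesis using ctxD(6)[OF s] ctxD(9)[OF s that XB] v(2) unfolding adjacency_def by simp
  qed
  show ?thesis
    unfolding compat_expr_def compat_def endp_def pos_expr_def digit_expr_def prev_expr_def next_expr_def endp_expr_def
    using adj[of "j - 1"] adj[of "Suc j"] ctxD(2)[OF s] ctxD(7)[OF s v(2)] ctxD(10)[OF s j(2)]
    by (auto simp: v(1) j(1) X(1))
qed

lemma sem_c_vertex:
  assumes s: "ctx s" and v: "fst s rV = v" "v < n"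
    and X: "snd s aX = X" "digits X"
  shows "performs (snd s aT (fst s rC)) (vertex_moves v X) (snd s aT') (snd (sem c_vertex s) aT')"
    and "snd (sem c_vertex s) aX = X"
proof -
  let ?t = "snd s aT (fst s rC)"
  define s1 where "s1 = sem c_relax (setr rVal ?t s)"
  \<comment> \<open>The moves into slots below \<open>j\<close>, together with leaving
    \<open>v\<close> free.\<close>
  let ?M = "\<lambda>j. insert (X, 0) ((\<lambda>j. (X(j := code v), 1 - pos j)) ` {i. i < j \<and> X i = 0 \<and> compat v i X})"
  let ?I = "\<lambda>j s'. performs ?t (?M j) (snd s aT') (snd s' aT') \<and> snd s' aX = X"
  have sv: "ctx (setr rVal ?t s)" using s by (rule ctx_setr) simp
  have s1: "ctx s1" "snd s1 aX = X" "fst s1 rV = v" "snd s1 aT = snd s aT" "fst s1 rC = fst s rC"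
    using X(1) v(1) unfolding s1_def by (auto intro!: ctx_sem sv simp: frame_arr frame_reg)
  have "?I D (sem c_vertex s)"
    unfolding c_vertex_def
  proof -
    let ?c = "If compat_expr (Update aX (Reg rJ) (Cell aCode (Reg rV)) ;;
      Assign rVal (Add (Cell aT (Reg rC)) (Sub (Num 1) pos_expr)) ;; c_relax ;;
      Update aX (Reg rJ) (Num 0)) SkipC"
    have "?I D (sem (For rJ rD ?c) s1)"
    proof (rule For_bound[where I = ?I, OF ctxD(4)[OF s1(1)]], goal_cases)
      case 1
      have "snd s1 aT' = relax (enc X) (?t + 0) (snd s aT')"
        unfolding s1_def sem_c_relax[OF sv] using X(1) by simp
      then show ?case using s1(2) performs_insert[OF performs_empty, of ?t X 0 "snd s aT'"] by simp
    next
      case (2 j s')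
      have s': "ctx s'" by (rule ctx_cong[OF s1(1)]) (auto intro!: 2(3,4))
      let ?s2 = "setr rJ j s'"
      have s2: "ctx ?s2" using s' by (rule ctx_setr) simp
      have r: "fst ?s2 rV = v" "fst ?s2 rJ = j" "fst ?s2 rC = fst s rC" "snd ?s2 aT = snd s aT" "snd ?s2 aX = X"
        using 2(2) 2(3)[of rV] 2(3)[of rC] 2(4)[of aT] s1 by simp_all
      have hold: "holds compat_expr ?s2 \<longleftrightarrow> X j = 0 \<and> compat v j X"
        by (rule holds_compat_expr[OF s2 r(1) v(2) r(2) 2(1) r(5) X(2)])
      show ?case
      proof (cases "X j = 0 \<and> compat v j X")
        case True
        let ?g = "1 - pos j"
        let ?s3 = "setr rVal (?t + ?g) (seta aX j (code v) ?s2)"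
        let ?s4 = "sem c_relax ?s3"
        have s3: "ctx ?s3" by (intro ctx_setr ctx_seta s') simp_all
        have "eval pos_expr (seta aX j (code v) ?s2) = pos j"
          using ctxD(10)[OF s2 2(1)] by (simp add: pos_expr_def)
        moreover have "snd ?s2 aCode v = code v" using ctxD(8)[OF s2 v(2)] .
        ultimately have step: "sem ?c ?s2 = seta aX j 0 ?s4"
          using hold True r by (simp add: frame_reg)
        have "snd ?s4 aT' = relax (enc (X(j := code v))) (?t + ?g) (snd s' aT')"
          unfolding sem_c_relax[OF s3] using r(5) by simp
        then have "performs ?t (insert (X(j := code v), ?g) (?M j)) (snd s aT') (snd ?s4 aT')"
          using performs_insert[of ?t "?M j" "snd s aT'" "snd s' aT'"] 2(2) by simp
        moreover have "?M (Suc j) = insert (X(j := code v), ?g) (?M j)"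
          using True by (auto simp: less_Suc_eq)
        moreover have "snd ?s4 aX = X(j := code v)" using r(5) by (simp add: frame_arr)
        ultimately show ?thesis unfolding step using True by (simp add: fun_upd_idem_iff)
      next
        case False
        then have "?M (Suc j) = ?M j" by (auto simp: less_Suc_eq)
        moreover have "sem ?c ?s2 = ?s2" using hold False by simp
        ultimately show ?thesis using 2(2) by simp
      qed
    qed
    then show "?I D (sem (Assign rVal (Cell aT (Reg rC)) ;; c_relax ;; For rJ rD ?c) s)"
      by (simp add: s1_def)
  qed
  then show "performs ?t (vertex_moves v X) (snd s aT') (snd (sem c_vertex s) aT')"
    "snd (sem c_vertex s) aX = X"
    unfolding vertex_moves_def by simp_all
qed

end

lemma card_less_Suc:
  "card {i. i < Suc j \<and> R i} = card {i. i < j \<and> R i} + (if R j then 1 else 0)"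
proof -
  have "{i. i < Suc j \<and> R i} = (if R j then insert j {i. i < j \<and> R i} else {i. i < j \<and> R i})"
    by (auto simp: less_Suc_eq)
  then show ?thesis by simp
qed

context path_dp begin

text \<open>One truncated decrement per occupied slot agrees with a single truncated subtraction of
  their number, even after 0 is reached.\<close>

lemma sem_c_check:
  assumes s: "ctx s" and X: "snd s aX = X" and Ok: "fst s rOk \<noteq> 0"
  shows "fst (sem c_check s) rXa = fst s rXa - card {j. j < D \<and> X j = 2 \<and> endp j}"
    and "fst (sem c_check s) rXb = fst s rXb - card {j. j < D \<and> X j = 2 \<and> \<not> endp j}"
    and "fst (sem c_check s) rOk \<noteq> 0 \<longleftrightarrow> closed X"
proof -
  let ?closed = "\<lambda>i. X i = 2 \<longrightarrow> (0 < pos i \<longrightarrow> 2 \<le> X (i - 1)) \<and> (pos i < l \<longrightarrow> 2 \<le> X (Suc i))"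
  let ?I = "\<lambda>j s'. fst s' rXa = fst s rXa - card {i. i < j \<and> X i = 2 \<and> endp i} \<and>
    fst s' rXb = fst s rXb - card {i. i < j \<and> X i = 2 \<and> \<not> endp i} \<and>
    (fst s' rOk \<noteq> 0 \<longleftrightarrow> (\<forall>i<j. ?closed i))"
  have "?I D (sem c_check s)"
    unfolding c_check_def
  proof (rule For_bound[where I = ?I, OF ctxD(4)[OF s]], goal_cases)
    case 1
    then show ?case using Ok by simp
  next
    case (2 j s')
    let ?s2 = "setr rJ j s'"
    have s2: "ctx ?s2" by (intro ctx_setr ctx_cong[OF s]) (auto intro!: 2(3,4))
    have r: "fst ?s2 rJ = j" "snd ?s2 aX = X" using 2(4)[of aX] X by simp_all
    have p: "eval pos_expr (setr x i ?s2) = pos j" if "x \<noteq> rJ" for x i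
      using ctxD(10)[OF s2 2(1)] that by (simp add: pos_expr_def)
    have e: "holds endp_expr ?s2 \<longleftrightarrow> endp j"
      using ctxD(2)[OF s2] ctxD(10)[OF s2 2(1)] by (simp add: endp_expr_def pos_expr_def endp_def)
    have o: "holds open_expr (setr x i ?s2) \<longleftrightarrow>
        (0 < pos j \<and> X (j - 1) < 2) \<or> (pos j < l \<and> X (Suc j) < 2)" if "x \<notin> {0, 2, rB, rD, rN, rJ}" for x i
      using p[of x i] ctxD(2)[OF ctx_setr[OF s2, of x i]] that r
      by (simp add: open_expr_def prev_expr_def next_expr_def)
    have d: "holds (Eq_expr digit_expr (Num 2)) ?s2 \<longleftrightarrow> X j = 2" using r by (simp add: digit_expr_def)
    have all: "(\<forall>i<Suc j. ?closed i) \<longleftrightarrow> (\<forall>i<j. ?closed i) \<and> ?closed j" by (auto simp: less_Suc_eq)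
    show ?case
    proof (cases "X j = 2")
      case True
      then show ?thesis unfolding all card_less_Suc using 2(2) d e o by (auto simp: not_less)
    next
      case False
      then show ?thesis unfolding all card_less_Suc using 2(2) d by simp
    qed
  qed
  then show "fst (sem c_check s) rXa = fst s rXa - card {j. j < D \<and> X j = 2 \<and> endp j}"
    and "fst (sem c_check s) rXb = fst s rXb - card {j. j < D \<and> X j = 2 \<and> \<not> endp j}"
    and "fst (sem c_check s) rOk \<noteq> 0 \<longleftrightarrow> closed X"
    unfolding closed_def by simp_all
qed

lemma sem_c_recolor:
  assumes s: "ctx s" and X: "snd s aX = X" "digits X"
  shows "snd (sem c_recolor s) aX = recolor X"
proof -
  let ?I = "\<lambda>j s'. snd s' aX = (\<lambda>i. if i < j then recolor X i else X i)"
  have "?I D (sem c_recolor s)"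
    unfolding c_recolor_def
  proof (rule For_bound[where I = ?I, OF ctxD(4)[OF s]], goal_cases)
    case 1
    then show ?case using X by simp
  next
    case (2 j s')
    then show ?case by (auto simp: digit_expr_def recolor_def fun_eq_iff less_Suc_eq)
  qed
  then show ?thesis using X(2) by (auto simp: fun_eq_iff recolor_def digits_def not_less)
qed

lemma sem_c_yield:
  assumes s: "ctx s"
  shows "fst (sem c_yield s) rVal = fst s rVal + clique_yield n (fst s rXa) (fst s rXb)"
proof -
  \<comment> \<open>The gain so far plus the greedy yield with the remaining fuel is constant; once
    the greedy condition fails, the yield is 0 for any fuel, in accordance with the idle
    rounds.\<close>
  let ?I = "\<lambda>i s'. fst s' rVal + clique_yield (n - i) (fst s' rXa) (fst s' rXb) =
    fst s rVal + clique_yield n (fst s rXa) (fst s rXb)"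
  have "?I n (sem c_yield s)"
    unfolding c_yield_def
  proof (rule For_bound[where I = ?I, OF ctxD(1)[OF s]], goal_cases)
    case (2 i s')
    have "n - i = Suc (n - Suc i)" using 2(1) by simp
    moreover have "fst s' 2 = l" using 2(3)[of 2] ctxD(2)[OF s] by simp
    moreover have "clique_yield m a b = 0" if "\<not> (2 \<le> a \<and> l - 1 \<le> b)" for m a b
      using that by (cases m) auto
    ultimately show ?case using 2(2) by auto
  qed simp
  then show ?thesis by simp
qed

lemma sem_c_clique:
  assumes s: "ctx s" and X: "snd s aX = X" "digits X"
  shows "performs (snd s aT (fst s rC)) (clique_moves (fst s rAlpha) (fst s rBeta) X)
      (snd s aT') (snd (sem c_clique s) aT')"
    and "snd (sem c_clique s) aX = recolor X"
proof -
  let ?t = "snd s aT (fst s rC)"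
  define s1 where "s1 = setr rXb (fst s rBeta) (setr rXa (fst s rAlpha) (setr rOk 1 s))"
  define s2 where "s2 = sem c_check s1"
  define s3 where "s3 = sem c_recolor s2"
  define s4 where "s4 = setr rVal (snd s3 aT (fst s3 rC)) s3"
  define s5 where "s5 = sem c_yield s4"
  have s1: "ctx s1" unfolding s1_def by (intro ctx_setr s) simp_all
  have s2: "ctx s2" unfolding s2_def by (intro ctx_sem s1) simp_all
  have s3: "ctx s3" unfolding s3_def by (intro ctx_sem s2) simp_all
  have s4: "ctx s4" unfolding s4_def by (intro ctx_setr s3) simp_all
  have s5: "ctx s5" unfolding s5_def by (intro ctx_sem s4) simp_all
  have X1: "snd s1 aX = X" "fst s1 rOk \<noteq> 0" using X by (simp_all add: s1_def)
  note check = sem_c_check[OF s1 X1, folded s2_def]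
  have X2: "snd s2 aX = X" using X1 by (simp add: s2_def frame_arr)
  have X3: "snd s3 aX = recolor X" unfolding s3_def by (rule sem_c_recolor[OF s2 X2 X(2)])
  have X5: "snd s5 aX = recolor X" using X3 by (simp add: s5_def s4_def frame_arr)
  have v4: "fst s4 rVal = ?t" by (simp add: s4_def s3_def s2_def s1_def frame_arr frame_reg)
  have a4: "fst s4 rXa = fst s rAlpha - card {j. j < D \<and> X j = 2 \<and> endp j}"
      "fst s4 rXb = fst s rBeta - card {j. j < D \<and> X j = 2 \<and> \<not> endp j}"
    using check(1,2) by (simp_all add: s4_def s3_def frame_reg s1_def)
  have v5: "fst s5 rVal = ?t + clique_yield n (fst s4 rXa) (fst s4 rXb)"
    unfolding s5_def sem_c_yield[OF s4] v4 ..
  have ok: "fst s5 rOk \<noteq> 0 \<longleftrightarrow> closed X"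
    using check(3) by (simp add: s5_def s4_def s3_def frame_reg)
  have T5: "snd s5 aT' = snd s aT'" by (simp add: s5_def s4_def s3_def s2_def s1_def frame_arr)
  have res: "sem c_clique s = (if closed X then sem c_relax s5 else s5)"
    using ok by (simp add: c_clique_def s5_def s4_def s3_def s2_def s1_def)
  show "snd (sem c_clique s) aX = recolor X" unfolding res using X5 by (simp add: frame_arr)
  show "performs ?t (clique_moves (fst s rAlpha) (fst s rBeta) X) (snd s aT') (snd (sem c_clique s) aT')"
  proof (cases "closed X")
    case True
    have "snd (sem c_relax s5) aT' = relax (enc (recolor X)) (?t + clique_yield n (fst s4 rXa) (fst s4 rXb)) (snd s aT')"
      unfolding sem_c_relax[OF s5] X5 v5 T5 ..
    then show ?thesis
      unfolding res clique_moves_def using True a4 performs_insert[OF performs_empty] by simp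
  next
    case False
    then show ?thesis unfolding res clique_moves_def using T5 performs_empty by simp
  qed
qed

text \<open>Lifts a body that performs all moves from one decoded state to a step of the table. The
  invariant of the main loop is \<open>table_step\<close> restricted to the states already
  expanded.\<close>

lemma sem_c_step:
  assumes s: "ctx s" "clean s"
    and body: "{0, 2, rB, rD, rN, rC} \<inter> rmods body = {}" "amods body \<subseteq> {aX, aT'}"
    and digits: "\<And>X X' g. digits X \<Longrightarrow> (X', g) \<in> \<Gamma> X \<Longrightarrow> digits X'"
    and spec: "\<And>s'. ctx s' \<Longrightarrow> snd s' aT = snd s aT \<Longrightarrow> fst s' rC < N \<Longrightarrow>
      snd s' aX = dec (fst s' rC) \<Longrightarrow>
      (\<And>x. x \<notin> {rC, rRem, rJ, rQ, rI2} \<union> rmods body \<Longrightarrow> fst s' x = fst s x) \<Longrightarrow>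
      performs (snd s aT (fst s' rC)) (\<Gamma> (dec (fst s' rC))) (snd s' aT') (snd (sem body s') aT') \<and>
      clean (sem body s')"
  shows "table_step \<Gamma> (snd s aT) (snd (sem (c_step body) s) aT)" "clean (sem (c_step body) s)"
proof -
  let ?T = "snd s aT"
  define s1 where "s1 = sem (For rC rN (Update aT' (Reg rC) (Num 0))) s"
  let ?loop = "For rC rN (If (Cell aT (Reg rC)) (c_dec ;; body) SkipC)"
  define s2 where "s2 = sem ?loop s1"
  define s3 where "s3 = sem (For rC rN (Update aT (Reg rC) (Cell aT' (Reg rC)))) s2"
  have res: "sem (c_step body) s = s3" by (simp add: c_step_def s3_def s2_def s1_def)
  have body': "aT \<notin> amods body" using body(2) by auto
  have s1: "ctx s1" unfolding s1_def by (intro ctx_sem s) auto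
  have s2: "ctx s2" unfolding s2_def using body by (intro ctx_sem s1) auto
  have zero: "\<forall>c<N. snd s1 aT' c = 0"
    unfolding s1_def
    by (rule For_bound[where I = "\<lambda>i s'. \<forall>c<i. snd s' aT' c = 0", OF ctxD(5)[OF s(1)]])
      (auto simp: less_Suc_eq)
  have T1: "snd s1 aT = ?T" unfolding s1_def by (rule frame_arr) simp
  have clean1: "clean s1"
    using s(2) unfolding clean_def s1_def by (subst frame_arr) simp_all
  have reg1: "fst s1 x = fst s x" if "x \<noteq> rC" for x
    unfolding s1_def by (rule frame_reg) (use that in simp)
  let ?I = "\<lambda>i s'. clean s' \<and>
     (\<forall>c'<N. snd s' aT' c' \<noteq> 0 \<longrightarrow>
        (\<exists>c<i. ?T c \<noteq> 0 \<and> (\<exists>(X, g)\<in>\<Gamma> (dec c). c' = enc X \<and> snd s' aT' c' = ?T c + g))) \<and>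
     (\<forall>c<i. ?T c \<noteq> 0 \<longrightarrow> (\<forall>(X, g)\<in>\<Gamma> (dec c). ?T c + g \<le> snd s' aT' (enc X)))"
  have I2: "?I N s2"
    unfolding s2_def
  proof (rule For_bound[where I = ?I, OF ctxD(5)[OF s1]], goal_cases)
    case 1
    then show ?case using clean1 zero by simp
  next
    case (2 i s')
    let ?t = "setr rC i s'"
    have t: "ctx ?t" using body by (intro ctx_setr ctx_cong[OF s1]) (auto intro!: 2(3,4))
    have T: "snd ?t aT = ?T" using 2(4)[of aT] T1 body' by simp
    have old: "\<forall>c'<N. snd s' aT' c' \<noteq> 0 \<longrightarrow>
      (\<exists>c<i. ?T c \<noteq> 0 \<and> (\<exists>(X, g)\<in>\<Gamma> (dec c). c' = enc X \<and> snd s' aT' c' = ?T c + g))"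
      and old2: "\<forall>c<i. ?T c \<noteq> 0 \<longrightarrow> (\<forall>(X, g)\<in>\<Gamma> (dec c). ?T c + g \<le> snd s' aT' (enc X))"
      using 2(2) by simp_all
    have less: "\<exists>c<Suc i. ?T c \<noteq> 0 \<and> (\<exists>(X, g)\<in>\<Gamma> (dec c). c' = enc X \<and> snd s' aT' c' = ?T c + g)"
      if c': "c' < N" "snd s' aT' c' \<noteq> 0" for c'
    proof -
      from old c' obtain c where c: "c < i"
        "?T c \<noteq> 0 \<and> (\<exists>(X, g)\<in>\<Gamma> (dec c). c' = enc X \<and> snd s' aT' c' = ?T c + g)" by blast
      from c(1) have "c < Suc i" by simp
      with c(2) show ?thesis by (intro exI[of _ c] conjI) simp_all
    qed
    show ?case
    proof (cases "?T i = 0")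
      case True
      have "\<forall>c<Suc i. ?T c \<noteq> 0 \<longrightarrow> (\<forall>(X, g)\<in>\<Gamma> (dec c). ?T c + g \<le> snd s' aT' (enc X))"
        using old2 True less_Suc_eq by (metis (lifting))
      moreover from True have "sem (If (Cell aT (Reg rC)) (c_dec ;; body) SkipC) ?t = ?t" using T by simp
      moreover have "clean ?t" using 2(2) by (simp add: clean_def)
      ultimately show ?thesis using less by simp
    next
      case False
      define d where "d = sem c_dec ?t"
      have run: "sem (If (Cell aT (Reg rC)) (c_dec ;; body) SkipC) ?t = sem body d"
        using T False by (simp add: d_def)
      have "clean ?t" using 2(2) by (simp add: clean_def)
      then have dX: "snd d aX = dec i" unfolding d_def using sem_c_dec[OF t] 2(1) by simp
      have d: "ctx d" unfolding d_def by (intro ctx_sem t) simp_all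
      have dT: "snd d aT = ?T" "snd d aT' = snd s' aT'" "fst d rC = i"
        using T by (simp_all add: d_def frame_arr frame_reg)
      have "fst d x = fst s x" if "x \<notin> {rC, rRem, rJ, rQ, rI2} \<union> rmods body" for x
        using that 2(3)[of x] reg1[of x] by (simp add: d_def frame_reg)
      from spec[OF d dT(1) _ _ this] dT dX 2(1)
      have perf: "performs (?T i) (\<Gamma> (dec i)) (snd s' aT') (snd (sem body d) aT')" and cl: "clean (sem body d)"
        by simp_all
      let ?T' = "snd (sem body d) aT'"
      have new: "\<exists>c<Suc i. ?T c \<noteq> 0 \<and> (\<exists>(X, g)\<in>\<Gamma> (dec c). c' = enc X \<and> ?T' c' = ?T c + g)"
        if c': "c' < N" "?T' c' \<noteq> 0" for c'
      proof (cases "?T' c' = snd s' aT' c'")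
        case True
        show ?thesis unfolding True using less[OF c'(1)] c'(2) True by simp
      next
        case ne: False
        then have "\<exists>(X, g)\<in>\<Gamma> (dec i). c' = enc X \<and> ?T' c' = ?T i + g"
          using perf unfolding performs_def by metis
        then show ?thesis using False by blast
      qed
      have new2: "\<forall>(X, g)\<in>\<Gamma> (dec c). ?T c + g \<le> ?T' (enc X)" if c: "c < Suc i" "?T c \<noteq> 0" for c
      proof (cases "c = i")
        case True
        then show ?thesis using perf unfolding performs_def by simp
      next
        case False
        then have "c < i" using c by simp
        show ?thesis
        proof (rule ballI, clarify)
          fix X g assume "(X, g) \<in> \<Gamma> (dec c)"
          then have "?T c + g \<le> snd s' aT' (enc X)" using old2 \<open>c < i\<close> c(2) by fastforce
          also have "\<dots> \<le> ?T' (enc X)" using perf unfolding performs_def by simp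
          finally show "?T c + g \<le> ?T' (enc X)" .
        qed
      qed
      show ?thesis unfolding run using cl new new2 by simp
    qed
  qed
  have "\<forall>c<N. snd s3 aT c = snd s2 aT' c"
    unfolding s3_def
  proof (rule For_bound[where I = "\<lambda>i s'. \<forall>c<i. snd s' aT c = snd s2 aT' c", OF ctxD(5)[OF s2]], goal_cases)
    case (2 i s')
    have "snd s' aT' = snd s2 aT'" using 2(4)[of aT'] by simp
    then show ?case using 2(2) by (simp add: less_Suc_eq)
  qed simp
  then have eq: "snd s3 aT c = snd s2 aT' c" if "c < N" for c using that by simp
  show "clean (sem (c_step body) s)"
    using I2 unfolding res clean_def s3_def by (subst frame_arr) simp_all
  show "table_step \<Gamma> ?T (snd (sem (c_step body) s) aT)"
    unfolding table_step_def res
  proof (intro conjI allI impI)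
    fix c' assume "c' < N" "snd s3 aT c' \<noteq> 0"
    then show "\<exists>c<N. ?T c \<noteq> 0 \<and> (\<exists>(X, g)\<in>\<Gamma> (dec c). c' = enc X \<and> snd s3 aT c' = ?T c + g)"
      using I2 eq by simp
  next
    fix c assume c: "c < N" "?T c \<noteq> 0"
    show "\<forall>(X, g)\<in>\<Gamma> (dec c). ?T c + g \<le> snd s3 aT (enc X)"
    proof (rule ballI, clarify)
      fix X g assume g: "(X, g) \<in> \<Gamma> (dec c)"
      then have le: "?T c + g \<le> snd s2 aT' (enc X)" using I2 c by fastforce
      have "enc X < N \<Longrightarrow> ?T c + g \<le> snd s3 aT (enc X)" using le eq by simp
      \<comment> \<open>Only entries below \<open>N\<close> are copied back; the successor has such
        a code because moves preserve \<open>digits\<close>.\<close>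
      moreover have "enc X < N" by (rule enc_less, rule digits[OF digits_dec g])
      ultimately show "?T c + g \<le> snd s3 aT (enc X)" by simp
    qed
  qed
qed

text \<open>Soundness and completeness as one invariant of the table. Completeness is asserted for
  all packings, since the table does not depend on the packing it is finally compared with.\<close>

definition tracks :: "nat set \<Rightarrow> nat set \<Rightarrow> (nat \<Rightarrow> nat) \<Rightarrow> bool" where
  "tracks U C T \<longleftrightarrow> sound U C T \<and>
     (\<forall>P. packed_instance n l E A S code sv P \<longrightarrow> packed_instance.complete l S code P U C T)"

lemma tracks_initial: "tracks {} {} ((\<lambda>_. 0)(0 := 1))"
  unfolding tracks_def using sound_initial packed_instance.complete_initial by blast

lemma tracks_vertex:
  assumes tr: "tracks U C T" and step: "table_step (vertex_moves v) T T'"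
    and v: "v < n" "v \<notin> U \<union> C" and sub: "U \<union> C \<subseteq> {..<n}"
    and UC': "v \<in> S \<and> U' = insert v U \<and> C' = C \<and> U \<union> C \<subseteq> S \<or> v \<notin> S \<and> U' = U \<and> C' = insert v C"
  shows "tracks U' C' T'"
  unfolding tracks_def
proof (intro conjI allI impI)
  show "sound U' C' T'"
  proof (rule sound_step[OF _ step])
    show "sound U C T" using tr by (simp add: tracks_def)
    fix X p X' g assume *: "digits X" "good U C X p" "(X', g) \<in> vertex_moves v X"
    have "digits X'" by (rule digits_vertex_moves[OF *(1,3) v(1)])
    moreover have "good U' C' X' (p + g)"
      by (rule good_vertex[OF *(2,3) v]) (use UC' sub v(1) in auto)
    ultimately show "digits X' \<and> good U' C' X' (p + g)" by blast
  qed
next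
  fix P assume "packed_instance n l E A S code sv P"
  then interpret packed_instance n l E A S code sv P .
  obtain g where g: "(config U' C', g) \<in> vertex_moves v (config U C)" "gained U' C' \<le> gained U C + g"
    using config_vertex_move[OF v, of U' C'] UC' by blast
  have "complete U C T" using tr packed_instance_axioms unfolding tracks_def by blast
  then show "complete U' C' T'" by (rule complete_step[where \<Gamma> = "vertex_moves v"]) (fact step g)+
qed

lemma tracks_clique:
  assumes tr: "tracks U C T"
    and step: "table_step (clique_moves (card (C \<inter> A)) (card (C - A))) T T'"
    and C: "C \<inter> U = {}" "C \<inter> S = {}" "C \<subseteq> {..<n}" and U: "S \<subseteq> U"
    and clique: "\<And>u v. u \<in> C \<Longrightarrow> v \<in> C \<Longrightarrow> u \<noteq> v \<Longrightarrow> adj u v"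
    and nbr: "\<And>u w. u \<in> C \<Longrightarrow> adj u w \<Longrightarrow> w \<notin> S \<Longrightarrow> w \<in> C"
  shows "tracks (U \<union> C) {} T'"
  unfolding tracks_def
proof (intro conjI allI impI)
  show "sound (U \<union> C) {} T'"
  proof (rule sound_step[OF _ step])
    show "sound U C T" using tr by (simp add: tracks_def)
    fix X p X' g
    assume *: "digits X" "good U C X p" "(X', g) \<in> clique_moves (card (C \<inter> A)) (card (C - A)) X"
    have "X' = recolor X" using *(3) by (simp add: clique_moves_def split: if_splits)
    then have "digits X'" using digits_recolor[OF *(1)] by simp
    moreover have "good (U \<union> C) {} X' (p + g)" by (rule good_clique[OF *(2,3) C(1,2) clique])
    ultimately show "digits X' \<and> good (U \<union> C) {} X' (p + g)" by blast
  qed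
next
  fix P assume "packed_instance n l E A S code sv P"
  then interpret packed_instance n l E A S code sv P .
  have "\<exists>g. (config (U \<union> C) {}, g) \<in> clique_moves (card (C \<inter> A)) (card (C - A)) (config U C) \<and>
      gained (U \<union> C) {} \<le> gained U C + g"
    by (rule config_clique_move[OF C U]) (rule nbr)
  then obtain g where g: "(config (U \<union> C) {}, g) \<in> clique_moves (card (C \<inter> A)) (card (C - A)) (config U C)"
    "gained (U \<union> C) {} \<le> gained U C + g"
    by blast
  have "complete U C T" using tr packed_instance_axioms unfolding tracks_def by blast
  then show "complete (U \<union> C) {} T'"
    by (rule complete_step[where \<Gamma> = "clique_moves (card (C \<inter> A)) (card (C - A))"]) (fact step g)+
qed

text \<open>Soundness yields a packing with \<open>T c - 1\<close> paths, at least \<open>k\<close>,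
  which is truncated; completeness is applied to a packing of size exactly \<open>k\<close>.\<close>

lemma tracks_final:
  assumes tr: "tracks {..<n} {} T"
  shows "(\<exists>c<N. k < T c \<and> final (dec c)) \<longleftrightarrow> A_path_packing {..<n} E A k l"
proof
  assume "\<exists>c<N. k < T c \<and> final (dec c)"
  then obtain c where c: "c < N" "k < T c" "final (dec c)" by blast
  moreover have "sound {..<n} {} T" using tr by (simp add: tracks_def)
  ultimately have "good {..<n} {} (dec c) (T c - 1)" by (simp add: sound_def)
  then have "A_path_packing {..<n} E A (T c - 1) l" by (rule good_final[OF _ c(3)])
  then show "A_path_packing {..<n} E A k l" by (rule A_path_packing_mono) (use c(2) in simp)
next
  assume "A_path_packing {..<n} E A k l"
  then obtain P where P: "length P = k" "\<forall>q\<in>set P. lpath q" "disjoint_lists P"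
    unfolding A_path_packing_iff by blast
  interpret packed_instance n l E A S code sv P
    by unfold_locales (use P in auto)
  have "complete {..<n} {} T" using tr packed_instance_axioms unfolding tracks_def by blast
  from complete_final[OF this] show "\<exists>c<N. k < T c \<and> final (dec c)" using P(1) by blast
qed

lemma clean_iff_digits: "digits (snd s aX) \<Longrightarrow> clean s"
  by (simp add: clean_def digits_def)

lemma sem_step_vertex:
  assumes s: "ctx s" "clean s" and v: "fst s rV = v" "v < n"
  shows "table_step (vertex_moves v) (snd s aT) (snd (sem (c_step c_vertex) s) aT)"
    and "clean (sem (c_step c_vertex) s)"
proof -
  have *: "performs (snd s aT (fst s' rC)) (vertex_moves v (dec (fst s' rC))) (snd s' aT')
        (snd (sem c_vertex s') aT') \<and> clean (sem c_vertex s')"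
    if s': "ctx s'" "snd s' aT = snd s aT" "snd s' aX = dec (fst s' rC)"
      and r: "\<And>x. x \<notin> {rC, rRem, rJ, rQ, rI2} \<union> rmods c_vertex \<Longrightarrow> fst s' x = fst s x" for s'
  proof -
    have "fst s' rV = v" using r[of rV] v(1) by simp
    note sv = sem_c_vertex[OF s'(1) this v(2) s'(3) digits_dec]
    show ?thesis using sv(1) sv(2) clean_iff_digits[of "sem c_vertex s'"] digits_dec s'(2) by simp
  qed
  show "table_step (vertex_moves v) (snd s aT) (snd (sem (c_step c_vertex) s) aT)"
    by (rule sem_c_step(1)[OF s]) (auto intro: digits_vertex_moves[OF _ _ v(2)] dest!: * )
  show "clean (sem (c_step c_vertex) s)"
    by (rule sem_c_step(2)[where \<Gamma> = "vertex_moves v", OF s])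
      (auto intro: digits_vertex_moves[OF _ _ v(2)] dest!: * )
qed

lemma digits_clique_moves: "digits X \<Longrightarrow> (X', g) \<in> clique_moves a b X \<Longrightarrow> digits X'"
  using digits_recolor by (auto simp: clique_moves_def split: if_splits)

lemma sem_step_clique:
  assumes s: "ctx s" "clean s"
  shows "table_step (clique_moves (fst s rAlpha) (fst s rBeta)) (snd s aT) (snd (sem (c_step c_clique) s) aT)"
    and "clean (sem (c_step c_clique) s)"
proof -
  have *: "performs (snd s aT (fst s' rC)) (clique_moves (fst s rAlpha) (fst s rBeta) (dec (fst s' rC)))
        (snd s' aT') (snd (sem c_clique s') aT') \<and> clean (sem c_clique s')"
    if s': "ctx s'" "snd s' aT = snd s aT" "snd s' aX = dec (fst s' rC)"
      and r: "\<And>x. x \<notin> {rC, rRem, rJ, rQ, rI2} \<union> rmods c_clique \<Longrightarrow> fst s' x = fst s x" for s'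
  proof -
    have ab: "fst s' rAlpha = fst s rAlpha" "fst s' rBeta = fst s rBeta" using r[of rAlpha] r[of rBeta] by simp_all
    note sv = sem_c_clique[OF s'(1) s'(3) digits_dec]
    show ?thesis using sv(1) sv(2) clean_iff_digits[of "sem c_clique s'"] digits_recolor digits_dec s'(2) ab
      by simp
  qed
  show "table_step (clique_moves (fst s rAlpha) (fst s rBeta)) (snd s aT) (snd (sem (c_step c_clique) s) aT)"
    by (rule sem_c_step(1)[OF s]) (auto intro: digits_clique_moves dest!: * )
  show "clean (sem (c_step c_clique) s)"
    by (rule sem_c_step(2)[where \<Gamma> = "clique_moves (fst s rAlpha) (fst s rBeta)", OF s])
      (auto intro: digits_clique_moves dest!: * )
qed

lemma ctx_step_vertex: "ctx s \<Longrightarrow> ctx (sem (c_step c_vertex) s)"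
  by (rule ctx_sem) auto

lemma ctx_step_clique: "ctx s \<Longrightarrow> ctx (sem (c_step c_clique) s)"
  by (rule ctx_sem) auto

lemma clean_upd [simp]: "clean (setr x i s) = clean s" "a \<noteq> aX \<Longrightarrow> clean (seta a i w s) = clean s"
  by (simp_all add: clean_def)

lemma marked_upd [simp]: "marked n (setr x i s) = marked n s"
    "a \<noteq> aDone \<Longrightarrow> marked n (seta a i w s) = marked n s"
    "i < n \<Longrightarrow> w \<noteq> 0 \<Longrightarrow> marked n (seta aDone i w s) = insert i (marked n s)"
  by (auto simp: marked_def)

lemma marked_cong: "snd s' aDone = snd s aDone \<Longrightarrow> marked n s' = marked n s"
  by (simp add: marked_def)

lemma sem_c_phase1:
  assumes s: "ctx s" "clean s" "marked n s = S" "snd s aT = (\<lambda>_. 0)"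
  defines "s' \<equiv> sem c_phase1 s"
  shows "ctx s'" "clean s'" "marked n s' = S" "tracks S {} (snd s' aT)"
proof -
  define s1 where "s1 = seta aT 0 1 s"
  let ?I = "\<lambda>i s'. ctx s' \<and> clean s' \<and> marked n s' = S \<and> tracks (S \<inter> {..<i}) {} (snd s' aT)"
  have c1: "ctx s1" unfolding s1_def by (rule ctx_seta[OF s(1)]) simp
  have "?I n (sem (For rV 0 (If (Cell aDone (Reg rV)) (c_step c_vertex) SkipC)) s1)"
  proof (rule For_bound[where I = ?I, OF ctxD(1)[OF c1]], goal_cases)
    case 1
    have "snd s1 aT = (\<lambda>_. 0)(0 := 1)" using s(4) by (simp add: s1_def)
    moreover have "clean s1" "marked n s1 = S" using s(2,3) by (simp_all add: s1_def)
    ultimately show ?case using c1 tracks_initial by simp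
  next
    case (2 v s')
    let ?t = "setr rV v s'"
    have I: "ctx s'" "clean s'" "marked n s' = S" "tracks (S \<inter> {..<v}) {} (snd s' aT)"
      using 2(2) by blast+
    have t: "ctx ?t" "clean ?t" "fst ?t rV = v" "marked n ?t = S"
      using ctx_setr[OF I(1)] I(2,3) by simp_all
    have "v \<in> marked n ?t \<longleftrightarrow> snd ?t aDone v \<noteq> 0" using 2(1) by (simp add: marked_def)
    then have hold: "holds (Cell aDone (Reg rV)) ?t \<longleftrightarrow> v \<in> S" unfolding t(4) by simp
    show ?case
    proof (cases "v \<in> S")
      case True
      let ?u = "sem (c_step c_vertex) ?t"
      note st = sem_step_vertex[OF t(1,2,3) 2(1)]
      have "S \<inter> {..<Suc v} = insert v (S \<inter> {..<v})" using True by auto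
      moreover have "tracks (S \<inter> {..<v}) {} (snd ?t aT)" using I(4) by simp
      then have "tracks (insert v (S \<inter> {..<v})) {} (snd ?u aT)"
        by (rule tracks_vertex[OF _ st(1) 2(1)]) (use True 2(1) in auto)
      moreover have "marked n ?u = S" unfolding t(4)[symmetric] by (rule marked_cong, rule frame_arr) simp
      moreover have "sem (If (Cell aDone (Reg rV)) (c_step c_vertex) SkipC) ?t = ?u"
        by (simp only: sem.simps hold True if_True)
      ultimately show ?thesis using ctx_step_vertex[OF t(1)] st(2) by simp
    next
      case False
      then have "S \<inter> {..<Suc v} = S \<inter> {..<v}" by (auto simp: less_Suc_eq)
      moreover have "sem (If (Cell aDone (Reg rV)) (c_step c_vertex) SkipC) ?t = ?t"
        by (simp only: sem.simps hold False if_False)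
      ultimately show ?thesis using t I(4) by simp
    qed
  qed
  moreover have "S \<inter> {..<n} = S" using S by blast
  moreover have "s' = sem (For rV 0 (If (Cell aDone (Reg rV)) (c_step c_vertex) SkipC)) s1"
    by (simp add: s'_def c_phase1_def s1_def)
  ultimately show "ctx s'" "clean s'" "marked n s' = S" "tracks S {} (snd s' aT)" by metis+
qed

text \<open>For \<open>r\<close> outside \<open>S\<close>, the component of \<open>r\<close> after
  deleting \<open>S\<close>: in a union of cliques it is a closed neighbourhood.\<close>

definition clique_of :: "nat \<Rightarrow> nat set" where
  "clique_of r = {v. v < n \<and> v \<notin> S \<and> (v = r \<or> adj r v)}"

lemma clique_of:
  assumes "r < n" "r \<notin> S"
  shows "u \<in> clique_of r \<Longrightarrow> v \<in> clique_of r \<Longrightarrow> u \<noteq> v \<Longrightarrow> adj u v"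
    and "u \<in> clique_of r \<Longrightarrow> adj u w \<Longrightarrow> w \<notin> S \<Longrightarrow> w \<in> clique_of r"
proof -
  show "adj u v" if "u \<in> clique_of r" "v \<in> clique_of r" "u \<noteq> v"
    using that assms cluster[of u r v] adj_sym[of r u] adj_sym[of r v] unfolding clique_of_def by auto
  assume u: "u \<in> clique_of r" "adj u w" "w \<notin> S"
  have "w < n" using graph u(2) unfolding simple_graph_def by auto
  moreover have "w = r \<or> adj r w"
    using u assms cluster[of r u w] unfolding clique_of_def by auto
  ultimately show "w \<in> clique_of r" using u(3) by (simp add: clique_of_def)
qed

lemma sem_c_collect:
  assumes s: "ctx s" "clean s" "marked n s = U" "tracks U {} (snd s aT)"
    and r: "fst s rR = r" "r < n" "r \<notin> U" and U: "S \<subseteq> U" "U \<inter> clique_of r = {}"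
    and ab: "fst s rAlpha = 0" "fst s rBeta = 0"
  defines "C \<equiv> clique_of r"
  defines "s' \<equiv> sem c_collect s"
  shows "ctx s'" "clean s'" "marked n s' = U \<union> C" "tracks U C (snd s' aT)"
    "fst s' rAlpha = card (C \<inter> A)" "fst s' rBeta = card (C - A)"
proof -
  let ?C = "\<lambda>i. C \<inter> {..<i}"
  let ?I = "\<lambda>i s'. ctx s' \<and> clean s' \<and> marked n s' = U \<union> ?C i \<and> tracks U (?C i) (snd s' aT) \<and>
    fst s' rAlpha = card (?C i \<inter> A) \<and> fst s' rBeta = card (?C i - A)"
  have Cn: "C \<subseteq> {..<n}" "C \<inter> S = {}" "C \<inter> U = {}" using U(2) by (auto simp: C_def clique_of_def)
  have Un: "U \<subseteq> {..<n}" using s(3) by (auto simp: marked_def)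
  have "?I n s'"
    unfolding s'_def c_collect_def
  proof (rule For_bound[where I = ?I, OF ctxD(1)[OF s(1)]], goal_cases)
    case 1
    then show ?case using s ab by simp
  next
    case (2 v s1)
    let ?t = "setr rV v s1"
    have I: "ctx s1" "clean s1" "marked n s1 = U \<union> ?C v" "tracks U (?C v) (snd s1 aT)"
        "fst s1 rAlpha = card (?C v \<inter> A)" "fst s1 rBeta = card (?C v - A)"
      using 2(2) by blast+
    have t: "ctx ?t" "clean ?t" "fst ?t rV = v" "marked n ?t = U \<union> ?C v" "fst ?t rR = r"
      using ctx_setr[OF I(1)] I(2,3) 2(3)[of rR] r(1) by simp_all
    have "(snd ?t aAdj (snd ?t aRow r + v) \<noteq> 0) \<longleftrightarrow> adj r v"
      using ctxD(6)[OF t(1)] r(2) 2(1) unfolding adjacency_def by blast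
    moreover have "v \<in> marked n ?t \<longleftrightarrow> snd ?t aDone v \<noteq> 0" using 2(1) by (simp add: marked_def)
    then have "snd ?t aDone v \<noteq> 0 \<longleftrightarrow> v \<in> U" unfolding t(4) by simp
    \<comment> \<open>The mark test also excludes \<open>S\<close>, which is part of
      \<open>U\<close>; the clique vertices marked during this loop are smaller than
      \<open>v\<close>.\<close>
    ultimately have hold: "holds (And_expr (Not_expr (Cell aDone (Reg rV)))
          (Or_expr (Eq_expr (Reg rV) (Reg rR)) (adj_expr (Reg rR) (Reg rV)))) ?t \<longleftrightarrow> v \<in> C"
      using t(3,5) 2(1) U Cn(3) by (auto simp: C_def clique_of_def)
    show ?case
    proof (cases "v \<in> C")
      case True
      define x where "x = (if v \<in> A then rAlpha else rBeta)"
      define u where "u = setr x (Suc (fst s1 x)) (seta aDone v 1 ?t)"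
      have x: "x = rAlpha \<or> x = rBeta" by (simp add: x_def)
      have u: "ctx u" "clean u" "fst u rV = v" "snd u aT = snd s1 aT"
        using t(1-3) x unfolding u_def by (auto intro!: ctx_setr ctx_seta)
      have "snd ?t aA v \<noteq> 0 \<longleftrightarrow> v \<in> A" by (rule ctxD(7)[OF t(1) 2(1)])
      then have run: "sem (Update aDone (Reg rV) (Num 1) ;;
         If (Cell aA (Reg rV)) (Assign rAlpha (Add (Reg rAlpha) (Num 1)))
           (Assign rBeta (Add (Reg rBeta) (Num 1))) ;; c_step c_vertex) ?t = sem (c_step c_vertex) u"
        by (simp add: u_def x_def)
      let ?u = "sem (c_step c_vertex) u"
      note st = sem_step_vertex[OF u(1-3) 2(1)]
      have C': "?C (Suc v) = insert v (?C v)" using True by auto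
      have "tracks U (?C v) (snd u aT)" using I(4) u(4) by simp
      then have tr: "tracks U (?C (Suc v)) (snd ?u aT)"
        unfolding C' by (rule tracks_vertex[OF _ st(1) 2(1)]) (use True Cn Un in auto)
      moreover have "marked n u = insert v (U \<union> ?C v)"
        using t(4) 2(1) by (simp add: u_def)
      moreover have "marked n ?u = marked n u" by (rule marked_cong, rule frame_arr) simp
      ultimately have "marked n ?u = U \<union> ?C (Suc v)" unfolding C' by simp
      moreover have "fst ?u rAlpha = fst u rAlpha" "fst ?u rBeta = fst u rBeta" by (simp_all add: frame_reg)
      moreover have "fst u rAlpha = card (?C (Suc v) \<inter> A)" "fst u rBeta = card (?C (Suc v) - A)"
        using I(5,6) unfolding C' by (simp_all add: u_def x_def Int_insert_left insert_Diff_if)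
      ultimately show ?thesis
        using ctx_step_vertex[OF u(1)] st(2) tr by (simp only: sem.simps(5) hold True if_True run simp_thms)
    next
      case False
      then have "?C (Suc v) = ?C v" by (auto simp: less_Suc_eq)
      then show ?thesis using t I
        by (simp only: sem.simps hold False if_False fst_setr snd_setr fun_upd_apply) simp
    qed
  qed
  moreover have "?C n = C" using Cn(1) by blast
  ultimately show "ctx s'" "clean s'" "marked n s' = U \<union> C" "tracks U C (snd s' aT)"
    "fst s' rAlpha = card (C \<inter> A)" "fst s' rBeta = card (C - A)" by simp_all
qed

text \<open>The marked set is kept closed under adjacency outside \<open>S\<close>. An unmarked
  \<open>r\<close> therefore has a wholly unmarked clique, and each clique is processed at its least
  member.\<close>

lemma sem_c_phase2:
  assumes s: "ctx s" "clean s" "marked n s = S" "tracks S {} (snd s aT)"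
  defines "s' \<equiv> sem c_phase2 s"
  shows "ctx s'" "clean s'" "tracks {..<n} {} (snd s' aT)"
proof -
  let ?I = "\<lambda>i s'. ctx s' \<and> clean s' \<and> tracks (marked n s') {} (snd s' aT) \<and>
    S \<subseteq> marked n s' \<and> {..<i} \<subseteq> marked n s' \<and>
    (\<forall>u w. u \<in> marked n s' - S \<longrightarrow> adj u w \<longrightarrow> w \<notin> S \<longrightarrow> w \<in> marked n s')"
  have "?I n s'"
    unfolding s'_def c_phase2_def
  proof (rule For_bound[where I = ?I, OF ctxD(1)[OF s(1)]], goal_cases)
    case 1
    then show ?case using s by simp
  next
    case (2 r s1)
    let ?U = "marked n s1"
    let ?C = "clique_of r"
    let ?t = "setr rR r s1"
    have I: "ctx s1" "clean s1" "tracks ?U {} (snd s1 aT)" and SU: "S \<subseteq> ?U" and less: "{..<r} \<subseteq> ?U"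
      and I': "\<forall>u w. u \<in> ?U - S \<longrightarrow> adj u w \<longrightarrow> w \<notin> S \<longrightarrow> w \<in> ?U"
      using 2(2) by simp_all
    have closed: "w \<in> ?U" if "u \<in> ?U" "u \<notin> S" "adj u w" "w \<notin> S" for u w
      using I' that by simp
    have t: "ctx ?t" "clean ?t" "fst ?t rR = r" "marked n ?t = ?U"
      using ctx_setr[OF I(1)] I(2) by simp_all
    have hold: "holds (Not_expr (Cell aDone (Reg rR))) ?t \<longleftrightarrow> r \<notin> ?U" using 2(1) by (simp add: marked_def)
    show ?case
    proof (cases "r \<in> ?U")
      case True
      then have "{..<Suc r} \<subseteq> ?U" using less by (simp add: lessThan_Suc)
      moreover have "\<not> holds (Not_expr (Cell aDone (Reg rR))) ?t" using hold True by blast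
      then have run: "sem (If (Not_expr (Cell aDone (Reg rR))) c SkipC) ?t = ?t" for c
        by (simp only: sem.simps(1,5) if_False)
      ultimately show ?thesis unfolding run t(4) snd_setr using t(1,2) I(3) SU I' by (intro conjI)
    next
      case False
      then have rS: "r \<notin> S" using SU by blast
      have disj: "?U \<inter> ?C = {}"
      proof (rule ccontr)
        assume "?U \<inter> ?C \<noteq> {}"
        then obtain v where v: "v \<in> ?U" "v \<notin> S" "v = r \<or> adj r v" by (auto simp: clique_of_def)
        then have "adj v r" using False adj_sym by blast
        then show False using closed[OF v(1,2) _ rS] False by blast
      qed
      let ?u = "setr rBeta 0 (setr rAlpha 0 ?t)"
      have u: "ctx ?u" "clean ?u" "marked n ?u = ?U" "tracks ?U {} (snd ?u aT)" "fst ?u rR = r"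
          "fst ?u rAlpha = 0" "fst ?u rBeta = 0"
        using I(2,3) t by (auto intro!: ctx_setr)
      define w where "w = sem c_collect ?u"
      note w = sem_c_collect[OF u(1-5) 2(1) False SU disj u(6,7), folded w_def]
      let ?w = "sem (c_step c_clique) w"
      note st = sem_step_clique[OF w(1,2), unfolded w(5,6)]
      have Cn: "?C \<inter> ?U = {}" "?C \<inter> S = {}" "?C \<subseteq> {..<n}" using disj by (auto simp: clique_of_def)
      have tr: "tracks (?U \<union> ?C) {} (snd ?w aT)"
        by (rule tracks_clique[OF w(4) st(1) Cn SU clique_of[OF 2(1) rS]])
      have m: "marked n ?w = ?U \<union> ?C"
        unfolding w(3)[symmetric] by (rule marked_cong, rule frame_arr) simp
      have rC: "r \<in> ?C" using 2(1) rS by (simp add: clique_of_def)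
      have run: "sem (If (Not_expr (Cell aDone (Reg rR)))
          (Assign rAlpha (Num 0) ;; Assign rBeta (Num 0) ;; c_collect ;; c_step c_clique) SkipC) ?t = ?w"
      proof -
        have "holds (Not_expr (Cell aDone (Reg rR))) ?t" using hold False by blast
        then show ?thesis by (simp only: sem.simps(2,4,5) eval.simps(1) if_True w_def)
      qed
      have "{..<Suc r} \<subseteq> ?U \<union> ?C" using less rC by (auto simp: lessThan_Suc)
      moreover have "w \<in> ?U \<union> ?C" if uw: "u \<in> ?U \<union> ?C - S" "adj u w" "w \<notin> S" for u w
      proof (cases "u \<in> ?U")
        case True
        then show ?thesis using closed[OF True _ uw(2,3)] uw(1) by simp
      next
        case False
        then show ?thesis using clique_of(2)[OF 2(1) rS _ uw(2,3)] uw(1) by simp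
      qed
      moreover have "S \<subseteq> ?U \<union> ?C" using SU by (rule le_supI1)
      ultimately show ?thesis
        unfolding run m using ctx_step_clique[OF w(1)] st(2) tr by (intro conjI allI impI)
    qed
  qed
  then have I: "ctx s'" "clean s'" "tracks (marked n s') {} (snd s' aT)" "{..<n} \<subseteq> marked n s'"
    by - (elim conjE, assumption)+
  have "marked n s' \<subseteq> {..<n}" by (auto simp: marked_def)
  with I(4) have m: "marked n s' = {..<n}" by (rule subset_antisym[rotated])
  show "ctx s'" "clean s'" "tracks {..<n} {} (snd s' aT)" using I(1-3) unfolding m .
qed

lemma sem_c_answer:
  assumes s: "ctx s" "clean s"
  shows "fst (sem c_answer s) rFlag = (if \<exists>c<N. fst s 1 < snd s aT c \<and> final (dec c) then 1 else 0)"
proof -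
  let ?T = "snd s aT" and ?k = "fst s 1"
  have check: "fst (sem c_final s') rOk \<noteq> 0 \<longleftrightarrow> final (snd s' aX)" if s': "ctx s'" "fst s' rOk \<noteq> 0" for s'
  proof -
    let ?X = "snd s' aX"
    let ?fin = "\<lambda>i. pos i < l \<longrightarrow> (?X i = 0 \<longleftrightarrow> ?X (Suc i) = 0)"
    let ?I = "\<lambda>j t. fst t rOk \<noteq> 0 \<longleftrightarrow> (\<forall>i<j. ?fin i)"
    have "?I D (sem c_final s')"
      unfolding c_final_def
    proof (rule For_bound[where I = ?I, OF ctxD(4)[OF s'(1)]], goal_cases)
      case 1
      then show ?case using s'(2) by simp
    next
      case (2 j t)
      let ?t = "setr rJ j t"
      have t: "ctx ?t" by (intro ctx_setr ctx_cong[OF s'(1)]) (auto intro!: 2(3,4))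
      have "snd t aX = ?X" by (rule 2(4)) simp
      then have "holds (And_expr (Less_expr pos_expr (Reg 2)) (Not_expr (Iff_expr digit_expr next_expr))) ?t
          \<longleftrightarrow> \<not> ?fin j"
        using ctxD(2)[OF t] ctxD(10)[OF t 2(1)] by (auto simp: pos_expr_def digit_expr_def next_expr_def)
      moreover have "(\<forall>i<Suc j. ?fin i) \<longleftrightarrow> (\<forall>i<j. ?fin i) \<and> ?fin j" by (auto simp: less_Suc_eq)
      ultimately show ?case using 2(2) by simp
    qed
    then show ?thesis by (simp add: final_def)
  qed
  define s1 where "s1 = setr rFlag 0 s"
  have s1: "ctx s1" unfolding s1_def by (rule ctx_setr[OF s(1)]) simp
  let ?ans = "\<lambda>c. ?k < ?T c \<and> final (dec c)"
  let ?I = "\<lambda>i t. clean t \<and> fst t rFlag = (if \<exists>c<i. ?ans c then 1 else 0)"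
  let ?c = "If (Less_expr (Reg 1) (Cell aT (Reg rC)))
     (c_dec ;; Assign rOk (Num 1) ;; c_final ;; If (Reg rOk) (Assign rFlag (Num 1)) SkipC) SkipC"
  have "?I N (sem (For rC rN ?c) s1)"
  proof (rule For_bound[where I = ?I, OF ctxD(5)[OF s1]], goal_cases)
    case 1
    then show ?case using s(2) by (simp add: s1_def clean_def)
  next
    case (2 i t)
    let ?t = "setr rC i t"
    have t: "ctx ?t" "clean ?t"
      using 2(2) by (auto intro!: ctx_setr ctx_cong[OF s1] 2(3,4) simp: clean_def)
    have kT: "fst ?t 1 = ?k" "snd ?t aT = ?T" using 2(3)[of 1] 2(4)[of aT] by (simp_all add: s1_def)
    have ex: "(\<exists>c<Suc i. ?ans c) \<longleftrightarrow> (\<exists>c<i. ?ans c) \<or> ?ans i" by (auto simp: less_Suc_eq)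
    show ?case
    proof (cases "?k < ?T i")
      case True
      define d where "d = setr rOk 1 (sem c_dec ?t)"
      have d: "ctx d" unfolding d_def by (intro ctx_setr ctx_sem t) simp_all
      have dX: "snd d aX = dec i" using sem_c_dec[OF t(1) _ t(2)] 2(1) by (simp add: d_def)
      have ok: "fst (sem c_final d) rOk \<noteq> 0 \<longleftrightarrow> final (dec i)"
        using check[OF d] dX by (simp add: d_def)
      have run: "sem ?c ?t = sem (If (Reg rOk) (Assign rFlag (Num 1)) SkipC) (sem c_final d)"
        using True kT by (simp add: d_def)
      have f: "fst (sem c_final d) rFlag = fst t rFlag" "snd (sem c_final d) aX = dec i"
        using dX by (simp_all add: frame_reg frame_arr d_def del: sem.simps(6))
      have "clean (sem c_final d)" using f(2) digits_dec clean_iff_digits by metis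
      then have cl: "clean (sem ?c ?t)" unfolding run by (simp del: sem.simps(6))
      have "fst (sem ?c ?t) rFlag = (if final (dec i) then 1 else fst t rFlag)"
        unfolding run using ok f(1) by (simp del: sem.simps(6))
      moreover have "fst t rFlag = (if \<exists>c<i. ?ans c then 1 else 0)" using 2(2) by (rule conjunct2)
      ultimately show ?thesis unfolding ex using cl True by (cases "final (dec i)") simp_all
    next
      case False
      then have "\<not> holds (Less_expr (Reg 1) (Cell aT (Reg rC))) ?t" using kT by simp
      then have "sem ?c ?t = ?t" by (simp only: sem.simps if_False)
      moreover have "fst ?t rFlag = (if \<exists>c<i. ?ans c then 1 else 0)" using 2(2) by simp
      ultimately show ?thesis unfolding ex using False t(2) by (simp only: simp_thms)
    qed
  qed
  then show ?thesis by (simp add: c_answer_def s1_def)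
qed

end

section \<open>The algorithm\<close>

definition c_prep :: cmd where
  "c_prep = c_row ;; c_select ;; c_code ;; c_slots"

definition c_number :: cmd where
  "c_number = Assign rN (Num 1) ;; c_power"

definition c_dp :: cmd where
  "c_dp = c_phase1 ;; c_phase2 ;; c_answer"

text \<open>For \<open>l = 0\<close> there is no \<open>A\<close>-path, so only \<open>k = 0\<close>
  is solvable; the answer is then \<open>1 - k\<close>, whatever the table says.\<close>

definition c_output :: cmd where
  "c_output = If (Reg 2) (Assign 0 (Reg rFlag)) (Assign 0 (Not_expr (Reg 1)))"

definition c_alg :: cmd where
  "c_alg = c_prep ;; c_pos ;; c_number ;; c_dp ;; c_output"

lemmas cmd_defs = c_row_def c_select_def c_mark_def c_code_def c_slots_def c_pos_def c_power_def
  c_div_def c_dec_def c_enc_def c_relax_def c_vertex_def c_check_def c_recolor_def c_yield_def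
  c_clique_def c_step_def c_phase1_def c_collect_def c_phase2_def c_final_def c_answer_def c_prep_def c_number_def c_dp_def
  c_output_def c_alg_def

lemmas expr_defs = cond_P3_def adj_expr_def pos_expr_def digit_expr_def prev_expr_def next_expr_def
  endp_expr_def compat_expr_def open_expr_def bool_expr_defs

text \<open>The highest register is \<open>rI2\<close>, number 27, so the compiler may use scratch
  registers from 28 on.\<close>

lemma cmd_regs_alg: "cmd_regs c_alg \<subseteq> {..<28}"
  by (simp add: cmd_defs expr_defs)

lemma mods_prep [simp]:
  "rmods c_row = {rAcc, rU}" "amods c_row = {aRow}"
  "rmods c_select = {rU, rV, rW}" "amods c_select = {aDone}"
  "rmods c_code = {rB, rV}" "amods c_code = {aSv, aCode}"
  "rmods c_slots = {rS, rL, rD}" "amods c_slots = {}"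
  "rmods c_pos = {rI, rJ, rD}" "amods c_pos = {aPos}"
  "rmods c_number = {rN, rJ, rAcc, rI}" "amods c_number = {}"
  "rmods c_prep = {rAcc, rU, rV, rW, rB, rS, rL, rD}" "amods c_prep = {aRow, aDone, aSv, aCode}"
  by (auto simp: cmd_defs)

lemma loop_regs_prep: "loop_regs c_prep = {0}"
  and loop_regs_pos: "loop_regs c_pos = {rS, rL}"
  and loop_regs_number: "loop_regs c_number = {rD, rB}"
  and loop_regs_dp: "loop_regs c_dp = {0, rB, rD, rN}"
  and loop_regs_output: "loop_regs c_output = {}"
  by (auto simp: cmd_defs)

lemma rmods_dp: "{0, 1, 2, rB, rD, rN} \<inter> rmods c_dp = {}"
  by (simp add: c_dp_def c_phase1_def c_collect_def c_phase2_def c_answer_def)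

subsection \<open>State after the preparation\<close>

text \<open>The minimum is attained because deleting all vertices leaves an empty cluster graph. Two
  blocks sharing the middle vertex of a path coincide, so no induced path on three vertices survives
  outside \<open>K\<close>.\<close>

lemma cvd_witness:
  assumes "simple_graph {..<n} E"
  obtains K where "K \<subseteq> {..<n}" "card K = cvd {..<n} E" "\<And>u v w. \<not> P3 E K u v w"
proof -
  let ?R = "\<lambda>d. \<exists>S\<subseteq>{..<n}. card S = d \<and> cluster_graph ({..<n} - S) {e \<in> E. e \<subseteq> {..<n} - S}"
  have "{e \<in> E. e \<subseteq> {}} = {}" using assms unfolding simple_graph_def by auto
  then have "cluster_graph ({..<n} - {..<n}) {e \<in> E. e \<subseteq> {..<n} - {..<n}}"
    unfolding cluster_graph_def by (intro exI[of _ "{}"]) (simp add: partition_on_def)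
  then have "?R (card {..<n})" by blast
  then have "?R (LEAST d. ?R d)" by (rule LeastI)
  then obtain K where K: "K \<subseteq> {..<n}" "card K = cvd {..<n} E"
    and cl: "cluster_graph ({..<n} - K) {e \<in> E. e \<subseteq> {..<n} - K}"
    unfolding cvd_def by blast
  from cl obtain \<C> where part: "partition_on ({..<n} - K) \<C>"
    and E: "{e \<in> E. e \<subseteq> {..<n} - K} = {{u, v} | u v. u \<noteq> v \<and> (\<exists>C\<in>\<C>. u \<in> C \<and> v \<in> C)}"
    unfolding cluster_graph_def by blast
  have same: "\<exists>C\<in>\<C>. u \<in> C \<and> v \<in> C" if "{u, v} \<in> E" "u \<notin> K" "v \<notin> K" for u v
  proof -
    have "{u, v} \<subseteq> {..<n}" using that(1) assms unfolding simple_graph_def by blast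
    then have "{u, v} \<in> {e \<in> E. e \<subseteq> {..<n} - K}" using that by simp
    then obtain a b where ab: "{u, v} = {a, b}" "\<exists>C\<in>\<C>. a \<in> C \<and> b \<in> C" unfolding E by blast
    then show ?thesis by (metis doubleton_eq_iff)
  qed
  have "\<not> P3 E K u v w" for u v w
  proof
    assume p: "P3 E K u v w"
    then obtain C C' where C: "C \<in> \<C>" "u \<in> C" "v \<in> C" and C': "C' \<in> \<C>" "v \<in> C'" "w \<in> C'"
      using same[of u v] same[of v w] unfolding P3_def by blast
    have "C = C'"
      using part C(1,3) C'(1,2) unfolding partition_on_def disjoint_def by blast
    then have "{u, w} \<in> {{u, v} | u v. u \<noteq> v \<and> (\<exists>C\<in>\<C>. u \<in> C \<and> v \<in> C)}"
      using C C' p unfolding P3_def by blast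
    then have "{u, w} \<in> E" unfolding E[symmetric] by blast
    then show False using p unfolding P3_def by blast
  qed
  then show thesis using that K by blast
qed

lemma sem_prep:
  fixes k l :: nat
  assumes graph: "simple_graph {..<n} E" and A: "A \<subseteq> {..<n}"
  defines "s \<equiv> sem c_prep (input n E A k l)"
  defines "S \<equiv> marked n s"
  shows "fst s 0 = n" "fst s 1 = k" "fst s 2 = l" "fst s rB = card S + 3" "fst s rS = card S"
    "fst s rL = Suc l" "fst s rD = 0"
    and "card S \<le> 3 * cvd {..<n} E" "\<And>u v w. \<not> P3 E S u v w" "adjacency n E s"
    and "v \<in> S \<Longrightarrow> 3 \<le> snd s aCode v \<and> snd s aCode v < card S + 3 \<and> snd s aSv (snd s aCode v) = v"
    and "v < n \<Longrightarrow> v \<notin> S \<Longrightarrow> snd s aCode v = 2"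
    and "3 \<le> i \<Longrightarrow> i < card S + 3 \<Longrightarrow> snd s aSv i < n"
    and "snd s aA v \<noteq> 0 \<longleftrightarrow> v \<in> A" "snd s aT = (\<lambda>_. 0)" "snd s aX = (\<lambda>_. 0)"
proof -
  define s0 where "s0 = input n E A k l"
  define s1 where "s1 = sem c_row s0"
  define s2 where "s2 = sem c_select s1"
  define s3 where "s3 = sem c_code s2"
  have s: "s = sem c_slots s3" by (simp add: s_def c_prep_def s3_def s2_def s1_def s0_def)
  have in0: "fst s0 0 = n" "fst s0 1 = k" "fst s0 2 = l" by (simp_all add: s0_def input_def)
  have nE: "e \<subseteq> {..<n}" "card e = 2" if "e \<in> E" for e
    using graph that unfolding simple_graph_def by blast+
  have row: "snd s1 aRow u = u * n" if "u < n" for u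
    unfolding s1_def using sem_c_row[of u s0] that in0(1) by simp
  have adj0: "snd s1 aAdj = snd s0 aAdj" by (simp add: s1_def frame_arr)
  have adj1: "adjacency n E s1"
    unfolding adjacency_def
  proof (intro allI impI)
    fix u v assume uv: "u < n" "v < n"
    \<comment> \<open>The index stays in the range \<open>i < n * n\<close> outside which the input
      array is 0.\<close>
    have "u * n + v < Suc u * n" using uv by simp
    also have "\<dots> \<le> n * n" using uv by (intro mult_right_mono) simp_all
    finally have "u * n + v < n * n" .
    moreover have "(u * n + v) div n = u" "(u * n + v) mod n = v" using uv by simp_all
    ultimately show "snd s1 aAdj (snd s1 aRow u + v) \<noteq> 0 \<longleftrightarrow> {u, v} \<in> E"
      using row[OF uv(1)] adj0 by (simp add: s0_def input_def)
  qed
  have n1: "fst s1 0 = n" using in0 by (simp add: s1_def frame_reg)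
  have m1: "marked n s1 = {}" by (simp add: s1_def frame_arr marked_def s0_def input_def)
  obtain K where K: "K \<subseteq> {..<n}" "card K = cvd {..<n} E" "\<And>u v w. \<not> P3 E K u v w"
    using cvd_witness[OF graph] by blast
  have noloop: "{v} \<notin> E" for v using nE(2)[of "{v}"] by auto
  have "packed n E K ({..<n} \<times> {..<n} \<times> {..<n}) (marked n s2)"
    unfolding s2_def by (rule sem_c_select[OF adj1 n1 m1 K(3) noloop])
  moreover have "marked n s2 = S"
    unfolding S_def marked_def s s3_def by (simp add: frame_arr)
  ultimately have p: "packed n E K ({..<n} \<times> {..<n} \<times> {..<n}) S" by simp
  have "finite K" using K(1) finite_subset by blast
  then have "card (S \<inter> K) \<le> card K" by (intro card_mono) auto
  then show "card S \<le> 3 * cvd {..<n} E" using p K(2) unfolding packed_def by linarith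
  show "\<not> P3 E S u v w" for u v w
  proof
    assume *: "P3 E S u v w"
    then have "u < n" "v < n" "w < n"
      using nE(1)[of "{u, v}"] nE(1)[of "{v, w}"] unfolding P3_def by simp_all
    with * show False using p unfolding packed_def by blast
  qed
  have n2: "fst s2 0 = n" using n1 by (simp add: s2_def frame_reg)
  note code = sem_c_code[OF n2, folded s3_def, unfolded \<open>marked n s2 = S\<close>]
  have arr: "snd s = snd s3" unfolding s by (auto simp: frame_arr fun_eq_iff)
  show "v \<in> S \<Longrightarrow> 3 \<le> snd s aCode v \<and> snd s aCode v < card S + 3 \<and> snd s aSv (snd s aCode v) = v"
    "v < n \<Longrightarrow> v \<notin> S \<Longrightarrow> snd s aCode v = 2"
    "3 \<le> i \<Longrightarrow> i < card S + 3 \<Longrightarrow> snd s aSv i < n"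
    unfolding arr by (fact code)+
  have B: "fst s3 rB = card S + 3" by (fact code)
  have l3: "fst s3 2 = l" using in0 by (simp add: s3_def s2_def s1_def frame_reg)
  show "fst s rB = card S + 3" "fst s rS = card S" "fst s rL = Suc l" "fst s rD = 0"
    using B l3 by (simp_all add: s c_slots_def)
  show "fst s 0 = n" "fst s 1 = k" "fst s 2 = l"
    using in0 by (simp_all add: s s3_def s2_def s1_def frame_reg)
  show "adjacency n E s"
    using adj1 unfolding adjacency_def s s3_def s2_def by (simp add: frame_arr)
  show "snd s aA v \<noteq> 0 \<longleftrightarrow> v \<in> A" "snd s aT = (\<lambda>_. 0)" "snd s aX = (\<lambda>_. 0)"
    by (simp_all add: s s3_def s2_def s1_def s0_def frame_arr input_def)
qed

lemma no_A_path_length_0: "A_path_packing V E A k 0 \<longleftrightarrow> k = 0"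
proof
  assume "A_path_packing V E A k 0"
  then obtain P where P: "length P = k" "\<forall>p\<in>set P. is_A_path V E A p \<and> path_length p = 0"
    unfolding A_path_packing_def by blast
  show "k = 0"
  proof (rule ccontr)
    assume "k \<noteq> 0"
    then obtain p where "p \<in> set P" using P(1) by (cases P) auto
    then have p: "is_A_path V E A p" "path_length p = 0" using P(2) by blast+
    then have "length p \<le> 1" by (simp add: path_length_def)
    moreover have "p \<noteq> []" using p(1) unfolding is_A_path_def is_path_def by blast
    ultimately have "hd p = last p" by (cases p) auto
    then show False using p(1) unfolding is_A_path_def by blast
  qed
qed (simp add: A_path_packing_def)

lemma sem_c_number:
  "fst (sem c_number s) rN = fst s rB ^ fst s rD"
  using sem_c_power[of "setr rN 1 s"] by (simp add: c_number_def)

lemma sem_c_alg: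
  fixes k l :: nat
  assumes graph: "simple_graph {..<n} E" and A: "A \<subseteq> {..<n}"
  defines "s \<equiv> input n E A k l"
  shows "fst (sem c_alg s) 0 = (if A_path_packing {..<n} E A k l then 1 else 0)"
proof -
  define s1 where "s1 = sem c_prep s"
  define s2 where "s2 = sem c_pos s1"
  define s3 where "s3 = sem c_number s2"
  define s4 where "s4 = sem c_dp s3"
  let ?S = "marked n s1"
  note prep = sem_prep[where k = k and l = l, OF graph A, folded s_def, folded s1_def]
  have alg: "sem c_alg s = sem c_output s4" by (simp add: c_alg_def s4_def s3_def s2_def s1_def)
  have r3: "fst s3 x = fst s1 x" if "x \<in> {0, 1, 2, rB}" for x
    using that unfolding s3_def s2_def by (auto simp: frame_reg)
  have r4: "fst s4 x = fst s1 x" if "x \<in> {0, 1, 2}" for x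
  proof -
    have "x \<notin> rmods c_dp" using that rmods_dp by blast
    then show ?thesis using r3[of x] that unfolding s4_def by (auto simp: frame_reg)
  qed
  show ?thesis
  proof (cases "l = 0")
    case True
    have "fst s4 2 = 0" "fst s4 1 = k" using r4 prep(2,3) True by simp_all
    then have "fst (sem c_output s4) 0 = (if k = 0 then 1 else 0)"
      by (simp add: c_output_def Not_expr_def)
    then show ?thesis unfolding alg True no_A_path_length_0 .
  next
    case False
    interpret instance_graph n l E A ?S
      using graph False by unfold_locales (auto simp: marked_def)
    interpret path_dp n l E A ?S "snd s1 aCode" "snd s1 aSv"
    proof
      show "{u, w} \<in> E" if "u \<notin> ?S" "v \<notin> ?S" "w \<notin> ?S" "u \<noteq> w" "{u, v} \<in> E" "{v, w} \<in> E" for u v w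
        using prep(9)[of u v w] that unfolding P3_def by blast
    qed (fact prep)+
    have D2: "fst s2 rD = D" unfolding s2_def D_def using sem_c_pos(1)[OF prep(6,7)] prep(5) by simp
    have B2: "fst s2 rB = B" unfolding s2_def B_def using prep(4) by (simp add: frame_reg)
    have a3: "snd s3 a = snd s1 a" if "a \<noteq> aPos" for a
      using that unfolding s3_def s2_def by (simp add: frame_arr)
    have p3: "snd s3 aPos j = pos j" if "j < D" for j
    proof -
      have "j < fst s1 rS * Suc l" using that prep(5) by (simp add: D_def)
      then have "snd s2 aPos j = pos j"
        unfolding s2_def pos_def by (rule sem_c_pos(2)[OF prep(6,7)])
      then show ?thesis unfolding s3_def by (simp add: frame_arr)
    qed
    have ctx: "ctx s3"
      unfolding ctx_def
    proof (intro conjI allI impI)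
      show "fst s3 0 = n" "fst s3 2 = l" using r3 prep(1,3) by simp_all
      show "fst s3 rB = B" using r3 prep(4) by (simp add: B_def)
      show "fst s3 rD = D" using D2 by (simp add: s3_def frame_reg)
      show "fst s3 rN = N" unfolding s3_def sem_c_number D2 B2 N_def ..
      show "snd s3 aA v \<noteq> 0 \<longleftrightarrow> v \<in> A" for v using a3 prep(14) by simp
      show "adjacency n E s3" using prep(10) a3 unfolding adjacency_def by simp
      show "snd s3 aCode v = snd s1 aCode v" "snd s3 aSv v = snd s1 aSv v" for v using a3 by simp_all
      show "j < D \<Longrightarrow> snd s3 aPos j = pos j" for j by (rule p3)
    qed
    have "clean s3" using a3 prep(16) by (simp add: clean_def)
    moreover have "marked n s3 = ?S" using a3 by (simp add: marked_def)
    moreover have "snd s3 aT = (\<lambda>_. 0)" using a3 prep(15) by simp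
    ultimately have ph1: "ctx (sem c_phase1 s3)" "clean (sem c_phase1 s3)"
      "marked n (sem c_phase1 s3) = ?S" "tracks ?S {} (snd (sem c_phase1 s3) aT)"
      by (rule sem_c_phase1[OF ctx])+
    define s' where "s' = sem c_phase2 (sem c_phase1 s3)"
    note ph2 = sem_c_phase2[OF ph1, folded s'_def]
    have "1 \<notin> rmods c_phase1 \<union> rmods c_phase2"
      by (simp add: c_phase1_def c_collect_def c_phase2_def)
    then have "fst s' 1 = fst s3 1" unfolding s'_def by (simp add: frame_reg)
    then have k: "fst s' 1 = k" using r3[of 1] prep(2) by simp
    have "s4 = sem c_answer s'" by (simp add: s4_def c_dp_def s'_def)
    then have "fst s4 rFlag = (if A_path_packing {..<n} E A k l then 1 else 0)"
      using sem_c_answer[OF ph2(1,2)] tracks_final[OF ph2(3), of k] k by simp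
    moreover have "fst s4 2 = l" using r4 prep(3) by simp
    ultimately show ?thesis using False unfolding alg by (simp add: c_output_def)
  qed
qed

subsection \<open>Time bound\<close>

text \<open>With \<open>y = 3 * x + 3\<close>, the base is at most \<open>y\<close>, the number of
  slots at most \<open>y ^ 2\<close> and the number of states at most \<open>y ^ (y ^ 2)\<close>,
  since \<open>card S <= 3 * x\<close> and \<open>l <= x\<close>. The command is cut into parts
  because loop bounds such as \<open>rD\<close> and \<open>rN\<close> are written by earlier parts,
  whereas \<open>time_le\<close> asks for bounds that the command leaves alone.\<close>

lemma time_c_alg:
  assumes graph: "simple_graph {..<n} E" and A: "A \<subseteq> {..<n}" and x: "cvd {..<n} E + l \<le> x"
  shows "time c_alg (input n E A k l) \<le>
    weight c_alg * (n + (3 * x + 3) + (3 * x + 3) ^ 2 + (3 * x + 3) ^ ((3 * x + 3) ^ 2) + 1) ^ depth c_alg"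
proof -
  define s where "s = input n E A k l"
  define s1 where "s1 = sem c_prep s"
  define s2 where "s2 = sem c_pos s1"
  define s3 where "s3 = sem c_number s2"
  define s4 where "s4 = sem c_dp s3"
  let ?S = "marked n s1" and ?y = "3 * x + 3"
  define M where "M = n + ?y + ?y ^ 2 + ?y ^ (?y ^ 2)"
  note prep = sem_prep[where k = k and l = l, OF graph A, folded s_def, folded s1_def]
  have S: "card ?S \<le> 3 * x" using prep(8) x by linarith
  have D: "card ?S * Suc l \<le> ?y ^ 2"
    unfolding power2_eq_square using S x by (intro mult_mono) simp_all
  have "(card ?S + 3) ^ (card ?S * Suc l) \<le> ?y ^ (card ?S * Suc l)"
    using S by (intro power_mono) simp_all
  also have "\<dots> \<le> ?y ^ (?y ^ 2)" using D by (intro power_increasing) simp_all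
  finally have N: "(card ?S + 3) ^ (card ?S * Suc l) \<le> ?y ^ (?y ^ 2)" .
  have fB: "fst s2 rB = card ?S + 3" "fst s3 rB = card ?S + 3" "fst s3 0 = n"
    using prep(1,4) by (simp_all add: s3_def s2_def frame_reg)
  have fD: "fst s2 rD = card ?S * Suc l" unfolding s2_def sem_c_pos(1)[OF prep(6,7)] prep(5) ..
  then have fD': "fst s3 rD = card ?S * Suc l" by (simp add: s3_def frame_reg)
  have fN: "fst s3 rN = (card ?S + 3) ^ (card ?S * Suc l)"
    unfolding s3_def sem_c_number fB(1) fD ..
  have le: "time c t \<le> weight c * (M + 1) ^ depth c_alg"
    if "loop_regs c \<inter> rmods c = {}" "\<And>y. y \<in> loop_regs c \<Longrightarrow> fst t y \<le> M" "depth c \<le> depth c_alg" for c t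
  proof -
    have "time c t \<le> weight c * (M + 1) ^ depth c" by (rule time_le[OF that(1,2)])
    also have "\<dots> \<le> weight c * (M + 1) ^ depth c_alg"
      using that(3) by (intro mult_left_mono power_increasing) simp_all
    finally show ?thesis .
  qed
  have dp: "loop_regs c_dp \<inter> rmods c_dp = {}" unfolding loop_regs_dp using rmods_dp by blast
  have depths: "depth c_prep \<le> depth c_alg" "depth c_pos \<le> depth c_alg" "depth c_number \<le> depth c_alg"
    "depth c_dp \<le> depth c_alg" "depth c_output \<le> depth c_alg"
    unfolding c_alg_def depth.simps by linarith+
  have bounds: "n \<le> M" "card ?S \<le> M" "card ?S + 3 \<le> M" "Suc l \<le> M" "card ?S * Suc l \<le> M"
      "(card ?S + 3) ^ (card ?S * Suc l) \<le> M"
  proof -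
    have y: "?y \<le> M" "?y ^ 2 \<le> M" "?y ^ (?y ^ 2) \<le> M" "n \<le> M" unfolding M_def by linarith+
    show "card ?S \<le> M" "card ?S + 3 \<le> M" using S y(1) by linarith+
    show "Suc l \<le> M" using x y(1) by linarith
    show "card ?S * Suc l \<le> M" using D y(2) by (rule order_trans)
    show "(card ?S + 3) ^ (card ?S * Suc l) \<le> M" using N y(3) by (rule order_trans)
    show "n \<le> M" by (rule y)
  qed
  have 1: "time c_prep s \<le> weight c_prep * (M + 1) ^ depth c_alg"
    by (rule le) (simp_all add: loop_regs_prep depths s_def input_def bounds)
  have 2: "time c_pos s1 \<le> weight c_pos * (M + 1) ^ depth c_alg"
  proof (rule le)
    show "fst s1 z \<le> M" if "z \<in> loop_regs c_pos" for z
      using that bounds(2,4) prep(5,6) unfolding loop_regs_pos by (metis empty_iff insert_iff)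
  qed (simp_all add: loop_regs_pos depths)
  have 3: "time c_number s2 \<le> weight c_number * (M + 1) ^ depth c_alg"
  proof (rule le)
    show "fst s2 z \<le> M" if "z \<in> loop_regs c_number" for z
      using that bounds(3,5) fB(1) fD unfolding loop_regs_number by (metis empty_iff insert_iff)
  qed (simp_all add: loop_regs_number depths)
  have 4: "time c_dp s3 \<le> weight c_dp * (M + 1) ^ depth c_alg"
  proof (rule le[OF dp])
    show "fst s3 z \<le> M" if "z \<in> loop_regs c_dp" for z
      using that bounds(1,3,5,6) fB(2,3) fD' fN unfolding loop_regs_dp by (metis empty_iff insert_iff)
  qed (rule depths)
  have 5: "time c_output s4 \<le> weight c_output * (M + 1) ^ depth c_alg"
    by (rule le) (simp_all add: loop_regs_output depths)
  have "time c_alg s = time c_prep s + (time c_pos s1 + (time c_number s2 + (time c_dp s3 + time c_output s4)))"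
    by (simp only: c_alg_def s4_def s3_def s2_def s1_def time.simps)
  also have "\<dots> \<le> (weight c_prep + (weight c_pos + (weight c_number + (weight c_dp + weight c_output))))
      * (M + 1) ^ depth c_alg"
    using 1 2 3 4 5 unfolding distrib_right by linarith
  also have "weight c_prep + (weight c_pos + (weight c_number + (weight c_dp + weight c_output))) = weight c_alg"
    by (simp only: c_alg_def weight.simps)
  finally show ?thesis unfolding s_def M_def .
qed

section \<open>A computable bound for the parameter\<close>

definition c_tower :: "nat \<Rightarrow> cmd" where
  "c_tower C = Assign 1 (Num C) ;; For 2 0 (Assign 1 (Add (Reg 1) (Num C))) ;;
     Assign 3 (Num 1) ;; For 2 1 (Assign 3 (Add (Reg 3) (Reg 3))) ;;
     Assign 0 (Num 1) ;; For 2 3 (Assign 0 (Add (Reg 0) (Reg 0)))"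

lemma sem_doubling_loop:
  assumes "x \<noteq> i"
  shows "fst (sem (For i y (Assign x (Add (Reg x) (Reg x)))) s) x = fst s x * 2 ^ fst s y"
  by (rule For_rule[where I = "\<lambda>j s'. fst s' x = fst s x * 2 ^ j"]) (use assms in simp_all)

text \<open>A double exponential is large enough for the time bound and easy to compute: two loops
  of repeated doubling, started from \<open>C * (x + 1)\<close>.\<close>

lemma computable_tower: "computable (\<lambda>x. 2 ^ 2 ^ (C * (x + 1)))"
  unfolding computable_def
proof (rule exI, rule allI)
  fix x
  let ?s = "((\<lambda>_. 0)(0 := x), \<lambda>_ _. 0) :: state"
  have "cmd_regs (c_tower C) \<subseteq> {..<4}" by (simp add: c_tower_def)
  from exec_compile[OF this, of ?s] obtain s' where
    s': "exec (compile 4 (c_tower C)) ?s (time (c_tower C) ?s) s'" "agree 4 s' (sem (c_tower C) ?s)"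
    by blast
  define s1 where "s1 = sem (For 2 0 (Assign 1 (Add (Reg 1) (Num C)))) (setr 1 C ?s)"
  define s2 where "s2 = sem (For 2 1 (Assign 3 (Add (Reg 3) (Reg 3)))) (setr 3 1 s1)"
  have "fst s1 1 = C + fst (setr 1 C ?s) 0 * C"
    unfolding s1_def by (rule For_rule[where I = "\<lambda>j s'. fst s' 1 = C + j * C"]) simp_all
  then have 1: "fst s1 1 = C * (x + 1)" by simp
  have "fst s2 3 = 1 * 2 ^ fst s1 1"
    unfolding s2_def by (subst sem_doubling_loop) simp_all
  then have 2: "fst s2 3 = 2 ^ (C * (x + 1))" unfolding 1 by simp
  have "sem (c_tower C) ?s = sem (For 2 3 (Assign 0 (Add (Reg 0) (Reg 0)))) (setr 0 1 s2)"
    by (simp add: c_tower_def s2_def s1_def)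
  then have "fst (sem (c_tower C) ?s) 0 = 2 ^ fst s2 3"
    by (simp only:) (subst sem_doubling_loop, simp_all)
  moreover have "fst s' 0 = fst (sem (c_tower C) ?s) 0" using s'(2) by (simp add: agree_def)
  ultimately have "fst s' 0 = 2 ^ 2 ^ (C * (x + 1))" unfolding 2 by simp
  with s'(1) show "\<exists>t s. exec (compile 4 (c_tower C)) ?s t s \<and> fst s 0 = 2 ^ 2 ^ (C * (x + 1))" by blast
qed

lemma le_two_power: "(m :: nat) \<le> 2 ^ m"
  by (rule less_imp_le) (rule less_exp)

text \<open>All estimates go through \<open>m <= 2 ^ m\<close>; the dominating term is at most
  \<open>Z = 2 ^ (y ^ 3)\<close>. The dependence on \<open>n\<close> splits off as a power of
  \<open>max 1 n\<close>, which is positive also for \<open>n = 0\<close>.\<close>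

lemma tower_bound:
  fixes W h x n :: nat
  defines "y \<equiv> 3 * x + 3"
  shows "W * (n + y + y ^ 2 + y ^ (y ^ 2) + 1) ^ h \<le>
    2 ^ 2 ^ ((W + 2 * h + 11) * (x + 1)) * max 1 n ^ h"
proof -
  define Z :: nat where "Z = 2 ^ (y ^ 3)"
  define m where "m = max 1 n"
  have y1: "1 \<le> y" by (simp add: y_def)
  have a: "y \<le> y ^ 3" using power_increasing[OF _ y1, of 1 3] by simp
  have b: "y ^ 2 \<le> y ^ 3" using power_increasing[OF _ y1, of 2 3] by simp
  have "(2::nat) ^ y \<le> Z" unfolding Z_def by (rule power_increasing[OF a]) simp
  with le_two_power have Z1: "y \<le> Z" by (rule order_trans)
  have "(2::nat) ^ (y ^ 2) \<le> Z" unfolding Z_def by (rule power_increasing[OF b]) simp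
  with le_two_power have Z1': "y ^ 2 \<le> Z" by (rule order_trans)
  have "y ^ (y ^ 2) \<le> (2 ^ y) ^ (y ^ 2)" by (rule power_mono[OF le_two_power]) simp
  also have "\<dots> = Z" unfolding Z_def power_mult[symmetric] by (simp add: power2_eq_square power3_eq_cube mult.assoc)
  finally have Z2: "y ^ (y ^ 2) \<le> Z" .
  have m: "1 \<le> m" "n \<le> m" by (simp_all add: m_def)
  have "1 \<le> Z" by (simp add: Z_def)
  then have mZ: "m \<le> m * Z" "Z \<le> m * Z" using m(1) by simp_all
  \<comment> \<open>Five summands, each at most \<open>m * Z\<close>; 8 is the next power of
    2.\<close>
  have "n + y + y ^ 2 + y ^ (y ^ 2) + 1 \<le> m * (8 * Z)"
    using Z1 Z1' Z2 m mZ by linarith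
  also have "\<dots> = m * 2 ^ (y ^ 3 + 3)" by (simp add: Z_def power_add)
  finally have "(n + y + y ^ 2 + y ^ (y ^ 2) + 1) ^ h \<le> (m * 2 ^ (y ^ 3 + 3)) ^ h"
    by (rule power_mono) simp
  then have "W * (n + y + y ^ 2 + y ^ (y ^ 2) + 1) ^ h \<le> 2 ^ W * (m * 2 ^ (y ^ 3 + 3)) ^ h"
    by (rule mult_le_mono[OF le_two_power])
  also have "\<dots> = 2 ^ (W + (y ^ 3 + 3) * h) * m ^ h"
    by (simp add: power_mult_distrib power_add power_mult)
  also have "\<dots> \<le> 2 ^ 2 ^ ((W + 2 * h + 11) * (x + 1)) * m ^ h"
  proof (intro mult_right_mono power_increasing)
    let ?X = "x + 1"
    have "y ^ 3 \<le> (2 ^ y) ^ 3" by (rule power_mono[OF le_two_power]) simp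
    also have "\<dots> = 2 ^ (9 * ?X)" unfolding power_mult[symmetric] by (simp add: y_def algebra_simps)
    finally have y3: "y ^ 3 \<le> 2 ^ (9 * ?X)" .
    have "(2::nat) ^ 9 \<le> 2 ^ (9 * ?X)" by (rule power_increasing) simp_all
    then have "3 \<le> (2::nat) ^ (9 * ?X)" by simp
    then have "(y ^ 3 + 3) * h \<le> (2 * 2 ^ (9 * ?X)) * 2 ^ h"
      using y3 by (intro mult_le_mono le_two_power) linarith
    also have "\<dots> = 2 ^ (9 * ?X + h + 1)" by (simp add: power_add)
    finally have "W + (y ^ 3 + 3) * h \<le> 2 ^ W + 2 ^ (9 * ?X + h + 1)"
      by (rule add_mono[OF le_two_power])
    also have "\<dots> \<le> 2 ^ (W + (9 * ?X + h + 1)) + 2 ^ (W + (9 * ?X + h + 1))"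
      by (rule add_mono; rule power_increasing; simp)
    also have "\<dots> = 2 ^ (W + (9 * ?X + h + 1) + 1)"
      by (simp only: Suc_eq_plus1[symmetric] power_Suc mult_2)
    also have "\<dots> \<le> 2 ^ ((W + 2 * h + 11) * ?X)"
    proof (rule power_increasing)
      \<comment> \<open>The 11 collects the 9 from the bound on \<open>y ^ 3\<close> and the two
        units added on the left.\<close>
      show "W + (9 * ?X + h + 1) + 1 \<le> (W + 2 * h + 11) * ?X" by (simp add: algebra_simps)
    qed simp
    finally show "W + (y ^ 3 + 3) * h \<le> 2 ^ ((W + 2 * h + 11) * ?X)" .
  qed simp_all
  finally show ?thesis unfolding m_def .
qed

theorem theorem3:
  "\<exists>(alg :: program) (f :: nat \<Rightarrow> nat) (c :: nat). computable f \<and>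
     (\<forall>(n :: nat) (E :: nat set set) (A :: nat set) (k :: nat) (l :: nat).
        simple_graph {..<n} E \<and> A \<subseteq> {..<n} \<longrightarrow>
        (\<exists>t s. exec alg (input n E A k l) t s \<and>
           fst s 0 = (if A_path_packing {..<n} E A k l then 1 else 0) \<and>
           t \<le> f (cvd {..<n} E + l) * max 1 n ^ c))"
proof -
  \<comment> \<open>Depends only on the fixed command \<open>c_alg\<close>, so \<open>f\<close> is
    the same for all instances.\<close>
  define C where "C = weight c_alg + 2 * depth c_alg + 11"
  have "\<exists>t s. exec (compile 28 c_alg) (input n E A k l) t s \<and>
      fst s 0 = (if A_path_packing {..<n} E A k l then 1 else 0) \<and>
      t \<le> 2 ^ 2 ^ (C * ((cvd {..<n} E + l) + 1)) * max 1 n ^ depth c_alg"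
    if graph: "simple_graph {..<n} E" and A: "A \<subseteq> {..<n}" for n E A k l
  proof -
    let ?s = "input n E A k l"
    obtain s' where s': "exec (compile 28 c_alg) ?s (time c_alg ?s) s'" "agree 28 s' (sem c_alg ?s)"
      using exec_compile[OF cmd_regs_alg] by blast
    have "fst s' 0 = fst (sem c_alg ?s) 0" using s'(2) by (simp add: agree_def)
    also have "\<dots> = (if A_path_packing {..<n} E A k l then 1 else 0)" by (rule sem_c_alg[OF graph A])
    finally have out: "fst s' 0 = (if A_path_packing {..<n} E A k l then 1 else 0)" .
    have "time c_alg ?s \<le> 2 ^ 2 ^ (C * ((cvd {..<n} E + l) + 1)) * max 1 n ^ depth c_alg"
      unfolding C_def by (rule order_trans[OF time_c_alg[OF graph A order_refl] tower_bound])
    with s'(1) out show ?thesis by blast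
  qed
  with computable_tower[of C] show ?thesis
    by (intro exI[of _ "compile 28 c_alg"] exI[of _ "\<lambda>x. 2 ^ 2 ^ (C * (x + 1))"]
        exI[of _ "depth c_alg"]) blast
qed

end
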